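(* Let $f$ be a continuous map and $X$ an isolated invariant set for $f$. Assume that the first cohomological Conley index $h^1(f,X)$ (with coefficients in $\mathbb C$) has a nonzero eigenvalue $\lambda\in\mathbb C$ that is not a root of unity. Then at least one of the following holds: (i) $X$ has infinitely many connected components. (ii) $f^*\colon\check H^1(X;\mathbb C)\to\check H^1(X;\mathbb C)$ has $\lambda$ as an eigenvalue. In particular, if the phase space is $\mathbb R^2$ and $f$ is a homeomorphism, then $X$ must have infinitely many connected components (because (ii) cannot hold).
   Context: Setting. $M$ (the phase space) is a locally compact, paracompact Hausdorff space, $f\colon D\to M$ is a continuous map defined on an open set $D\subseteq M$. $\check H^*$ denotes Čech cohomology. For $A\subseteq D$, $\mathrm{Inv}(A)$ is the set of $p\in A$ for which there is a sequence $(p_i)_{i\in\mathbb Z}$ in $A$ with $p_0=p$ and $f(p_i)=p_{i+1}$ for all $i$. A compact set $X\subseteq D$ with $f(X)=X$ is an isolated invariant set if it has a compact neighbourhood $A\subseteq D$ with $X=\mathrm{Inv}(A)$ (such $A$ is an isolating neighbourhood of $X$). The map $f^*$ on $\check H^1(X;\mathbb C)$ is induced by $f|_X$. Index pairs. An index pair for $f$ and $X$ is a pair of compact sets $L\subseteq N\subseteq D$ such that (i) $\overline{N\setminus L}$ is an isolating neighbourhood of $X$ and $X\cap L=\emptyset$; (ii) $f(N\setminus L)\subseteq N$; (iii) $f(L)\cap N\subseteq L$. The index map is the continuous map $f_\#\colon (N/L,[L])\to(N/L,[L])$ of the pointed quotient space given by $f_\#(p)=f(p)$ if $p,f(p)\in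 N\setminus L$ and $f_\#(p)=[L]$ otherwise (if $L=\emptyset$, $N/L$ is $N$ with a disjoint base point added). Conley index. The first cohomological Conley index $h^1(f,X)$ is the shift equivalence class of $f_\#^*\colon\check H^1(N/L,[L];\mathbb C)\to\check H^1(N/L,[L];\mathbb C)$; it does not depend on the index pair. Its nonzero eigenvalues are the nonzero eigenvalues of $f_\#^*$ for any index pair with finite dimensional cohomology (these do not depend on the index pair). Standing assumption. $X$ has an index pair $(N,L)$ such that $\check H^q(N/L;\mathbb C)$ is finite dimensional in every degree (automatic if $M$ is a locally compact metrizable absolute neighbourhood retract, e.g. a topological manifold). *)

theory Defs
  imports "HOL-Analysis.Analysis" "Jordan_Normal_Form.VS_Connect"
begin

section \<open>Cech cohomology with complex coefficients\<close>

definition cech_cover :: "'a topology \<Rightarrow> 'a set set \<Rightarrow> bool" where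
  "cech_cover X U \<longleftrightarrow> (\<forall>u\<in>U. openin X u) \<and> \<Union>U = topspace X"

text \<open>The ordered simplices of the nerve of \<open>U\<close>: a simplex of dimension \<open>q\<close> is a list of length
  \<open>Suc q\<close>, repetitions allowed.\<close>

definition nerve :: "'a set set \<Rightarrow> 'a set list set" where
  "nerve U = {s. s \<noteq> [] \<and> set s \<subseteq> U \<and> \<Inter>(set s) \<noteq> {}}"

text \<open>The \<open>q\<close>-cochains of \<open>U\<close> relative to \<open>A\<close> are the kernel of the restriction to the cover
  \<open>{u \<inter> A | u \<in> U}\<close> of \<open>A\<close>. Cochains are extended by zero outside the \<open>q\<close>-simplices of the nerve.
  Absolute cohomology is the case \<open>A = {}\<close>.\<close>

definition cech_cochains :: "'a set \<Rightarrow> nat \<Rightarrow> 'a set set \<Rightarrow> ('a set list \<Rightarrow> complex) set" where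
  "cech_cochains A q U =
     {c. \<forall>s. c s \<noteq> 0 \<longrightarrow> s \<in> nerve U \<and> length s = Suc q \<and> \<Inter>(set s) \<inter> A = {}}"

definition cech_coboundary ::
    "'a set set \<Rightarrow> ('a set list \<Rightarrow> complex) \<Rightarrow> 'a set list \<Rightarrow> complex" where
  "cech_coboundary U c s =
     (if s \<in> nerve U then \<Sum>i<length s. (- 1) ^ i * c (take i s @ drop (Suc i) s) else 0)"

definition cech_cocycles ::
    "'a topology \<Rightarrow> 'a set \<Rightarrow> nat \<Rightarrow> ('a set set \<times> ('a set list \<Rightarrow> complex)) set" where
  "cech_cocycles X A q =
     {(U, c). cech_cover X U \<and> c \<in> cech_cochains A q U \<and> (\<forall>s. cech_coboundary U c s = 0)}"

definition cech_coboundaries ::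
    "'a set \<Rightarrow> nat \<Rightarrow> 'a set set \<Rightarrow> ('a set list \<Rightarrow> complex) set" where
  "cech_coboundaries A q U =
     (case q of 0 \<Rightarrow> {\<lambda>s. 0} | Suc p \<Rightarrow> cech_coboundary U ` cech_cochains A p U)"

text \<open>For \<open>g = id\<close> this says that \<open>r\<close> is a refinement projection from \<open>V\<close> to \<open>U\<close>; in general it is
  a refinement projection from \<open>V\<close> to the preimage of the cover \<open>U\<close> under \<open>g\<close>.\<close>

definition cech_refines ::
    "('a \<Rightarrow> 'b) \<Rightarrow> 'a set set \<Rightarrow> 'b set set \<Rightarrow> ('a set \<Rightarrow> 'b set) \<Rightarrow> bool" where
  "cech_refines g V U r \<longleftrightarrow> (\<forall>v\<in>V. r v \<in> U \<and> g ` v \<subseteq> r v)"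

definition cech_pullback ::
    "('a set \<Rightarrow> 'b set) \<Rightarrow> 'a set set \<Rightarrow> ('b set list \<Rightarrow> complex) \<Rightarrow> 'a set list \<Rightarrow> complex" where
  "cech_pullback r V c s = (if s \<in> nerve V then c (map r s) else 0)"

text \<open>Two cocycles on two covers are identified when they become cohomologous on a common
  refinement; the classes are the elements of the direct limit over all open covers.\<close>

definition cech_rel ::
    "'a topology \<Rightarrow> 'a set \<Rightarrow> nat \<Rightarrow>
      (('a set set \<times> ('a set list \<Rightarrow> complex)) \<times> ('a set set \<times> ('a set list \<Rightarrow> complex))) set" where
  "cech_rel X A q =
     {((U, c), (V, d)). (U, c) \<in> cech_cocycles X A q \<and> (V, d) \<in> cech_cocycles X A q \<and>
        (\<exists>W r s. cech_cover X W \<and> cech_refines id W U r \<and> cech_refines id W V s \<and>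
           (\<lambda>t. cech_pullback r W c t - cech_pullback s W d t) \<in> cech_coboundaries A q W)}"

type_synonym 'a cech_elem = "('a set set \<times> ('a set list \<Rightarrow> complex)) set"

definition cech_class ::
    "'a topology \<Rightarrow> 'a set \<Rightarrow> nat \<Rightarrow> 'a set set \<Rightarrow> ('a set list \<Rightarrow> complex) \<Rightarrow> 'a cech_elem" where
  "cech_class X A q U c = cech_rel X A q `` {(U, c)}"

text \<open>The operations below are unions over all choices of representatives (any two classes have
  representatives on a common cover). All choices give the same class, so the union is that class.
  The fields \<open>mult\<close> and \<open>one\<close> of a module record play no role.\<close>

definition cech :: "'a topology \<Rightarrow> 'a set \<Rightarrow> nat \<Rightarrow> (complex, 'a cech_elem) module" where
  "cech X A q =
     \<lparr>carrier = cech_cocycles X A q // cech_rel X A q,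
      mult = undefined,
      one = undefined,
      zero = cech_class X A q {topspace X} (\<lambda>s. 0),
      add = (\<lambda>\<xi> \<eta>. \<Union>{cech_class X A q U (\<lambda>s. c s + d s) |U c d. (U, c) \<in> \<xi> \<and> (U, d) \<in> \<eta>}),
      smult = (\<lambda>a \<xi>. \<Union>{cech_class X A q U (\<lambda>s. a * c s) |U c. (U, c) \<in> \<xi>})\<rparr>"

text \<open>The map induced by a continuous map \<open>g\<close> from the pair \<open>(X, A)\<close> to some pair \<open>(Y, B)\<close>, applied
  to a class \<open>\<xi>\<close> of \<open>(Y, B)\<close>.\<close>

definition cech_map ::
    "'a topology \<Rightarrow> 'a set \<Rightarrow> nat \<Rightarrow> ('a \<Rightarrow> 'b) \<Rightarrow> 'b cech_elem \<Rightarrow> 'a cech_elem" where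
  "cech_map X A q g \<xi> =
     \<Union>{cech_class X A q V (cech_pullback r V c) |U c V r.
         (U, c) \<in> \<xi> \<and> cech_cover X V \<and> cech_refines g V U r}"

definition finite_dimensional_cech :: "'a topology \<Rightarrow> bool" where
  "finite_dimensional_cech X \<longleftrightarrow>
     (\<forall>q. vectorspace.fin_dim (class_ring :: complex ring) (cech X {} q))"

definition linear_eigenvalue :: "('k, 'v, 'm) module_scheme \<Rightarrow> ('v \<Rightarrow> 'v) \<Rightarrow> 'k \<Rightarrow> bool" where
  "linear_eigenvalue V T \<mu> \<longleftrightarrow> (\<exists>v \<in> carrier V. v \<noteq> \<zero>\<^bsub>V\<^esub> \<and> T v = \<mu> \<odot>\<^bsub>V\<^esub> v)"


section \<open>Isolated invariant sets and index pairs\<close>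

definition paracompact_space :: "'a topology \<Rightarrow> bool" where
  "paracompact_space X \<longleftrightarrow>
     (\<forall>\<U>. (\<forall>u\<in>\<U>. openin X u) \<and> \<Union>\<U> = topspace X \<longrightarrow>
       (\<exists>\<V>. (\<forall>v\<in>\<V>. openin X v) \<and> \<Union>\<V> = topspace X \<and>
            (\<forall>v\<in>\<V>. \<exists>u\<in>\<U>. v \<subseteq> u) \<and> locally_finite_in X \<V>))"

definition Inv :: "('a \<Rightarrow> 'a) \<Rightarrow> 'a set \<Rightarrow> 'a set" where
  "Inv f A = {p \<in> A. \<exists>x :: int \<Rightarrow> 'a. range x \<subseteq> A \<and> x 0 = p \<and> (\<forall>i. f (x i) = x (i + 1))}"

definition isolating_neighbourhood ::
    "'a topology \<Rightarrow> 'a set \<Rightarrow> ('a \<Rightarrow> 'a) \<Rightarrow> 'a set \<Rightarrow> 'a set \<Rightarrow> bool" where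
  "isolating_neighbourhood M D f X A \<longleftrightarrow>
     compactin M A \<and> A \<subseteq> D \<and> X \<subseteq> M interior_of A \<and> X = Inv f A"

definition isolated_invariant_set ::
    "'a topology \<Rightarrow> 'a set \<Rightarrow> ('a \<Rightarrow> 'a) \<Rightarrow> 'a set \<Rightarrow> bool" where
  "isolated_invariant_set M D f X \<longleftrightarrow>
     compactin M X \<and> X \<subseteq> D \<and> f ` X = X \<and> (\<exists>A. isolating_neighbourhood M D f X A)"

definition index_pair ::
    "'a topology \<Rightarrow> 'a set \<Rightarrow> ('a \<Rightarrow> 'a) \<Rightarrow> 'a set \<Rightarrow> 'a set \<Rightarrow> 'a set \<Rightarrow> bool" where
  "index_pair M D f X N L \<longleftrightarrow>
     compactin M N \<and> compactin M L \<and> L \<subseteq> N \<and> N \<subseteq> D \<and>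
     isolating_neighbourhood M D f X (M closure_of (N - L)) \<and> X \<inter> L = {} \<and>
     f ` (N - L) \<subseteq> N \<and>
     f ` L \<inter> N \<subseteq> L"

text \<open>The point \<open>[L]\<close> of \<open>N/L\<close> is \<open>None\<close> and a point \<open>p\<close> of \<open>N - L\<close> is \<open>Some p\<close>. For \<open>L = {}\<close> the
  topology below makes \<open>None\<close> an isolated point.\<close>

definition collapse :: "'a set \<Rightarrow> 'a \<Rightarrow> 'a option" where
  "collapse L p = (if p \<in> L then None else Some p)"

definition pointed_quotient :: "'a topology \<Rightarrow> 'a set \<Rightarrow> 'a set \<Rightarrow> 'a option topology" where
  "pointed_quotient M N L =
     topology (\<lambda>W. W \<subseteq> insert None (Some ` (N - L)) \<and>
                   openin (subtopology M N) {p \<in> topspace (subtopology M N). collapse L p \<in> W})"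

lemma openin_pointed_quotient:
  "openin (pointed_quotient M N L) W \<longleftrightarrow>
     W \<subseteq> insert None (Some ` (N - L)) \<and>
     openin (subtopology M N) {p \<in> topspace (subtopology M N). collapse L p \<in> W}"
proof -
  let ?T = "subtopology M N"
  let ?P = "\<lambda>W. W \<subseteq> insert None (Some ` (N - L)) \<and>
                 openin ?T {p \<in> topspace ?T. collapse L p \<in> W}"
  have 1: "?P (S \<inter> T)" if "?P S" "?P T" for S T
  proof -
    have "{p \<in> topspace ?T. collapse L p \<in> S \<inter> T} =
          {p \<in> topspace ?T. collapse L p \<in> S} \<inter> {p \<in> topspace ?T. collapse L p \<in> T}"
      by blast
    then show ?thesis using that by (auto intro: openin_Int)
  qed
  have 2: "?P (\<Union>K)" if "\<forall>S\<in>K. ?P S" for K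
  proof -
    have "{p \<in> topspace ?T. collapse L p \<in> \<Union>K} =
          (\<Union>S\<in>K. {p \<in> topspace ?T. collapse L p \<in> S})"
      by blast
    moreover have "openin ?T (\<Union>S\<in>K. {p \<in> topspace ?T. collapse L p \<in> S})"
      using that by (intro openin_Union) blast
    ultimately show ?thesis using that by (metis (no_types, lifting) Union_least)
  qed
  have "istopology ?P"
    unfolding istopology_def using 1 2 by blast
  then show ?thesis
    unfolding pointed_quotient_def by (simp add: topology_inverse')
qed

lemma topspace_pointed_quotient:
  assumes "N \<subseteq> topspace M"
  shows "topspace (pointed_quotient M N L) = insert None (Some ` (N - L))"
proof
  show "topspace (pointed_quotient M N L) \<subseteq> insert None (Some ` (N - L))"
    using openin_pointed_quotient[of M N L] openin_topspace by blast
  have "{p \<in> topspace (subtopology M N). collapse L p \<in> insert None (Some ` (N - L))} =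
        topspace (subtopology M N)"
    by (auto simp: collapse_def)
  then have "openin (pointed_quotient M N L) (insert None (Some ` (N - L)))"
    unfolding openin_pointed_quotient by (metis openin_topspace subset_refl)
  then show "insert None (Some ` (N - L)) \<subseteq> topspace (pointed_quotient M N L)"
    by (rule openin_subset)
qed

definition index_map :: "('a \<Rightarrow> 'a) \<Rightarrow> 'a set \<Rightarrow> 'a set \<Rightarrow> 'a option \<Rightarrow> 'a option" where
  "index_map f N L z =
     (case z of None \<Rightarrow> None
      | Some p \<Rightarrow> if p \<in> N - L \<and> f p \<in> N - L then Some (f p) else None)"

text \<open>Nonzero eigenvalues of the first cohomological Conley index. They do not depend on the index
  pair with finite dimensional cohomology, so the choice of one such pair is immaterial.\<close>

definition conley_index1_nonzero_eigenvalue ::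
    "'a topology \<Rightarrow> 'a set \<Rightarrow> ('a \<Rightarrow> 'a) \<Rightarrow> 'a set \<Rightarrow> complex \<Rightarrow> bool" where
  "conley_index1_nonzero_eigenvalue M D f X \<mu> \<longleftrightarrow>
     \<mu> \<noteq> 0 \<and>
     (\<exists>N L. index_pair M D f X N L \<and> finite_dimensional_cech (pointed_quotient M N L) \<and>
        linear_eigenvalue (cech (pointed_quotient M N L) {None} 1)
          (cech_map (pointed_quotient M N L) {None} 1 (index_map f N L)) \<mu>)"

end

theory Submission
  imports Defs "HOL-Combinatorics.Cycles"
begin

text \<open>
  A degree-one class is a torsor under the constant sheaf: a cocycle \<open>(U, c)\<close> represents zero iff
  the torsor that it glues has a global section, that is, a family of locally constant functions
  \<open>s _ u\<close> on the members \<open>u\<close> of \<open>U\<close> with \<open>s x v = s x u + c [u, v]\<close>.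

  Let \<open>F\<close> be the index map and let \<open>\<xi>\<close> be an eigenclass for \<open>\<mu>\<close> whose restriction to \<open>X\<close> is zero.
  A section over \<open>X\<close> can be made invariant under the pull-back by \<open>F\<close>, because \<open>F\<close> permutes the
  finitely many components of \<open>X\<close> and \<open>\<mu>\<close> is no root of unity; it extends to a neighbourhood of \<open>X\<close>.
  The zero section at the base point, which attracts in finite time, extends to its whole basin by
  pulling back. The two differ by a locally constant function \<open>g\<close> with \<open>g \<circ> F = \<mu> g\<close>, which takes
  finitely many values on a fundamental domain of the unstable set of \<open>X\<close>. As \<open>\<mu>\<close> is no root of unity,
  \<open>g\<close> can be cut off between \<open>X\<close> and the fundamental domain, so that the two sections can be glued over the
  unstable set. Pulling back once more gives a global section, hence \<open>\<xi> = 0\<close>.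

  In the plane every class on \<open>X\<close> is a finite combination of the classes of \<open>z \<mapsto> z - a\<close>, with one
  point \<open>a\<close> in each of finitely many holes of \<open>X\<close>, and these classes are independent. The inverse of a
  homeomorphism permutes them up to sign, so the squares of the coefficients of an eigenclass form a
  finite set closed under division by \<open>\<mu>\<^sup>2\<close>, and \<open>\<mu>\<close> would be a root of unity.
\<close>

text \<open>The gluing needs a locally constant function on the unstable set that is
  \<open>g\<close> near \<open>X\<close> and 0 near the base point. Switching at a fixed stage of
  the orbits would in general create a jump, because the set where the switch happens need not be
  open and closed in the unstable set. The switch is therefore made by the value of \<open>g\<close>
  and not by position alone: on the compact set where a jump could occur, \<open>g\<close> takes
  none of the nonzero values that are kept. The glued section is not invariant and need not be;
  invariance of the two pieces serves only to control the values of \<open>g\<close>.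

  In the plane \<open>f\<close> is given on \<open>D\<close> only, whereas its inverse is defined
  everywhere, so the inverse is the map that acts. It is an embedding of the plane, possibly not
  onto; a puncture outside its image contributes a trivial class. Maps to the circle see integral
  cocycles only, so complex coefficients are reduced to integral ones: a cocycle with finitely many
  values is split by rational coordinates, and a linear relation is made rational by a functional
  that is linear over the rationals.\<close>

section \<open>Torsors and classes of degree one\<close>

text \<open>A link from \<open>P\<close> to \<open>R\<close> over \<open>g\<close> is an isomorphism from the torsor of \<open>P\<close> to the pull-back under \<open>g\<close>
  of the torsor of \<open>R\<close>, written in the charts \<open>u\<close> at \<open>x\<close> and \<open>v\<close> at \<open>g x\<close>. It exists iff \<open>P\<close> represents
  the pull-back of the class of \<open>R\<close>. Working with links avoids choosing refinements.\<close>

definition cech_link ::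
    "'a topology \<Rightarrow> 'a set \<Rightarrow> ('a \<Rightarrow> 'b) \<Rightarrow> 'a set set \<times> ('a set list \<Rightarrow> complex) \<Rightarrow>
      'b set set \<times> ('b set list \<Rightarrow> complex) \<Rightarrow> ('a \<Rightarrow> 'a set \<Rightarrow> 'b set \<Rightarrow> complex) \<Rightarrow> bool" where
  "cech_link X A g P R h \<longleftrightarrow>
     (\<forall>x u u' v v'. u \<in> fst P \<and> u' \<in> fst P \<and> v \<in> fst R \<and> v' \<in> fst R \<and>
        x \<in> u \<and> x \<in> u' \<and> g x \<in> v \<and> g x \<in> v' \<longrightarrow>
        h x u' v' = h x u v - snd P [u, u'] + snd R [v, v']) \<and>
     (\<forall>x u v. u \<in> fst P \<and> v \<in> fst R \<and> x \<in> u \<and> g x \<in> v \<longrightarrow>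
        (\<exists>w. openin X w \<and> x \<in> w \<and> (\<forall>y\<in>w. y \<in> u \<and> g y \<in> v \<longrightarrow> h y u v = h x u v))) \<and>
     (\<forall>x u v. u \<in> fst P \<and> v \<in> fst R \<and> x \<in> u \<and> g x \<in> v \<and> x \<in> A \<longrightarrow> h x u v = 0)"

lemma cech_linkI:
  assumes "\<And>x u u' v v'. \<lbrakk>u \<in> U; u' \<in> U; v \<in> V; v' \<in> V; x \<in> u; x \<in> u'; g x \<in> v; g x \<in> v'\<rbrakk> \<Longrightarrow>
        h x u' v' = h x u v - c [u, u'] + d [v, v']"
    and "\<And>x u v. \<lbrakk>u \<in> U; v \<in> V; x \<in> u; g x \<in> v\<rbrakk> \<Longrightarrow>
        \<exists>w. openin X w \<and> x \<in> w \<and> (\<forall>y\<in>w. y \<in> u \<and> g y \<in> v \<longrightarrow> h y u v = h x u v)"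
    and "\<And>x u v. \<lbrakk>u \<in> U; v \<in> V; x \<in> u; g x \<in> v; x \<in> A\<rbrakk> \<Longrightarrow> h x u v = 0"
  shows "cech_link X A g (U, c) (V, d) h"
  unfolding cech_link_def fst_conv snd_conv
  by (intro conjI allI impI; elim conjE; (rule assms(1) | rule assms(2) | rule assms(3)); assumption)

lemma cech_link_change:
  assumes "cech_link X A g (U, c) (V, d) h"
    and "u \<in> U" "u' \<in> U" "v \<in> V" "v' \<in> V" "x \<in> u" "x \<in> u'" "g x \<in> v" "g x \<in> v'"
  shows "h x u' v' = h x u v - c [u, u'] + d [v, v']"
  by (rule assms(1)[unfolded cech_link_def fst_conv snd_conv, THEN conjunct1, rule_format])
    (intro conjI assms)

lemma cech_link_locally_const:
  assumes "cech_link X A g (U, c) (V, d) h" "u \<in> U" "v \<in> V" "x \<in> u" "g x \<in> v"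
  shows "\<exists>w. openin X w \<and> x \<in> w \<and> (\<forall>y\<in>w. y \<in> u \<and> g y \<in> v \<longrightarrow> h y u v = h x u v)"
  by (rule assms(1)[unfolded cech_link_def fst_conv snd_conv, THEN conjunct2, THEN conjunct1,
        THEN spec, THEN spec, THEN spec, THEN mp])
    (intro conjI assms)

lemma cech_link_zero:
  assumes "cech_link X A g (U, c) (V, d) h" "u \<in> U" "v \<in> V" "x \<in> u" "g x \<in> v" "x \<in> A"
  shows "h x u v = 0"
  by (rule assms(1)[unfolded cech_link_def fst_conv snd_conv, THEN conjunct2, THEN conjunct2,
        rule_format])
    (intro conjI assms)

section \<open>Cochains and cocycles of degree one\<close>

lemma nerve_pair: "[u, v] \<in> nerve U \<longleftrightarrow> u \<in> U \<and> v \<in> U \<and> u \<inter> v \<noteq> {}"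
  by (auto simp: nerve_def)

lemma nerve_triple: "[u, v, w] \<in> nerve U \<longleftrightarrow> u \<in> U \<and> v \<in> U \<and> w \<in> U \<and> u \<inter> v \<inter> w \<noteq> {}"
  by (auto simp: nerve_def)

lemma cech_cochains1_iff:
  "c \<in> cech_cochains A 1 U \<longleftrightarrow>
     (\<forall>s. c s \<noteq> 0 \<longrightarrow> (\<exists>u v. s = [u, v] \<and> u \<in> U \<and> v \<in> U \<and> u \<inter> v \<noteq> {} \<and> u \<inter> v \<inter> A = {}))"
proof -
  have "s \<in> nerve U \<and> length s = Suc 1 \<and> \<Inter>(set s) \<inter> A = {} \<longleftrightarrow>
     (\<exists>u v. s = [u, v] \<and> u \<in> U \<and> v \<in> U \<and> u \<inter> v \<noteq> {} \<and> u \<inter> v \<inter> A = {})" for s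
  proof
    assume a: "s \<in> nerve U \<and> length s = Suc 1 \<and> \<Inter>(set s) \<inter> A = {}"
    then obtain u v where "s = [u, v]" by (auto simp: length_Suc_conv)
    with a show "\<exists>u v. s = [u, v] \<and> u \<in> U \<and> v \<in> U \<and> u \<inter> v \<noteq> {} \<and> u \<inter> v \<inter> A = {}"
      by (auto simp: nerve_pair)
  qed (auto simp: nerve_pair)
  then show ?thesis unfolding cech_cochains_def by simp
qed

lemma cech_coboundary_triple:
  "cech_coboundary U c [u, v, w] =
     (if [u, v, w] \<in> nerve U then c [v, w] - c [u, w] + c [u, v] else 0)"
proof -
  have "{..<length [u, v, w]} = {0, 1, 2}" by auto
  note e = this
  show ?thesis unfolding cech_coboundary_def e by (simp add: nerve_pair nerve_triple)
qed

lemma cech_coboundary_pair: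
  "cech_coboundary U c [u, v] = (if [u, v] \<in> nerve U then c [v] - c [u] else 0)"
proof -
  have "{..<length [u, v]} = {0, 1}" by auto
  note e = this
  show ?thesis unfolding cech_coboundary_def e by (simp add: nerve_pair nerve_triple)
qed

lemma cech_cocycles1_iff:
  "(U, c) \<in> cech_cocycles X A 1 \<longleftrightarrow>
     cech_cover X U \<and> c \<in> cech_cochains A 1 U \<and>
     (\<forall>u\<in>U. \<forall>v\<in>U. \<forall>w\<in>U. u \<inter> v \<inter> w \<noteq> {} \<longrightarrow> c [u, w] = c [u, v] + c [v, w])"
proof -
  have "(\<forall>s. cech_coboundary U c s = 0) \<longleftrightarrow>
     (\<forall>u\<in>U. \<forall>v\<in>U. \<forall>w\<in>U. u \<inter> v \<inter> w \<noteq> {} \<longrightarrow> c [u, w] = c [u, v] + c [v, w])" (is "?L \<longleftrightarrow> ?R")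
    if c: "c \<in> cech_cochains A 1 U"
  proof
    assume L: ?L
    show ?R
    proof (intro ballI impI)
      fix u v w assume "u \<in> U" "v \<in> U" "w \<in> U" "u \<inter> v \<inter> w \<noteq> {}"
      then show "c [u, w] = c [u, v] + c [v, w]"
        using L[rule_format, of "[u, v, w]"]
        by (auto simp: cech_coboundary_triple nerve_triple algebra_simps split: if_splits)
    qed
  next
    assume R: ?R
    show ?L
    proof
      fix s
      show "cech_coboundary U c s = 0"
      proof (cases "length s = 3")
        case True
        then obtain u v w where s: "s = [u, v, w]"
          by (auto simp: length_Suc_conv numeral_3_eq_3)
        show ?thesis
        proof (cases "[u, v, w] \<in> nerve U")
          case True
          then have "c [u, w] = c [u, v] + c [v, w]" using R unfolding nerve_triple by blast
          then show ?thesis by (simp add: s cech_coboundary_triple)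
        qed (simp add: s cech_coboundary_triple)
      next
        case False
        \<comment> \<open>Deleting an entry leaves a list of length other than 2, where a 1-cochain
          vanishes. So the cocycle condition concerns triples only.\<close>
        have "c (take i s @ drop (Suc i) s) = 0" if "i < length s" for i
        proof (rule ccontr)
          assume "c (take i s @ drop (Suc i) s) \<noteq> 0"
          then obtain u v where "take i s @ drop (Suc i) s = [u, v]"
            using c unfolding cech_cochains1_iff by blast
          then have "length (take i s @ drop (Suc i) s) = length [u, v]" by (rule arg_cong)
          moreover have "length (take i s @ drop (Suc i) s) = length s - 1" using that by simp
          ultimately show False using False that by simp
        qed
        then show ?thesis by (simp add: cech_coboundary_def)
      qed
    qed
  qed
  note key = this
  have eq: "(U, c) \<in> cech_cocycles X A 1 \<longleftrightarrow>
     cech_cover X U \<and> c \<in> cech_cochains A 1 U \<and> (\<forall>s. cech_coboundary U c s = 0)"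
    by (simp add: cech_cocycles_def)
  show ?thesis
  proof (cases "c \<in> cech_cochains A 1 U")
    case True
    show ?thesis unfolding eq key[OF True] by (rule refl)
  qed (simp add: eq del: One_nat_def)
qed

lemma cech_cover_point:
  "\<lbrakk>cech_cover X U; x \<in> topspace X\<rbrakk> \<Longrightarrow> \<exists>u\<in>U. x \<in> u"
  by (auto simp: cech_cover_def)

lemma cech_cover_mem: "\<lbrakk>cech_cover X U; u \<in> U; x \<in> u\<rbrakk> \<Longrightarrow> x \<in> topspace X"
  by (auto simp: cech_cover_def)

lemma cech_cover_open: "\<lbrakk>cech_cover X U; u \<in> U\<rbrakk> \<Longrightarrow> openin X u"
  by (auto simp: cech_cover_def)

lemma cech_cocycle_cover: "(U, c) \<in> cech_cocycles X A q \<Longrightarrow> cech_cover X U"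
  by (simp add: cech_cocycles_def)

lemma cech_cocycle_cochain: "(U, c) \<in> cech_cocycles X A q \<Longrightarrow> c \<in> cech_cochains A q U"
  by (simp add: cech_cocycles_def)

lemma cech_cocycle_support:
  assumes "(U, c) \<in> cech_cocycles X A 1" "c s \<noteq> 0"
  shows "\<exists>u v. s = [u, v] \<and> u \<in> U \<and> v \<in> U \<and> u \<inter> v \<noteq> {} \<and> u \<inter> v \<inter> A = {}"
  using cech_cocycle_cochain[OF assms(1)] assms(2) unfolding cech_cochains1_iff by blast

lemma cech_cocycle_add:
  "\<lbrakk>(U, c) \<in> cech_cocycles X A 1; u \<in> U; v \<in> U; w \<in> U; x \<in> u; x \<in> v; x \<in> w\<rbrakk> \<Longrightarrow>
     c [u, w] = c [u, v] + c [v, w]"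
  unfolding cech_cocycles1_iff by blast

lemma cech_cocycle_refl:
  "\<lbrakk>(U, c) \<in> cech_cocycles X A 1; u \<in> U; x \<in> u\<rbrakk> \<Longrightarrow> c [u, u] = 0"
  using cech_cocycle_add[of U c X A u u u x] by simp

lemma cech_cocycle_zero:
  "\<lbrakk>(U, c) \<in> cech_cocycles X A 1; x \<in> u; x \<in> v; x \<in> A\<rbrakk> \<Longrightarrow> c [u, v] = 0"
  unfolding cech_cocycles1_iff cech_cochains1_iff by blast

lemma cech_cocycle_smult:
  assumes "(U, c) \<in> cech_cocycles X A 1"
  shows "(U, \<lambda>s. a * c s) \<in> cech_cocycles X A 1"
  unfolding cech_cocycles1_iff
proof (intro conjI ballI impI)
  show "cech_cover X U" using assms by (rule cech_cocycle_cover)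
  show "(\<lambda>s. a * c s) \<in> cech_cochains A 1 U"
    using assms unfolding cech_cocycles1_iff cech_cochains1_iff mult_eq_0_iff by blast
  fix u v w assume "u \<in> U" "v \<in> U" "w \<in> U" "u \<inter> v \<inter> w \<noteq> {}"
  then have e: "c [u, w] = c [u, v] + c [v, w]"
    using assms unfolding cech_cocycles1_iff by blast
  show "a * c [u, w] = a * c [u, v] + a * c [v, w]" unfolding e by (rule distrib_left)
qed

lemma cech_cocycle_trivial: "({topspace X}, \<lambda>s. 0) \<in> cech_cocycles X A 1"
  unfolding cech_cocycles1_iff cech_cochains1_iff by (simp add: cech_cover_def)

section \<open>Composition and comparison of links\<close>

lemma continuous_map_preimage_open:
  assumes g: "continuous_map X Y g" and V: "cech_cover Y V" and x: "x \<in> topspace X"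
  obtains v w where "v \<in> V" "openin X w" "x \<in> w" "\<And>y. y \<in> w \<Longrightarrow> g y \<in> v"
proof -
  have "g x \<in> topspace Y" using g x by (auto simp: continuous_map_def)
  then obtain v where v: "v \<in> V" "g x \<in> v" using cech_cover_point[OF V] by blast
  have "openin X {y \<in> topspace X. g y \<in> v}"
    using g cech_cover_open[OF V v(1)] by (simp add: continuous_map_def)
  then show ?thesis using that[of v "{y \<in> topspace X. g y \<in> v}"] v x by blast
qed

lemma cech_link_smult:
  assumes "cech_link X A g (U, c) (V, d) h"
  shows "cech_link X A g (U, \<lambda>s. a * c s) (V, \<lambda>s. a * d s) (\<lambda>x u v. a * h x u v)"
proof (rule cech_linkI)
  fix x u u' v v'
  assume "u \<in> U" "u' \<in> U" "v \<in> V" "v' \<in> V" "x \<in> u" "x \<in> u'" "g x \<in> v" "g x \<in> v'"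
  note e = cech_link_change[OF assms this]
  show "a * h x u' v' = a * h x u v - a * c [u, u'] + a * d [v, v']"
    unfolding e by (simp add: algebra_simps)
next
  fix x u v
  assume "u \<in> U" "v \<in> V" "x \<in> u" "g x \<in> v"
  from cech_link_locally_const[OF assms this]
  show "\<exists>w. openin X w \<and> x \<in> w \<and> (\<forall>y\<in>w. y \<in> u \<and> g y \<in> v \<longrightarrow> a * h y u v = a * h x u v)"
    by metis
next
  fix x u v
  assume "u \<in> U" "v \<in> V" "x \<in> u" "g x \<in> v" "x \<in> A"
  from cech_link_zero[OF assms this]
  show "a * h x u v = 0" by simp
qed

text \<open>Isomorphisms of torsors compose through an intermediate chart \<open>v\<close> at
  \<open>g x\<close>. The terms in \<open>d\<close> of the two change formulas cancel, so the choice
  of \<open>v\<close> does not matter. This freedom gives local constancy, since one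
  \<open>v\<close> can be kept on a neighbourhood of \<open>x\<close>.\<close>

lemma cech_link_compose:
  assumes U: "cech_cover X U" and V: "cech_cover Y V"
    and g: "continuous_map X Y g" and gA: "\<And>x. x \<in> A \<Longrightarrow> x \<in> topspace X \<Longrightarrow> g x \<in> B"
    and h: "cech_link X A g (U, c) (V, d) h"
    and k: "cech_link Y B g' (V, d) (W, e) k"
  obtains l where "cech_link X A (g' \<circ> g) (U, c) (W, e) l"
proof -
  define v0 where "v0 y = (SOME v. v \<in> V \<and> y \<in> v)" for y
  have v0: "v0 y \<in> V" "y \<in> v0 y" if "y \<in> topspace Y" for y
    using someI_ex[of "\<lambda>v. v \<in> V \<and> y \<in> v"] cech_cover_point[OF V that] unfolding v0_def by auto
  have gY: "g x \<in> topspace Y" if "u \<in> U" "x \<in> u" for x u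
    using g cech_cover_mem[OF U that] by (auto simp: continuous_map_def)
  define l where "l x u w = h x u (v0 (g x)) + k (g x) (v0 (g x)) w" for x u w
  have l: "l x u w = h x u v + k (g x) v w"
    if "u \<in> U" "x \<in> u" "w \<in> W" "g' (g x) \<in> w" "v \<in> V" "g x \<in> v" for x u w v
  proof -
    note gx = gY[OF that(1,2)]
    have A: "h x u v = h x u (v0 (g x)) - c [u, u] + d [v0 (g x), v]"
      using cech_link_change[OF h that(1) that(1) v0(1)[OF gx] that(5) that(2) that(2) v0(2)[OF gx] that(6)] .
    \<comment> \<open>The cochains are not assumed to be cocycles, so diagonal terms need not
      vanish. The change formula with equal charts shows that they agree, and then they
      cancel.\<close>
    have E1: "c [u, u] = d [v, v]"
      using cech_link_change[OF h that(1) that(1) that(5,5) that(2) that(2) that(6,6)] by simp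
    have B: "k (g x) v w = k (g x) (v0 (g x)) w - d [v0 (g x), v] + e [w, w]"
      using cech_link_change[OF k v0(1)[OF gx] that(5,3,3) v0(2)[OF gx] that(6,4,4)] .
    have E2: "d [v, v] = e [w, w]"
      using cech_link_change[OF k that(5,5,3,3,6,6,4,4)] by simp
    show ?thesis unfolding l_def A B E1 E2 by simp
  qed
  have "cech_link X A (g' \<circ> g) (U, c) (W, e) l"
  proof (rule cech_linkI)
    fix x u u' w w'
    assume a: "u \<in> U" "u' \<in> U" "w \<in> W" "w' \<in> W" "x \<in> u" "x \<in> u'" "(g' \<circ> g) x \<in> w" "(g' \<circ> g) x \<in> w'"
    note gx = gY[OF a(1,5)]
    let ?v = "v0 (g x)"
    have a': "g' (g x) \<in> w" "g' (g x) \<in> w'" using a by auto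
    have A: "h x u' ?v = h x u ?v - c [u, u'] + d [?v, ?v]"
      using cech_link_change[OF h a(1,2) v0(1)[OF gx] v0(1)[OF gx] a(5,6) v0(2)[OF gx] v0(2)[OF gx]] .
    have B: "k (g x) ?v w' = k (g x) ?v w - d [?v, ?v] + e [w, w']"
      using cech_link_change[OF k v0(1)[OF gx] v0(1)[OF gx] a(3,4) v0(2)[OF gx] v0(2)[OF gx] a'] .
    show "l x u' w' = l x u w - c [u, u'] + e [w, w']"
      unfolding l_def A B by simp
  next
    fix x u w
    assume a: "u \<in> U" "w \<in> W" "x \<in> u" "(g' \<circ> g) x \<in> w"
    have xX: "x \<in> topspace X" using cech_cover_mem[OF U a(1,3)] .
    obtain v w1 where v: "v \<in> V" and w1: "openin X w1" "x \<in> w1" "\<And>y. y \<in> w1 \<Longrightarrow> g y \<in> v"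
      using continuous_map_preimage_open[OF g V xX] by blast
    have a': "g' (g x) \<in> w" using a by auto
    obtain w2 where w2: "openin X w2" "x \<in> w2" "\<forall>y\<in>w2. y \<in> u \<and> g y \<in> v \<longrightarrow> h y u v = h x u v"
      using cech_link_locally_const[OF h a(1) v a(3) w1(3)[OF w1(2)]] by blast
    obtain w3 where w3: "openin Y w3" "g x \<in> w3" "\<forall>y\<in>w3. y \<in> v \<and> g' y \<in> w \<longrightarrow> k y v w = k (g x) v w"
      using cech_link_locally_const[OF k v a(2) w1(3)[OF w1(2)] a'] by blast
    have op: "openin X {y \<in> topspace X. g y \<in> w3}"
      using g w3(1) by (simp add: continuous_map_def)
    let ?w = "w1 \<inter> w2 \<inter> {y \<in> topspace X. g y \<in> w3}"
    have "openin X ?w" using w1 w2 op by blast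
    moreover have "x \<in> ?w" using w1 w2 w3 xX by auto
    moreover have "l y u w = l x u w" if y: "y \<in> ?w" "y \<in> u" "(g' \<circ> g) y \<in> w" for y
    proof -
      have "l y u w = h y u v + k (g y) v w"
        by (rule l) (use a y v w1 in auto)
      also have "\<dots> = h x u v + k (g x) v w" using w2 w3 y w1 by auto
      also have "\<dots> = l x u w" by (rule l[symmetric]) (use a v w1 in auto)
      finally show ?thesis .
    qed
    ultimately show "\<exists>w'. openin X w' \<and> x \<in> w' \<and> (\<forall>y\<in>w'. y \<in> u \<and> (g' \<circ> g) y \<in> w \<longrightarrow> l y u w = l x u w)"
      by blast
  next
    fix x u w
    assume a: "u \<in> U" "w \<in> W" "x \<in> u" "(g' \<circ> g) x \<in> w" "x \<in> A"
    note gx = gY[OF a(1,3)]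
    have a': "g' (g x) \<in> w" using a by auto
    show "l x u w = 0"
      unfolding l_def
      using cech_link_zero[OF h a(1) v0(1)[OF gx] a(3) v0(2)[OF gx] a(5)]
        cech_link_zero[OF k v0(1)[OF gx] a(2) v0(2)[OF gx] a' gA[OF a(5) cech_cover_mem[OF U a(1,3)]]]
      by simp
  qed
  then show ?thesis by (rule that)
qed

text \<open>Two torsors with links to the same torsor over the same map are isomorphic: follow one
  link and return along the other. This takes the place of inverses and is the source of symmetry
  and of independence of choices below.\<close>

lemma cech_link_diff:
  assumes U: "cech_cover X U" and V: "cech_cover X V" and W: "cech_cover Y W"
    and g: "continuous_map X Y g"
    and h: "cech_link X A g (U, c) (W, e) h"
    and k: "cech_link X A g (V, d) (W, e) k"
  obtains l where "cech_link X A id (U, c) (V, d) l"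
proof -
  define w0 where "w0 y = (SOME w. w \<in> W \<and> y \<in> w)" for y
  have w0: "w0 y \<in> W" "y \<in> w0 y" if "y \<in> topspace Y" for y
    using someI_ex[of "\<lambda>w. w \<in> W \<and> y \<in> w"] cech_cover_point[OF W that] unfolding w0_def by auto
  have gY: "g x \<in> topspace Y" if "u \<in> U" "x \<in> u" for x u
    using g cech_cover_mem[OF U that] by (auto simp: continuous_map_def)
  define l where "l x u v = h x u (w0 (g x)) - k x v (w0 (g x))" for x u v
  have l: "l x u v = h x u w - k x v w"
    if "u \<in> U" "x \<in> u" "v \<in> V" "x \<in> v" "w \<in> W" "g x \<in> w" for x u v w
  proof -
    note gx = gY[OF that(1,2)]
    have A: "h x u w = h x u (w0 (g x)) - c [u, u] + e [w0 (g x), w]"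
      using cech_link_change[OF h that(1) that(1) w0(1)[OF gx] that(5) that(2) that(2) w0(2)[OF gx] that(6)] .
    have B: "k x v w = k x v (w0 (g x)) - d [v, v] + e [w0 (g x), w]"
      using cech_link_change[OF k that(3) that(3) w0(1)[OF gx] that(5) that(4) that(4) w0(2)[OF gx] that(6)] .
    have E1: "c [u, u] = e [w, w]"
      using cech_link_change[OF h that(1) that(1) that(5,5) that(2) that(2) that(6,6)] by simp
    have E2: "d [v, v] = e [w, w]"
      using cech_link_change[OF k that(3) that(3) that(5,5) that(4) that(4) that(6,6)] by simp
    show ?thesis unfolding l_def A B E1 E2 by simp
  qed
  have "cech_link X A id (U, c) (V, d) l"
  proof (rule cech_linkI)
    fix x u u' v v'
    assume a: "u \<in> U" "u' \<in> U" "v \<in> V" "v' \<in> V" "x \<in> u" "x \<in> u'" "id x \<in> v" "id x \<in> v'"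
    then have a': "x \<in> v" "x \<in> v'" by auto
    note gx = gY[OF a(1,5)]
    let ?w = "w0 (g x)"
    have A: "h x u' ?w = h x u ?w - c [u, u'] + e [?w, ?w]"
      using cech_link_change[OF h a(1,2) w0(1)[OF gx] w0(1)[OF gx] a(5,6) w0(2)[OF gx] w0(2)[OF gx]] .
    have B: "k x v' ?w = k x v ?w - d [v, v'] + e [?w, ?w]"
      using cech_link_change[OF k a(3,4) w0(1)[OF gx] w0(1)[OF gx] a' w0(2)[OF gx] w0(2)[OF gx]] .
    show "l x u' v' = l x u v - c [u, u'] + d [v, v']"
      unfolding l_def A B by simp
  next
    fix x u v
    assume a: "u \<in> U" "v \<in> V" "x \<in> u" "id x \<in> v"
    then have a': "x \<in> v" by auto
    have xX: "x \<in> topspace X" using cech_cover_mem[OF U a(1,3)] .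
    obtain w w1 where w: "w \<in> W" and w1: "openin X w1" "x \<in> w1" "\<And>y. y \<in> w1 \<Longrightarrow> g y \<in> w"
      using continuous_map_preimage_open[OF g W xX] by blast
    obtain w2 where w2: "openin X w2" "x \<in> w2" "\<forall>y\<in>w2. y \<in> u \<and> g y \<in> w \<longrightarrow> h y u w = h x u w"
      using cech_link_locally_const[OF h a(1) w a(3) w1(3)[OF w1(2)]] by blast
    obtain w3 where w3: "openin X w3" "x \<in> w3" "\<forall>y\<in>w3. y \<in> v \<and> g y \<in> w \<longrightarrow> k y v w = k x v w"
      using cech_link_locally_const[OF k a(2) w a' w1(3)[OF w1(2)]] by blast
    let ?w = "w1 \<inter> w2 \<inter> w3"
    have "openin X ?w" using w1 w2 w3 by blast
    moreover have "x \<in> ?w" using w1 w2 w3 xX by auto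
    moreover have "l y u v = l x u v" if y: "y \<in> ?w" "y \<in> u" "id y \<in> v" for y
    proof -
      have "l y u v = h y u w - k y v w"
        by (rule l) (use a y w w1 in auto)
      also have "\<dots> = h x u w - k x v w" using w2 w3 y w1 by auto
      also have "\<dots> = l x u v" by (rule l[symmetric]) (use a w w1 in auto)
      finally show ?thesis .
    qed
    ultimately show "\<exists>w'. openin X w' \<and> x \<in> w' \<and> (\<forall>y\<in>w'. y \<in> u \<and> id y \<in> v \<longrightarrow> l y u v = l x u v)"
      by blast
  next
    fix x u v
    assume a: "u \<in> U" "v \<in> V" "x \<in> u" "id x \<in> v" "x \<in> A"
    then have a': "x \<in> v" by auto
    note gx = gY[OF a(1,3)]
    show "l x u v = 0"
      unfolding l_def
      using cech_link_zero[OF h a(1) w0(1)[OF gx] a(3) w0(2)[OF gx] a(5)]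
        cech_link_zero[OF k a(2) w0(1)[OF gx] a' w0(2)[OF gx] a(5)]
      by simp
  qed
  then show ?thesis by (rule that)
qed

section \<open>Refinements and pull-backs as links\<close>

lemma cech_pullback_pair:
  "cech_pullback r V c [u, v] = (if [u, v] \<in> nerve V then c [r u, r v] else 0)"
  by (simp add: cech_pullback_def)

lemma cech_cochains0_iff:
  "a \<in> cech_cochains A 0 U \<longleftrightarrow> (\<forall>s. a s \<noteq> 0 \<longrightarrow> (\<exists>u. s = [u] \<and> u \<in> U \<and> u \<noteq> {} \<and> u \<inter> A = {}))"
proof -
  have "s \<in> nerve U \<and> length s = Suc 0 \<and> \<Inter>(set s) \<inter> A = {} \<longleftrightarrow>
     (\<exists>u. s = [u] \<and> u \<in> U \<and> u \<noteq> {} \<and> u \<inter> A = {})" for s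
    by (auto simp: nerve_def length_Suc_conv)
  then show ?thesis unfolding cech_cochains_def by simp
qed

lemma cech_pullback_cocycle:
  assumes c: "(U, c) \<in> cech_cocycles Y B 1" and g: "g ` A \<subseteq> B"
    and V: "cech_cover X V" and r: "cech_refines g V U r"
  shows "(V, cech_pullback r V c) \<in> cech_cocycles X A 1"
  unfolding cech_cocycles1_iff
proof (intro conjI ballI impI V)
  have r1: "r v \<in> U" "\<And>x. x \<in> v \<Longrightarrow> g x \<in> r v" if "v \<in> V" for v
    using r that by (auto simp: cech_refines_def)
  show "cech_pullback r V c \<in> cech_cochains A 1 V"
    unfolding cech_cochains1_iff
  proof (intro allI impI)
    fix s assume s: "cech_pullback r V c s \<noteq> 0"
    then have sV: "s \<in> nerve V" and cs: "c (map r s) \<noteq> 0"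
      by (auto simp: cech_pullback_def split: if_splits)
    obtain a b where ab: "map r s = [a, b]" "a \<inter> b \<inter> B = {}"
      using cech_cocycle_support[OF c cs] by (elim exE conjE) (rule that)
    then obtain u v where uv: "s = [u, v]" "a = r u" "b = r v"
      by (auto simp: map_eq_Cons_conv)
    have "u \<in> V" "v \<in> V" "u \<inter> v \<noteq> {}" using sV uv by (auto simp: nerve_pair)
    moreover have "u \<inter> v \<inter> A = {}"
      using ab(2) uv(2,3) r1(2)[OF \<open>u \<in> V\<close>] r1(2)[OF \<open>v \<in> V\<close>] g by blast
    ultimately show "\<exists>u v. s = [u, v] \<and> u \<in> V \<and> v \<in> V \<and> u \<inter> v \<noteq> {} \<and> u \<inter> v \<inter> A = {}"
      using uv by blast
  qed
  fix u v w assume a: "u \<in> V" "v \<in> V" "w \<in> V" "u \<inter> v \<inter> w \<noteq> {}"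
  then obtain x where x: "x \<in> u" "x \<in> v" "x \<in> w" by blast
  have n: "[u, w] \<in> nerve V" "[u, v] \<in> nerve V" "[v, w] \<in> nerve V"
    using a by (auto simp: nerve_pair)
  have e: "c [r u, r w] = c [r u, r v] + c [r v, r w]"
    by (rule cech_cocycle_add[OF c r1(1)[OF a(1)] r1(1)[OF a(2)] r1(1)[OF a(3)],
          of "g x"]) (use r1(2) a x in auto)
  show "cech_pullback r V c [u, w] = cech_pullback r V c [u, v] + cech_pullback r V c [v, w]"
    using n e by (simp add: cech_pullback_pair)
qed

text \<open>The isomorphism is the transition function of the target torsor from the chart
  \<open>r v\<close>, picked by the refinement, to an arbitrary chart \<open>u\<close>.\<close>

lemma cech_pullback_link:
  assumes c: "(U, c) \<in> cech_cocycles Y B 1" and g: "g ` A \<subseteq> B"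
    and V: "cech_cover X V" and r: "cech_refines g V U r"
  shows "cech_link X A g (V, cech_pullback r V c) (U, c) (\<lambda>x v u. c [r v, u])"
proof (rule cech_linkI)
  have r1: "r v \<in> U" "\<And>x. x \<in> v \<Longrightarrow> g x \<in> r v" if "v \<in> V" for v
    using r that by (auto simp: cech_refines_def)
  fix x v v' u u'
  assume a: "v \<in> V" "v' \<in> V" "u \<in> U" "u' \<in> U" "x \<in> v" "x \<in> v'" "g x \<in> u" "g x \<in> u'"
  note rv = r1(1)[OF a(1)] r1(2)[OF a(1,5)] r1(1)[OF a(2)] r1(2)[OF a(2,6)]
  have p: "cech_pullback r V c [v, v'] = c [r v, r v']"
    using a by (auto simp: cech_pullback_pair nerve_pair)
  have e1: "c [r v, u'] = c [r v, r v'] + c [r v', u']"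
    by (rule cech_cocycle_add[OF c rv(1,3) a(4) rv(2,4) a(8)])
  have e2: "c [r v, u'] = c [r v, u] + c [u, u']"
    by (rule cech_cocycle_add[OF c rv(1) a(3,4) rv(2) a(7,8)])
  show "c [r v', u'] = c [r v, u] - cech_pullback r V c [v, v'] + c [u, u']"
    unfolding p using e1 e2 by (simp add: algebra_simps)
next
  fix x v u assume "v \<in> V" "x \<in> v"
  then show "\<exists>w. openin X w \<and> x \<in> w \<and> (\<forall>y\<in>w. y \<in> v \<and> g y \<in> u \<longrightarrow> c [r v, u] = c [r v, u])"
    using cech_cover_open[OF V] by blast
next
  fix x v u assume a: "v \<in> V" "u \<in> U" "x \<in> v" "g x \<in> u" "x \<in> A"
  show "c [r v, u] = 0"
    by (rule cech_cocycle_zero[OF c, of "g x"]) (use a r g in \<open>auto simp: cech_refines_def\<close>)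
qed

lemma cech_refines_exists:
  assumes g: "continuous_map X Y g" and U: "cech_cover Y U"
  obtains V r where "cech_cover X V" "cech_refines g V U r"
proof -
  define V where "V = {v. openin X v \<and> (\<exists>u\<in>U. g ` v \<subseteq> u)}"
  define r where "r v = (SOME u. u \<in> U \<and> g ` v \<subseteq> u)" for v
  have "r v \<in> U \<and> g ` v \<subseteq> r v" if "v \<in> V" for v
    unfolding r_def by (rule someI_ex) (use that in \<open>auto simp: V_def\<close>)
  then have "cech_refines g V U r" by (simp add: cech_refines_def)
  moreover have "cech_cover X V"
    unfolding cech_cover_def
  proof (intro conjI ballI)
    show "\<Union>V = topspace X"
    proof
      show "topspace X \<subseteq> \<Union>V"
      proof
        fix x assume "x \<in> topspace X"
        then obtain v w where "v \<in> U" "openin X w" "x \<in> w" "\<And>y. y \<in> w \<Longrightarrow> g y \<in> v"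
          using continuous_map_preimage_open[OF g U] by blast
        then show "x \<in> \<Union>V" by (auto simp: V_def)
      qed
    qed (auto simp: V_def dest: openin_subset)
  qed (simp add: V_def)
  ultimately show ?thesis by (rule that[rotated])
qed

text \<open>A cobounding 0-cochain is an isomorphism of torsors written in the charts of a common
  refinement; a link is one written in the charts of the two given covers. From cochain to link, any
  member of the refinement around the point will do. Conversely, the refinement is made of the open
  sets on which the link is constant for some pair of charts.\<close>

lemma cech_rel1_iff_link:
  assumes c: "(U, c) \<in> cech_cocycles X A 1" and d: "(V, d) \<in> cech_cocycles X A 1"
  shows "((U, c), (V, d)) \<in> cech_rel X A 1 \<longleftrightarrow> (\<exists>h. cech_link X A id (U, c) (V, d) h)"
proof
  assume "((U, c), (V, d)) \<in> cech_rel X A 1"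
  then obtain W r s a where W: "cech_cover X W" and r: "cech_refines id W U r"
    and s: "cech_refines id W V s" and a: "a \<in> cech_cochains A 0 W"
    and eq: "(\<lambda>t. cech_pullback r W c t - cech_pullback s W d t) = cech_coboundary W a"
    by (auto simp: cech_rel_def cech_coboundaries_def)
  have r1: "r w \<in> U" "\<And>x. x \<in> w \<Longrightarrow> x \<in> r w" if "w \<in> W" for w
    using r that by (auto simp: cech_refines_def)
  have s1: "s w \<in> V" "\<And>x. x \<in> w \<Longrightarrow> x \<in> s w" if "w \<in> W" for w
    using s that by (auto simp: cech_refines_def)
  have eq': "c [r w, r w'] - d [s w, s w'] = a [w'] - a [w]"
    if "w \<in> W" "w' \<in> W" "x \<in> w" "x \<in> w'" for w w' x
  proof -
    have "[w, w'] \<in> nerve W" using that by (auto simp: nerve_pair)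
    then show ?thesis using fun_cong[OF eq, of "[w, w']"]
      by (simp add: cech_pullback_pair cech_coboundary_pair)
  qed
  define w0 where "w0 x = (SOME w. w \<in> W \<and> x \<in> w)" for x
  have w0: "w0 x \<in> W" "x \<in> w0 x" if "x \<in> topspace X" for x
    using someI_ex[of "\<lambda>w. w \<in> W \<and> x \<in> w"] cech_cover_point[OF W that] unfolding w0_def by auto
  \<comment> \<open>Change from \<open>u\<close> to \<open>r w\<close>, cross over by
    \<open>- a [w]\<close>, and change from \<open>s w\<close> to \<open>v\<close>, with
    \<open>w = w0 x\<close>. The next fact says that every \<open>w\<close> around \<open>x\<close>
    gives the same value.\<close>
  define h where "h x u v = - c [r (w0 x), u] + d [s (w0 x), v] - a [w0 x]" for x u v
  have h: "h x u v = - c [r w, u] + d [s w, v] - a [w]"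
    if "w \<in> W" "x \<in> w" "u \<in> U" "x \<in> u" "v \<in> V" "x \<in> v" for x u v w
  proof -
    have xX: "x \<in> topspace X" using cech_cover_mem[OF W that(1,2)] .
    note w0 = w0[OF xX]
    have A: "c [r (w0 x), u] = c [r (w0 x), r w] + c [r w, u]"
      by (rule cech_cocycle_add[OF c r1(1)[OF w0(1)] r1(1)[OF that(1)] that(3)
        r1(2)[OF w0] r1(2)[OF that(1,2)] that(4)])
    have B: "d [s (w0 x), v] = d [s (w0 x), s w] + d [s w, v]"
      by (rule cech_cocycle_add[OF d s1(1)[OF w0(1)] s1(1)[OF that(1)] that(5)
        s1(2)[OF w0] s1(2)[OF that(1,2)] that(6)])
    have C: "c [r (w0 x), r w] = d [s (w0 x), s w] + a [w] - a [w0 x]"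
      using eq'[OF w0(1) that(1) w0(2) that(2)] by (simp add: algebra_simps)
    show ?thesis unfolding h_def A B C by simp
  qed
  have "cech_link X A id (U, c) (V, d) h"
  proof (rule cech_linkI)
    fix x u u' v v'
    assume t: "u \<in> U" "u' \<in> U" "v \<in> V" "v' \<in> V" "x \<in> u" "x \<in> u'" "id x \<in> v" "id x \<in> v'"
    then have t': "x \<in> v" "x \<in> v'" by auto
    have xX: "x \<in> topspace X" using cech_cover_mem[OF cech_cocycle_cover[OF c] t(1,5)] .
    note w0 = w0[OF xX]
    have A: "c [r (w0 x), u'] = c [r (w0 x), u] + c [u, u']"
      by (rule cech_cocycle_add[OF c r1(1)[OF w0(1)] t(1,2) r1(2)[OF w0] t(5,6)])
    have B: "d [s (w0 x), v'] = d [s (w0 x), v] + d [v, v']"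
      by (rule cech_cocycle_add[OF d s1(1)[OF w0(1)] t(3,4) s1(2)[OF w0] t'])
    show "h x u' v' = h x u v - c [u, u'] + d [v, v']"
      unfolding h_def A B by simp
  next
    fix x u v assume t: "u \<in> U" "v \<in> V" "x \<in> u" "id x \<in> v"
    then have t': "x \<in> v" by auto
    have xX: "x \<in> topspace X" using cech_cover_mem[OF cech_cocycle_cover[OF c] t(1,3)] .
    note w0 = w0[OF xX]
    have "h y u v = h x u v" if "y \<in> w0 x" "y \<in> u" "y \<in> v" for y
      unfolding h[OF w0(1) that(1) t(1) that(2) t(2) that(3)]
        h[OF w0(1) w0(2) t(1,3) t(2) t'] by simp
    then show "\<exists>w. openin X w \<and> x \<in> w \<and> (\<forall>y\<in>w. y \<in> u \<and> id y \<in> v \<longrightarrow> h y u v = h x u v)"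
      using w0 cech_cover_open[OF W] by (intro exI[of _ "w0 x"]) auto
  next
    fix x u v assume t: "u \<in> U" "v \<in> V" "x \<in> u" "id x \<in> v" "x \<in> A"
    then have t': "x \<in> v" by auto
    have xX: "x \<in> topspace X" using cech_cover_mem[OF cech_cocycle_cover[OF c] t(1,3)] .
    note w0 = w0[OF xX]
    have "c [r (w0 x), u] = 0" by (rule cech_cocycle_zero[OF c r1(2)[OF w0] t(3,5)])
    moreover have "d [s (w0 x), v] = 0" by (rule cech_cocycle_zero[OF d s1(2)[OF w0] t' t(5)])
    moreover have "a [w0 x] = 0"
      using a w0(2) t(5) unfolding cech_cochains0_iff by blast
    ultimately show "h x u v = 0" by (simp add: h_def)
  qed
  then show "\<exists>h. cech_link X A id (U, c) (V, d) h" by blast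
next
  assume "\<exists>h. cech_link X A id (U, c) (V, d) h"
  then obtain h where h: "cech_link X A id (U, c) (V, d) h" by blast
  define good where "good w u v \<longleftrightarrow> u \<in> U \<and> v \<in> V \<and> w \<subseteq> u \<inter> v \<and> (\<forall>x\<in>w. \<forall>y\<in>w. h x u v = h y u v)" for w u v
  define W where "W = {w. openin X w \<and> (\<exists>u v. good w u v)}"
  define r where "r w = (SOME u. \<exists>v. good w u v)" for w
  define s where "s w = (SOME v. good w (r w) v)" for w
  have r_good: "\<exists>v. good w (r w) v" if "w \<in> W" for w
    unfolding r_def by (rule someI_ex[of "\<lambda>u. \<exists>v. good w u v"]) (use that in \<open>auto simp: W_def\<close>)
  have good: "good w (r w) (s w)" if "w \<in> W" for w
    unfolding s_def using r_good[OF that] by (rule someI_ex)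
  \<comment> \<open>\<open>W\<close> may contain the empty set, which is not a simplex of the nerve,
    so the cochain has to be 0 there.\<close>
  define a where "a t = (if \<exists>w x. t = [w] \<and> w \<in> W \<and> x \<in> w
     then - h (SOME x. x \<in> hd t) (r (hd t)) (s (hd t)) else 0)" for t
  have a: "a [w] = - h x (r w) (s w)" if "w \<in> W" "x \<in> w" for w x
  proof -
    have "(SOME x. x \<in> w) \<in> w" using that(2) by (rule someI)
    then have "h (SOME x. x \<in> w) (r w) (s w) = h x (r w) (s w)"
      using good[OF that(1)] that(2) unfolding good_def by blast
    then show ?thesis using that by (auto simp: a_def)
  qed
  have W: "cech_cover X W"
    unfolding cech_cover_def
  proof (intro conjI ballI)
    show "\<Union>W = topspace X"
    proof
      show "topspace X \<subseteq> \<Union>W"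
      proof
        fix x assume "x \<in> topspace X"
        then obtain u v where uv: "u \<in> U" "x \<in> u" "v \<in> V" "x \<in> v"
          using cech_cover_point cech_cocycle_cover[OF c] cech_cocycle_cover[OF d] by metis
        then obtain w where w: "openin X w" "x \<in> w" "\<forall>y\<in>w. y \<in> u \<and> id y \<in> v \<longrightarrow> h y u v = h x u v"
          using cech_link_locally_const[OF h uv(1,3,2)] by auto
        have "openin X (w \<inter> u \<inter> v)"
          using w uv cech_cover_open cech_cocycle_cover[OF c] cech_cocycle_cover[OF d]
          by (meson openin_Int)
        moreover have "good (w \<inter> u \<inter> v) u v" using uv w(3) by (auto simp: good_def)
        ultimately have "w \<inter> u \<inter> v \<in> W" by (auto simp: W_def)
        then show "x \<in> \<Union>W" using w(2) uv by blast
      qed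
    qed (auto simp: W_def dest: openin_subset)
  qed (simp add: W_def)
  have r: "cech_refines id W U r" and s: "cech_refines id W V s"
    using good by (auto simp: cech_refines_def good_def)
  have sub: "x \<in> r w" "x \<in> s w" "r w \<in> U" "s w \<in> V" if "w \<in> W" "x \<in> w" for x w
    using good[OF that(1)] that(2) by (auto simp: good_def)
  have aW: "a \<in> cech_cochains A 0 W"
    unfolding cech_cochains0_iff
  proof (intro allI impI)
    fix t assume at: "a t \<noteq> 0"
    then obtain w x where t: "t = [w]" "w \<in> W" "x \<in> w" by (auto simp: a_def split: if_splits)
    have "w \<inter> A = {}"
    proof (rule ccontr)
      assume "w \<inter> A \<noteq> {}"
      then obtain y where y: "y \<in> w" "y \<in> A" by blast
      have "h y (r w) (s w) = 0"
        by (rule cech_link_zero[OF h]) (use sub[OF t(2) y(1)] y in auto)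
      then show False using a[OF t(2) y(1)] at t by simp
    qed
    then show "\<exists>u. t = [u] \<and> u \<in> W \<and> u \<noteq> {} \<and> u \<inter> A = {}" using t by blast
  qed
  have pc: "(W, cech_pullback r W c) \<in> cech_cocycles X A 1"
    by (rule cech_pullback_cocycle[OF c _ W r]) simp
  have pd: "(W, cech_pullback s W d) \<in> cech_cocycles X A 1"
    by (rule cech_pullback_cocycle[OF d _ W s]) simp
  have "cech_pullback r W c t - cech_pullback s W d t = cech_coboundary W a t" for t
  proof (cases "\<exists>w w'. t = [w, w'] \<and> w \<in> W \<and> w' \<in> W \<and> w \<inter> w' \<noteq> {}")
    case True
    then obtain w w' x where t: "t = [w, w']" "w \<in> W" "w' \<in> W" "x \<in> w" "x \<in> w'" by blast
    have n: "[w, w'] \<in> nerve W" using t by (auto simp: nerve_pair)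
    note m = sub[OF t(2,4)] sub[OF t(3,5)]
    have "h x (r w') (s w') = h x (r w) (s w) - c [r w, r w'] + d [s w, s w']"
      by (rule cech_link_change[OF h m(3,7,4,8,1,5)]) (use m in auto)
    note A = a[OF t(2,4)] a[OF t(3,5), unfolded this]
    show ?thesis using n by (simp add: t(1) cech_pullback_pair cech_coboundary_pair A)
  next
    case False
    have 1: "cech_pullback r W c t = 0" and 2: "cech_pullback s W d t = 0"
      using False cech_cocycle_support[OF pc, of t] cech_cocycle_support[OF pd, of t] by blast+
    have 3: "cech_coboundary W a t = 0"
    proof (cases "t \<in> nerve W")
      case True
      have "a (take i t @ drop (Suc i) t) = 0" if "i < length t" for i
      proof (rule ccontr)
        assume "a (take i t @ drop (Suc i) t) \<noteq> 0"
        then obtain u where "take i t @ drop (Suc i) t = [u]"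
          using aW unfolding cech_cochains0_iff by blast
        then have "length (take i t @ drop (Suc i) t) = length [u]" by (rule arg_cong)
        moreover have "length (take i t @ drop (Suc i) t) = length t - 1" using that by simp
        ultimately have "length t = 2" by simp
        then obtain w w' where t: "t = [w, w']" by (auto simp: length_Suc_conv numeral_2_eq_2)
        then show False using \<open>t \<in> nerve W\<close> False by (auto simp: nerve_pair)
      qed
      then show ?thesis by (simp add: cech_coboundary_def)
    qed (simp add: cech_coboundary_def)
    show ?thesis by (simp add: 1 2 3)
  qed
  then have "(\<lambda>t. cech_pullback r W c t - cech_pullback s W d t) \<in> cech_coboundaries A 1 W"
    using aW by (auto simp: cech_coboundaries_def)
  then show "((U, c), (V, d)) \<in> cech_rel X A 1"
    unfolding cech_rel_def using c d W r s by blast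
qed

section \<open>Classes, induced maps and eigenclasses in terms of links\<close>

lemma cech_link_exists_refl:
  assumes "(U, c) \<in> cech_cocycles X A 1"
  shows "\<exists>h. cech_link X A id (U, c) (U, c) h"
proof -
  have "cech_refines id U U id" by (auto simp: cech_refines_def)
  from cech_pullback_link[OF assms _ cech_cocycle_cover[OF assms] this, of A]
  have h: "cech_link X A id (U, cech_pullback id U c) (U, c) (\<lambda>x v u. c [v, u])" by simp
  have "cech_pullback id U c = c"
  proof
    fix s show "cech_pullback id U c s = c s"
    proof (cases "c s = 0")
      case False
      then have "s \<in> nerve U" using cech_cocycle_support[OF assms, of s] nerve_pair by metis
      then show ?thesis by (simp add: cech_pullback_def)
    qed (simp add: cech_pullback_def)
  qed
  then show ?thesis using h by auto
qed

text \<open>Both \<open>h\<close> and the identity link of \<open>(V, d)\<close> end at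
  \<open>(V, d)\<close>, so they can be compared in the opposite order.\<close>

lemma cech_link_exists_sym:
  assumes "(U, c) \<in> cech_cocycles X A 1" "(V, d) \<in> cech_cocycles X A 1"
    and "cech_link X A id (U, c) (V, d) h"
  shows "\<exists>k. cech_link X A id (V, d) (U, c) k"
proof -
  obtain k where k: "cech_link X A id (V, d) (V, d) k" using cech_link_exists_refl[OF assms(2)] by blast
  note cov = assms(1,2)[THEN cech_cocycle_cover]
  show ?thesis
    using cech_link_diff[OF cov(2,1) cov(2) continuous_map_id k assms(3)] by blast
qed

lemma cech_class1:
  assumes c: "(U, c) \<in> cech_cocycles X A 1"
  shows "cech_class X A 1 U c = {(V, d) \<in> cech_cocycles X A 1. \<exists>h. cech_link X A id (V, d) (U, c) h}"
proof -
  have "(V, d) \<in> cech_class X A 1 U c \<longleftrightarrow>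
      (V, d) \<in> cech_cocycles X A 1 \<and> (\<exists>h. cech_link X A id (V, d) (U, c) h)" for V d
  proof -
    have "(V, d) \<in> cech_class X A 1 U c \<longleftrightarrow> ((U, c), (V, d)) \<in> cech_rel X A 1"
      by (simp add: cech_class_def)
    also have "\<dots> \<longleftrightarrow> (V, d) \<in> cech_cocycles X A 1 \<and> ((U, c), (V, d)) \<in> cech_rel X A 1"
      by (auto simp: cech_rel_def)
    also have "\<dots> \<longleftrightarrow> (V, d) \<in> cech_cocycles X A 1 \<and> (\<exists>h. cech_link X A id (U, c) (V, d) h)"
      using cech_rel1_iff_link[OF c] by blast
    also have "\<dots> \<longleftrightarrow> (V, d) \<in> cech_cocycles X A 1 \<and> (\<exists>h. cech_link X A id (V, d) (U, c) h)"
      using cech_link_exists_sym[OF c] cech_link_exists_sym[OF _ c] by blast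
    finally show ?thesis .
  qed
  then show ?thesis by auto
qed

lemma cech_class1_mem:
  assumes "(U, c) \<in> cech_cocycles X A 1"
  shows "(V, d) \<in> cech_class X A 1 U c \<longleftrightarrow>
    (V, d) \<in> cech_cocycles X A 1 \<and> (\<exists>h. cech_link X A id (V, d) (U, c) h)"
  unfolding cech_class1[OF assms] by (simp only: mem_Collect_eq prod.case)

lemma cech_class1_self: "(U, c) \<in> cech_cocycles X A 1 \<Longrightarrow> (U, c) \<in> cech_class X A 1 U c"
  using cech_link_exists_refl cech_class1_mem by blast

lemma cech_class1_eq_iff:
  assumes c: "(U, c) \<in> cech_cocycles X A 1" and d: "(V, d) \<in> cech_cocycles X A 1"
  shows "cech_class X A 1 U c = cech_class X A 1 V d \<longleftrightarrow> (\<exists>h. cech_link X A id (U, c) (V, d) h)"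
proof
  assume "cech_class X A 1 U c = cech_class X A 1 V d"
  then have "(U, c) \<in> cech_class X A 1 V d" using cech_class1_self[OF c] by simp
  then show "\<exists>h. cech_link X A id (U, c) (V, d) h" unfolding cech_class1_mem[OF d] by blast
next
  assume "\<exists>h. cech_link X A id (U, c) (V, d) h"
  then obtain h k where h: "cech_link X A id (U, c) (V, d) h" and k: "cech_link X A id (V, d) (U, c) k"
    using cech_link_exists_sym[OF c d] by blast
  note cov = c[THEN cech_cocycle_cover] d[THEN cech_cocycle_cover]
  have "(\<exists>l. cech_link X A id (W, e) (U, c) l) \<longleftrightarrow> (\<exists>l. cech_link X A id (W, e) (V, d) l)"
    if "(W, e) \<in> cech_cocycles X A 1" for W e
    using cech_link_compose[OF cech_cocycle_cover[OF that] cov(1) continuous_map_id _ _ h, of A e]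
      cech_link_compose[OF cech_cocycle_cover[OF that] cov(2) continuous_map_id _ _ k, of A e]
    by (metis comp_id id_apply)
  then show "cech_class X A 1 U c = cech_class X A 1 V d"
    unfolding cech_class1[OF c] cech_class1[OF d] by blast
qed

text \<open>Every representative and every refinement yields a cocycle with a link to
  \<open>(U, c)\<close> over \<open>g\<close>, and \<open>(V, d)\<close> has one too; by comparison
  of links all of them lie in one class. The union that defines \<open>cech_map\<close> is thus a
  union of copies of one class, and no refinement has to be exhibited in order to compute
  it.\<close>

lemma cech_map1_class:
  assumes g: "continuous_map X Y g" and gA: "g ` A \<subseteq> B"
    and c: "(U, c) \<in> cech_cocycles Y B 1"
    and d: "(V, d) \<in> cech_cocycles X A 1" and h: "cech_link X A g (V, d) (U, c) h"
  shows "cech_map X A 1 g (cech_class Y B 1 U c) = cech_class X A 1 V d"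
proof -
  have gA': "\<And>x. x \<in> A \<Longrightarrow> g x \<in> B" using gA by blast
  have eq: "cech_class X A 1 W (cech_pullback r W c') = cech_class X A 1 V d"
    if mem: "(U', c') \<in> cech_class Y B 1 U c" and W: "cech_cover X W" and r: "cech_refines g W U' r" for U' c' W r
  proof -
    obtain l where c': "(U', c') \<in> cech_cocycles Y B 1" and l: "cech_link Y B id (U', c') (U, c) l"
      using mem unfolding cech_class1_mem[OF c] by blast
    note p = cech_pullback_cocycle[OF c' gA W r]
    obtain m where "cech_link X A (id \<circ> g) (W, cech_pullback r W c') (U, c) m"
      using cech_link_compose[OF W cech_cocycle_cover[OF c'] g gA'
          cech_pullback_link[OF c' gA W r] l] by blast
    then have m: "cech_link X A g (W, cech_pullback r W c') (U, c) m" by simp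
    show ?thesis
      unfolding cech_class1_eq_iff[OF p d]
      using cech_link_diff[OF W cech_cocycle_cover[OF d] cech_cocycle_cover[OF c] g m h] by blast
  qed
  obtain W r where W: "cech_cover X W" "cech_refines g W U r"
    using cech_refines_exists[OF g cech_cocycle_cover[OF c]] by blast
  have "{cech_class X A 1 W (cech_pullback r W c') |U' c' W r.
         (U', c') \<in> cech_class Y B 1 U c \<and> cech_cover X W \<and> cech_refines g W U' r} = {cech_class X A 1 V d}"
    using eq W cech_class1_self[OF c] by (auto simp del: One_nat_def) metis
  then show ?thesis unfolding cech_map_def by (simp del: One_nat_def)
qed

lemma cech_smult1_class:
  assumes c: "(U, c) \<in> cech_cocycles X A 1"
  shows "a \<odot>\<^bsub>cech X A 1\<^esub> cech_class X A 1 U c = cech_class X A 1 U (\<lambda>s. a * c s)"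
proof -
  have eq: "cech_class X A 1 V (\<lambda>s. a * d s) = cech_class X A 1 U (\<lambda>s. a * c s)"
    if mem: "(V, d) \<in> cech_class X A 1 U c" for V d
  proof -
    obtain l where d: "(V, d) \<in> cech_cocycles X A 1" and l: "cech_link X A id (V, d) (U, c) l"
      using mem unfolding cech_class1_mem[OF c] by blast
    show ?thesis
      unfolding cech_class1_eq_iff[OF cech_cocycle_smult[OF d] cech_cocycle_smult[OF c]]
      using cech_link_smult[OF l] by blast
  qed
  have "{cech_class X A 1 V (\<lambda>s. a * d s) |V d. (V, d) \<in> cech_class X A 1 U c}
    = {cech_class X A 1 U (\<lambda>s. a * c s)}" (is "?S = {?x}")
  proof
    show "?S \<subseteq> {?x}"
    proof
      fix y assume "y \<in> ?S"
      then show "y \<in> {?x}" using eq by (elim CollectE exE conjE) (simp only: singleton_iff)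
    qed
    show "{?x} \<subseteq> ?S" using cech_class1_self[OF c] by blast
  qed
  then show ?thesis by (simp add: cech_def del: One_nat_def)
qed

lemma cech_carrier1:
  "carrier (cech X A 1) = {cech_class X A 1 U c |U c. (U, c) \<in> cech_cocycles X A 1}"
  by (auto simp: cech_def quotient_def cech_class_def)

text \<open>Local constancy is relative to \<open>S\<close>, which need not be open: sections are
  needed over compact invariant sets and over the preimages of a point under iterates.\<close>

definition cech_section ::
    "'a topology \<Rightarrow> 'a set \<Rightarrow> 'a set set \<Rightarrow> ('a set list \<Rightarrow> complex) \<Rightarrow> ('a \<Rightarrow> 'a set \<Rightarrow> complex) \<Rightarrow> bool" where
  "cech_section X S U c s \<longleftrightarrow>
     (\<forall>x\<in>S. \<forall>u\<in>U. \<forall>v\<in>U. x \<in> u \<and> x \<in> v \<longrightarrow> s x v = s x u + c [u, v]) \<and>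
     (\<forall>x\<in>S. \<forall>u\<in>U. x \<in> u \<longrightarrow>
        (\<exists>w. openin X w \<and> x \<in> w \<and> (\<forall>y\<in>w \<inter> S. y \<in> u \<longrightarrow> s y u = s x u)))"

lemma cech_sectionI:
  assumes "\<And>x u v. \<lbrakk>x \<in> S; u \<in> U; v \<in> U; x \<in> u; x \<in> v\<rbrakk> \<Longrightarrow> s x v = s x u + c [u, v]"
    and "\<And>x u. \<lbrakk>x \<in> S; u \<in> U; x \<in> u\<rbrakk> \<Longrightarrow>
        \<exists>w. openin X w \<and> x \<in> w \<and> (\<forall>y\<in>w \<inter> S. y \<in> u \<longrightarrow> s y u = s x u)"
  shows "cech_section X S U c s"
  unfolding cech_section_def
  by (intro conjI allI impI ballI; (elim conjE)?; (rule assms(1) | rule assms(2)); assumption)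

lemma cech_section_change:
  assumes "cech_section X S U c s" "x \<in> S" "u \<in> U" "v \<in> U" "x \<in> u" "x \<in> v"
  shows "s x v = s x u + c [u, v]"
  by (rule assms(1)[unfolded cech_section_def, THEN conjunct1, THEN bspec, THEN bspec, THEN bspec, THEN mp])
    (intro conjI assms)+

lemma cech_section_locally_const:
  assumes "cech_section X S U c s" "x \<in> S" "u \<in> U" "x \<in> u"
  shows "\<exists>w. openin X w \<and> x \<in> w \<and> (\<forall>y\<in>w \<inter> S. y \<in> u \<longrightarrow> s y u = s x u)"
  by (rule assms(1)[unfolded cech_section_def, THEN conjunct2, THEN bspec, THEN bspec, THEN mp])
    (intro conjI assms)+

text \<open>The zero class is represented by the one-element cover with the zero cochain. A link to
  it subtracts transition terms where a section adds them, so the two differ by a sign.\<close>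

lemma cech_class1_zero_iff:
  assumes c: "(U, c) \<in> cech_cocycles X A 1"
  shows "cech_class X A 1 U c = \<zero>\<^bsub>cech X A 1\<^esub> \<longleftrightarrow>
    (\<exists>s. cech_section X (topspace X) U c s \<and> (\<forall>x\<in>A. \<forall>u\<in>U. x \<in> u \<longrightarrow> s x u = 0))"
proof -
  let ?T = "topspace X"
  have "cech_class X A 1 U c = \<zero>\<^bsub>cech X A 1\<^esub> \<longleftrightarrow> cech_class X A 1 U c = cech_class X A 1 {?T} (\<lambda>s. 0)"
    by (simp add: cech_def)
  also have "\<dots> \<longleftrightarrow> (\<exists>h. cech_link X A id (U, c) ({?T}, \<lambda>s. 0) h)"
    by (rule cech_class1_eq_iff[OF c cech_cocycle_trivial])
  also have "\<dots> \<longleftrightarrow> (\<exists>s. cech_section X ?T U c s \<and> (\<forall>x\<in>A. \<forall>u\<in>U. x \<in> u \<longrightarrow> s x u = 0))"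
  proof
    assume "\<exists>h. cech_link X A id (U, c) ({?T}, \<lambda>s. 0) h"
    then obtain h where h: "cech_link X A id (U, c) ({?T}, \<lambda>s. 0) h" by blast
    have "cech_section X ?T U c (\<lambda>x u. - h x u ?T)"
    proof (rule cech_sectionI)
      fix x u v assume a: "x \<in> ?T" "u \<in> U" "v \<in> U" "x \<in> u" "x \<in> v"
      have "h x v ?T = h x u ?T - c [u, v] + 0"
        by (rule cech_link_change[OF h a(2,3) _ _ a(4,5)]) (use a in auto)
      then show "- h x v ?T = - h x u ?T + c [u, v]" by simp
    next
      fix x u assume a: "x \<in> ?T" "u \<in> U" "x \<in> u"
      then obtain w where "openin X w" "x \<in> w" "\<forall>y\<in>w. y \<in> u \<and> id y \<in> ?T \<longrightarrow> h y u ?T = h x u ?T"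
        using cech_link_locally_const[OF h a(2) _ a(3), of ?T] by auto
      then show "\<exists>w. openin X w \<and> x \<in> w \<and> (\<forall>y\<in>w \<inter> ?T. y \<in> u \<longrightarrow> - h y u ?T = - h x u ?T)"
        by auto
    qed
    moreover have "- h x u ?T = 0" if "x \<in> A" "u \<in> U" "x \<in> u" for x u
      using cech_link_zero[OF h that(2) _ that(3) _ that(1), of ?T]
        cech_cover_mem[OF cech_cocycle_cover[OF c] that(2,3)] by simp
    ultimately show "\<exists>s. cech_section X ?T U c s \<and> (\<forall>x\<in>A. \<forall>u\<in>U. x \<in> u \<longrightarrow> s x u = 0)" by blast
  next
    assume "\<exists>s. cech_section X ?T U c s \<and> (\<forall>x\<in>A. \<forall>u\<in>U. x \<in> u \<longrightarrow> s x u = 0)"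
    then obtain s where s: "cech_section X ?T U c s" "\<forall>x\<in>A. \<forall>u\<in>U. x \<in> u \<longrightarrow> s x u = 0"
      by (elim exE conjE) (rule that)
    have mem: "\<And>x u. u \<in> U \<Longrightarrow> x \<in> u \<Longrightarrow> x \<in> ?T"
      by (rule cech_cover_mem[OF cech_cocycle_cover[OF c]])
    have "cech_link X A id (U, c) ({?T}, \<lambda>s. 0) (\<lambda>x u v. - s x u)"
    proof (rule cech_linkI)
      fix x u u' assume a: "u \<in> U" "u' \<in> U" "x \<in> u" "x \<in> u'"
      have "s x u' = s x u + c [u, u']"
        by (rule cech_section_change[OF s(1) mem a]) (use a in auto)
      then show "- s x u' = - s x u - c [u, u'] + 0" by simp
    next
      fix x u v assume a: "u \<in> U" "x \<in> u"
      then obtain w where "openin X w" "x \<in> w" "\<forall>y\<in>w \<inter> ?T. y \<in> u \<longrightarrow> s y u = s x u"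
        using cech_section_locally_const[OF s(1) mem a] by blast
      then show "\<exists>w. openin X w \<and> x \<in> w \<and> (\<forall>y\<in>w. y \<in> u \<and> id y \<in> v \<longrightarrow> - s y u = - s x u)"
        using mem a by (metis IntI)
    qed (use s(2) in auto)
    then show "\<exists>h. cech_link X A id (U, c) ({?T}, \<lambda>s. 0) h" by blast
  qed
  finally show ?thesis .
qed

text \<open>The cocycle \<open>\<mu> * c\<close> represents \<open>\<mu>\<close> times the class,
  and a link from it to \<open>c\<close> over \<open>g\<close> says that it represents the pull-back
  as well. An eigenclass thereby becomes data that can be evaluated at points, which is how both
  halves of the proof use it.\<close>

lemma linear_eigenvalue_cech1_iff:
  assumes g: "continuous_map X X g" and gA: "g ` A \<subseteq> A"
  shows "linear_eigenvalue (cech X A 1) (cech_map X A 1 g) \<mu> \<longleftrightarrow>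
    (\<exists>U c h. (U, c) \<in> cech_cocycles X A 1 \<and> cech_link X A g (U, \<lambda>s. \<mu> * c s) (U, c) h \<and>
       \<not> (\<exists>s. cech_section X (topspace X) U c s \<and> (\<forall>x\<in>A. \<forall>u\<in>U. x \<in> u \<longrightarrow> s x u = 0)))"
proof -
  have "cech_map X A 1 g (cech_class X A 1 U c) = \<mu> \<odot>\<^bsub>cech X A 1\<^esub> cech_class X A 1 U c \<longleftrightarrow>
     (\<exists>h. cech_link X A g (U, \<lambda>s. \<mu> * c s) (U, c) h)" (is "?L \<longleftrightarrow> ?R")
    if c: "(U, c) \<in> cech_cocycles X A 1" for U c
  proof
    note cov = cech_cocycle_cover[OF c]
    note m = cech_cocycle_smult[OF c, of \<mu>]
    {
      assume ?R
      then show ?L using cech_map1_class[OF g gA c m] cech_smult1_class[OF c] by metis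
    }
    assume L: ?L
    obtain W r where W: "cech_cover X W" "cech_refines g W U r"
      using cech_refines_exists[OF g cov] by blast
    note p = cech_pullback_cocycle[OF c gA W] and k = cech_pullback_link[OF c gA W]
    have "cech_class X A 1 U (\<lambda>s. \<mu> * c s) = cech_class X A 1 W (cech_pullback r W c)"
      using L cech_map1_class[OF g gA c p k] cech_smult1_class[OF c] by metis
    then obtain l where "cech_link X A id (U, \<lambda>s. \<mu> * c s) (W, cech_pullback r W c) l"
      using cech_class1_eq_iff[OF m p] by blast
    from cech_link_compose[OF cov W(1) continuous_map_id _ this k]
    show ?R by auto
  qed
  note eq = this
  show ?thesis
  proof
    assume "linear_eigenvalue (cech X A 1) (cech_map X A 1 g) \<mu>"
    then obtain U c where c: "(U, c) \<in> cech_cocycles X A 1"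
      and "cech_class X A 1 U c \<noteq> \<zero>\<^bsub>cech X A 1\<^esub>"
      and "cech_map X A 1 g (cech_class X A 1 U c) = \<mu> \<odot>\<^bsub>cech X A 1\<^esub> cech_class X A 1 U c"
      unfolding linear_eigenvalue_def cech_carrier1 by blast
    then show "\<exists>U c h. (U, c) \<in> cech_cocycles X A 1 \<and> cech_link X A g (U, \<lambda>s. \<mu> * c s) (U, c) h \<and>
       \<not> (\<exists>s. cech_section X (topspace X) U c s \<and> (\<forall>x\<in>A. \<forall>u\<in>U. x \<in> u \<longrightarrow> s x u = 0))"
      unfolding eq[OF c] cech_class1_zero_iff[OF c] by blast
  next
    assume "\<exists>U c h. (U, c) \<in> cech_cocycles X A 1 \<and> cech_link X A g (U, \<lambda>s. \<mu> * c s) (U, c) h \<and>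
       \<not> (\<exists>s. cech_section X (topspace X) U c s \<and> (\<forall>x\<in>A. \<forall>u\<in>U. x \<in> u \<longrightarrow> s x u = 0))"
    then obtain U c h where c: "(U, c) \<in> cech_cocycles X A 1"
      and h: "cech_link X A g (U, \<lambda>s. \<mu> * c s) (U, c) h"
      and s: "\<not> (\<exists>s. cech_section X (topspace X) U c s \<and> (\<forall>x\<in>A. \<forall>u\<in>U. x \<in> u \<longrightarrow> s x u = 0))"
      by blast
    have "cech_map X A 1 g (cech_class X A 1 U c) = \<mu> \<odot>\<^bsub>cech X A 1\<^esub> cech_class X A 1 U c"
      using h unfolding eq[OF c] by blast
    moreover have "cech_class X A 1 U c \<noteq> \<zero>\<^bsub>cech X A 1\<^esub>"
      using s unfolding cech_class1_zero_iff[OF c] .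
    ultimately show "linear_eigenvalue (cech X A 1) (cech_map X A 1 g) \<mu>"
      using c unfolding linear_eigenvalue_def cech_carrier1 by blast
  qed
qed

section \<open>Sections near compact invariant sets\<close>

lemma nested_closed_subset_open:
  fixes C :: "nat \<Rightarrow> 'a set"
  assumes X: "compact_space X" and C: "\<And>n. closedin X (C n)" and dec: "decseq C"
    and W: "openin X W" and sub: "(\<Inter>n. C n) \<subseteq> W"
  obtains n where "C n \<subseteq> W"
proof (rule ccontr)
  assume "\<not> thesis"
  then have ne: "C n - W \<noteq> {}" for n using that by blast
  have "closedin X (C n - W)" for n using C W by blast
  moreover have "decseq (\<lambda>n. C n - W)" using dec by (force simp: decseq_def)
  ultimately have "(\<Inter>n. C n - W) \<noteq> {}" by (rule compact_space_imp_nest[OF X _ ne])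
  then show False using sub by blast
qed

lemma funpow_continuous_map:
  "continuous_map X X F \<Longrightarrow> continuous_map X X (F ^^ n)"
proof (induction n)
  case 0
  then show ?case using continuous_map_id[of X] by (simp add: id_def)
next
  case (Suc n)
  then show ?case using continuous_map_compose[of X X "F ^^ n" X F] by (simp only: funpow.simps)
qed

text \<open>For a continuous self-map of a compact Hausdorff space, this is the largest subset that
  is mapped onto itself. In the pointed quotient it consists of the base point and the unstable set
  of the overview.\<close>

definition core :: "'a topology \<Rightarrow> ('a \<Rightarrow> 'a) \<Rightarrow> 'a set" where
  "core X F = (\<Inter>n. (F ^^ n) ` topspace X)"

context
  fixes X :: "'a topology" and F :: "'a \<Rightarrow> 'a"
  assumes cpt: "compact_space X" and haus: "Hausdorff_space X" and F: "continuous_map X X F"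
begin

lemma core_images_closed: "closedin X ((F ^^ n) ` topspace X)"
  using image_compactin[OF _ funpow_continuous_map[OF F], of "topspace X" n] cpt
    compactin_imp_closedin[OF haus] unfolding compact_space_def by blast

lemma core_images_decseq: "decseq (\<lambda>n. (F ^^ n) ` topspace X)"
proof (rule decseq_SucI)
  fix n
  have "(F ^^ Suc n) ` topspace X = (F ^^ n) ` (F ` topspace X)"
    by (simp only: funpow_Suc_right image_comp)
  also have "\<dots> \<subseteq> (F ^^ n) ` topspace X"
    using F by (intro image_mono) (auto simp: continuous_map_def)
  finally show "(F ^^ Suc n) ` topspace X \<subseteq> (F ^^ n) ` topspace X" .
qed

lemma closedin_core: "closedin X (core X F)"
  unfolding core_def using core_images_closed by blast

lemma core_absorbing:
  assumes "openin X W" "core X F \<subseteq> W"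
  obtains n where "(F ^^ n) ` topspace X \<subseteq> W"
  using nested_closed_subset_open[OF cpt core_images_closed core_images_decseq assms(1)]
    assms(2) unfolding core_def by blast

lemma core_nonempty: "topspace X \<noteq> {} \<Longrightarrow> core X F \<noteq> {}"
  unfolding core_def
  by (rule compact_space_imp_nest[OF cpt core_images_closed _ core_images_decseq]) simp

text \<open>Surjectivity is a compactness argument: the preimages of \<open>y\<close> inside the
  iterated images form a decreasing sequence of nonempty closed sets, so one preimage lies in all of
  the images.\<close>

lemma image_core: "F ` core X F = core X F"
proof
  show "F ` core X F \<subseteq> core X F"
  proof
    fix y assume "y \<in> F ` core X F"
    then obtain x where x: "x \<in> core X F" "y = F x" by blast
    have "y \<in> (F ^^ n) ` topspace X" for n
    proof -
      have "x \<in> (F ^^ n) ` topspace X" using x(1) by (auto simp: core_def)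
      then have "y \<in> (F ^^ Suc n) ` topspace X" using x(2) by auto
      then show ?thesis using decseq_SucD[OF core_images_decseq, of n] by blast
    qed
    then show "y \<in> core X F" by (auto simp: core_def)
  qed
  show "core X F \<subseteq> F ` core X F"
  proof
    fix y assume y: "y \<in> core X F"
    have yX: "y \<in> topspace X" using y closedin_subset[OF closedin_core] by blast
    have "closedin X {x \<in> topspace X. F x \<in> {y}}"
      by (rule closedin_continuous_map_preimage[OF F])
        (use yX haus in \<open>simp add: Hausdorff_imp_t1_space closedin_t1_singleton\<close>)
    then have cl: "closedin X ((F ^^ n) ` topspace X \<inter> {x \<in> topspace X. F x \<in> {y}})" for n
      using core_images_closed by blast
    have ne: "(F ^^ n) ` topspace X \<inter> {x \<in> topspace X. F x \<in> {y}} \<noteq> {}" for n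
    proof -
      have "y \<in> (F ^^ Suc n) ` topspace X" using y unfolding core_def by blast
      then obtain z where "z \<in> topspace X" "y = F ((F ^^ n) z)" by auto
      moreover have "(F ^^ n) z \<in> topspace X" if "z \<in> topspace X" for z
        using funpow_continuous_map[OF F, of n] that by (auto simp: continuous_map_def)
      ultimately show ?thesis by blast
    qed
    have "decseq (\<lambda>n. (F ^^ n) ` topspace X \<inter> {x \<in> topspace X. F x \<in> {y}})"
      using core_images_decseq unfolding decseq_def by blast
    from compact_space_imp_nest[OF cpt cl ne this]
    show "y \<in> F ` core X F" unfolding core_def by blast
  qed
qed

end

lemma full_orbit_exists:
  fixes F :: "'a \<Rightarrow> 'a"
  assumes "F ` K = K" "p \<in> K"
  obtains x :: "int \<Rightarrow> 'a" where "range x \<subseteq> K" "x 0 = p" "\<And>i. F (x i) = x (i + 1)"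
proof -
  have "\<forall>y\<in>K. \<exists>z\<in>K. F z = y" using assms(1) by (metis imageE)
  then obtain b where b: "\<And>y. y \<in> K \<Longrightarrow> b y \<in> K \<and> F (b y) = y" by metis
  have bK: "(b ^^ n) p \<in> K" for n by (induction n) (use assms(2) b in auto)
  have FK: "(F ^^ n) p \<in> K" for n by (induction n) (use assms in auto)
  define x where "x i = (if i \<ge> 0 then (F ^^ nat i) p else (b ^^ nat (- i)) p)" for i :: int
  have "F (x i) = x (i + 1)" for i
  proof (cases "i \<ge> 0")
    case True
    then have "nat (i + 1) = Suc (nat i)" by simp
    then show ?thesis using True by (simp add: x_def)
  next
    case False
    define n where "n = nat (- i) - 1"
    have n: "nat (- i) = Suc n" using False by (simp add: n_def)
    have i: "i = - int (Suc n)" using False n by linarith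
    have "F (x i) = (b ^^ n) p" using False b[OF bK[of n]] by (simp add: x_def n)
    also have "\<dots> = x (i + 1)" by (cases "n = 0") (auto simp: x_def i)
    finally show ?thesis .
  qed
  moreover have "range x \<subseteq> K" using bK FK by (auto simp: x_def)
  ultimately show ?thesis using that[of x] by (simp add: x_def)
qed

text \<open>Near each point of \<open>S\<close> the section is constant in a chart and extends by
  that constant. Finitely many such extensions cover \<open>S\<close>. Two of them that are
  incompatible have domains \<open>k\<close> that meet only off \<open>S\<close>, and this
  intersection is removed. Regularity makes the domains closed, so that an open set remains.\<close>

lemma cech_section_extend:
  assumes X: "regular_space X" and S: "compactin X S"
    and c: "(U, c) \<in> cech_cocycles X A 1" and s: "cech_section X S U c s"
  obtains W t where "openin X W" "S \<subseteq> W" "cech_section X W U c t"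
    "\<And>x u. x \<in> S \<Longrightarrow> u \<in> U \<Longrightarrow> x \<in> u \<Longrightarrow> t x u = s x u"
proof -
  note U = cech_cocycle_cover[OF c]
  have "\<exists>u w k. u \<in> U \<and> openin X w \<and> x \<in> w \<and> closedin X k \<and> w \<subseteq> k \<and> k \<subseteq> u \<and>
      (\<forall>y\<in>k \<inter> S. s y u = s x u)" if xS: "x \<in> S" for x
  proof -
    have xX: "x \<in> topspace X" using xS compactin_subset_topspace[OF S] by blast
    then obtain u where u: "u \<in> U" "x \<in> u" using cech_cover_point[OF U] by blast
    obtain w where w: "openin X w" "x \<in> w" "\<forall>y\<in>w \<inter> S. y \<in> u \<longrightarrow> s y u = s x u"
      using cech_section_locally_const[OF s xS u] by blast
    have "openin X (w \<inter> u)" using w(1) cech_cover_open[OF U u(1)] by blast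
    then obtain w' k where wk: "openin X w'" "closedin X k" "x \<in> w'" "w' \<subseteq> k" "k \<subseteq> w \<inter> u"
      using X w(2) u(2) unfolding neighbourhood_base_of_closedin[symmetric] neighbourhood_base_of
      by (metis IntI)
    have "\<forall>y\<in>k \<inter> S. s y u = s x u" using wk(5) w(3) by auto
    moreover have "k \<subseteq> u" using wk(5) by blast
    ultimately show ?thesis using u(1) wk(1-4) by (intro exI conjI)
  qed
  then obtain u w k where uwk: "\<And>x. x \<in> S \<Longrightarrow> u x \<in> U \<and> openin X (w x) \<and> x \<in> w x \<and>
      closedin X (k x) \<and> w x \<subseteq> k x \<and> k x \<subseteq> u x \<and> (\<forall>y\<in>k x \<inter> S. s y (u x) = s x (u x))"
    by metis
  have "\<exists>F. finite F \<and> F \<subseteq> w ` S \<and> S \<subseteq> \<Union>F"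
    using S uwk unfolding compactin_def by (elim conjE allE[of _ "w ` S"]) blast
  then obtain F where F: "finite F" "F \<subseteq> S" "S \<subseteq> \<Union>(w ` F)"
    by (metis finite_subset_image)
  define good where "good i j \<longleftrightarrow> s i (u i) + c [u i, u j] = s j (u j)" for i j
  \<comment> \<open>Compatibility is a condition on the pair of indices and not on points, since the
    transition function between \<open>u i\<close> and \<open>u j\<close> is one number. So each bad
    pair costs just the closed set \<open>k i \<inter> k j\<close>.\<close>
  define W where "W = \<Union>(w ` F) - \<Union>((\<lambda>(i, j). k i \<inter> k j) ` {(i, j) \<in> F \<times> F. \<not> good i j})"
  have "openin X (\<Union>(w ` F))" using F(2) uwk by blast
  moreover have "closedin X (\<Union>((\<lambda>(i, j). k i \<inter> k j) ` {(i, j) \<in> F \<times> F. \<not> good i j}))"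
  proof (rule closedin_Union)
    have "finite (F \<times> F)" using F(1) by simp
    then have "finite {(i, j) \<in> F \<times> F. \<not> good i j}" by (rule rev_finite_subset) auto
    then show "finite ((\<lambda>(i, j). k i \<inter> k j) ` {(i, j) \<in> F \<times> F. \<not> good i j})" by simp
    fix T assume "T \<in> (\<lambda>(i, j). k i \<inter> k j) ` {(i, j) \<in> F \<times> F. \<not> good i j}"
    then show "closedin X T" using F(2) uwk by auto
  qed
  ultimately have Wo: "openin X W" unfolding W_def by (rule openin_diff)
  have SW: "S \<subseteq> W"
  proof
    fix x assume x: "x \<in> S"
    have "good i j" if "i \<in> F" "j \<in> F" "x \<in> k i" "x \<in> k j" for i j
    proof -
      have ij: "i \<in> S" "j \<in> S" using that F by auto
      have "s x (u i) = s i (u i)" "s x (u j) = s j (u j)"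
        using uwk[OF ij(1)] uwk[OF ij(2)] that x by blast+
      moreover have "s x (u j) = s x (u i) + c [u i, u j]"
        by (rule cech_section_change[OF s x]) (use uwk[OF ij(1)] uwk[OF ij(2)] that in blast)+
      ultimately show ?thesis by (simp add: good_def)
    qed
    then show "x \<in> W" using F(3) x unfolding W_def by blast
  qed
  define i0 where "i0 x = (SOME i. i \<in> F \<and> x \<in> w i)" for x
  have i0: "i0 x \<in> F" "x \<in> w (i0 x)" if "x \<in> W" for x
  proof -
    have "\<exists>i. i \<in> F \<and> x \<in> w i" using that by (auto simp: W_def)
    then show "i0 x \<in> F" "x \<in> w (i0 x)" unfolding i0_def by (metis (mono_tags, lifting) someI_ex)+
  qed
  have wk: "x \<in> u i \<and> x \<in> k i" if "i \<in> F" "x \<in> w i" for x i using uwk F(2) that by blast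
  define t where "t x v = s (i0 x) (u (i0 x)) + c [u (i0 x), v]" for x v
  have t: "t x v = s i (u i) + c [u i, v]"
    if "x \<in> W" "i \<in> F" "x \<in> w i" "v \<in> U" "x \<in> v" for x v i
  proof -
    note j = i0[OF that(1)]
    have "good i (i0 x)"
      using that(1) j(1) that(2) wk[OF that(2,3)] wk[OF j] unfolding W_def by blast
    then have g: "s (i0 x) (u (i0 x)) = s i (u i) + c [u i, u (i0 x)]" by (simp add: good_def)
    have e: "c [u i, v] = c [u i, u (i0 x)] + c [u (i0 x), v]"
      by (rule cech_cocycle_add[OF c, of _ _ _ x]) (use that j wk uwk F(2) in blast)+
    show ?thesis unfolding t_def g e by simp
  qed
  have "cech_section X W U c t"
  proof (rule cech_sectionI)
    fix x v v' assume a: "x \<in> W" "v \<in> U" "v' \<in> U" "x \<in> v" "x \<in> v'"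
    note j = i0[OF a(1)]
    have "c [u (i0 x), v'] = c [u (i0 x), v] + c [v, v']"
      by (rule cech_cocycle_add[OF c, of _ _ _ x]) (use a j wk uwk F(2) in blast)+
    then show "t x v' = t x v + c [v, v']" by (simp add: t_def)
  next
    fix x v assume a: "x \<in> W" "v \<in> U" "x \<in> v"
    note j = i0[OF a(1)]
    have "t y v = t x v" if "y \<in> w (i0 x)" "y \<in> W" "y \<in> v" for y
      unfolding t[OF that(2) j(1) that(1) a(2) that(3)] t[OF a(1) j a(2,3)] ..
    then show "\<exists>w. openin X w \<and> x \<in> w \<and> (\<forall>y\<in>w \<inter> W. y \<in> v \<longrightarrow> t y v = t x v)"
      using j uwk F(2) by (intro exI[of _ "w (i0 x)"]) blast
  qed
  moreover have "t x v = s x v" if "x \<in> S" "v \<in> U" "x \<in> v" for x v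
  proof -
    have xW: "x \<in> W" using SW that by blast
    note j = i0[OF xW]
    have iS: "i0 x \<in> S" using j F by blast
    have "s x (u (i0 x)) = s (i0 x) (u (i0 x))" using uwk[OF iS] wk[OF j] that by blast
    moreover have "s x v = s x (u (i0 x)) + c [u (i0 x), v]"
      by (rule cech_section_change[OF s that(1) _ that(2) _ that(3)]) (use uwk[OF iS] wk[OF j] in blast)+
    ultimately show ?thesis by (simp add: t_def)
  qed
  ultimately show ?thesis using that Wo SW by blast
qed

section \<open>Differences and pull-backs of sections\<close>

lemma cech_section_subset:
  assumes "cech_section X S U c s" "T \<subseteq> S"
  shows "cech_section X T U c s"
proof (rule cech_sectionI)
  fix x u v assume "x \<in> T" "u \<in> U" "v \<in> U" "x \<in> u" "x \<in> v"
  then show "s x v = s x u + c [u, v]" using assms(2) by (intro cech_section_change[OF assms(1)]) auto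
next
  fix x u assume a: "x \<in> T" "u \<in> U" "x \<in> u"
  obtain w where "openin X w" "x \<in> w" "\<forall>y\<in>w \<inter> S. y \<in> u \<longrightarrow> s y u = s x u"
    using cech_section_locally_const[OF assms(1) _ a(2,3)] a(1) assms(2) by blast
  then show "\<exists>w. openin X w \<and> x \<in> w \<and> (\<forall>y\<in>w \<inter> T. y \<in> u \<longrightarrow> s y u = s x u)"
    using assms(2) by blast
qed

lemma cech_section_diff_const:
  assumes "cech_section X S U c s" "cech_section X S U c t"
    and "x \<in> S" "u \<in> U" "v \<in> U" "x \<in> u" "x \<in> v"
  shows "s x v - t x v = s x u - t x u"
  using cech_section_change[OF assms(1,3-7)] cech_section_change[OF assms(2,3-7)] by simp

text \<open>Transition terms cancel in a difference of sections, so it is a function of the point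
  alone. The conclusion allows unrelated charts at \<open>x\<close> and \<open>y\<close>, so the
  difference may be evaluated in charts chosen separately at each point.\<close>

lemma cech_section_diff_locally_const:
  assumes U: "cech_cover X U"
    and s: "cech_section X S U c s" and t: "cech_section X S U c t" and x: "x \<in> S" "x \<in> topspace X"
  obtains w where "openin X w" "x \<in> w"
    "\<And>y u v. \<lbrakk>y \<in> w; y \<in> S; u \<in> U; v \<in> U; x \<in> u; y \<in> v\<rbrakk> \<Longrightarrow> s y v - t y v = s x u - t x u"
proof -
  obtain u0 where u0: "u0 \<in> U" "x \<in> u0" using cech_cover_point[OF U x(2)] by blast
  obtain w1 where w1: "openin X w1" "x \<in> w1" "\<forall>y\<in>w1 \<inter> S. y \<in> u0 \<longrightarrow> s y u0 = s x u0"
    using cech_section_locally_const[OF s x(1) u0] by blast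
  obtain w2 where w2: "openin X w2" "x \<in> w2" "\<forall>y\<in>w2 \<inter> S. y \<in> u0 \<longrightarrow> t y u0 = t x u0"
    using cech_section_locally_const[OF t x(1) u0] by blast
  have "openin X (w1 \<inter> w2 \<inter> u0)" using w1 w2 cech_cover_open[OF U u0(1)] by blast
  moreover have "x \<in> w1 \<inter> w2 \<inter> u0" using w1 w2 u0 by blast
  moreover have "s y v - t y v = s x u - t x u"
    if "y \<in> w1 \<inter> w2 \<inter> u0" "y \<in> S" "u \<in> U" "v \<in> U" "x \<in> u" "y \<in> v" for y u v
  proof -
    have "s y u0 = s x u0" "t y u0 = t x u0" using w1 w2 that by blast+
    moreover have "s y v - t y v = s y u0 - t y u0"
      by (rule cech_section_diff_const[OF s t]) (use that u0 in auto)
    moreover have "s x u - t x u = s x u0 - t x u0"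
      by (rule cech_section_diff_const[OF s t]) (use that u0 x in auto)
    ultimately show ?thesis by simp
  qed
  ultimately show ?thesis by (rule that)
qed

text \<open>If the link \<open>h\<close> exhibits \<open>\<mu> * c\<close> as the pull-back of \<open>c\<close> under \<open>F\<close>, then \<open>F\<close> pulls sections of \<open>c\<close> over
  \<open>S\<close> back to sections of \<open>c\<close> over the preimage of \<open>S\<close>.\<close>

definition section_pull ::
    "('a \<Rightarrow> 'a) \<Rightarrow> 'a set set \<Rightarrow> complex \<Rightarrow> ('a \<Rightarrow> 'a set \<Rightarrow> 'a set \<Rightarrow> complex) \<Rightarrow>
      ('a \<Rightarrow> 'a set \<Rightarrow> complex) \<Rightarrow> 'a \<Rightarrow> 'a set \<Rightarrow> complex" where
  "section_pull F U \<mu> h s x u =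
     (let v = SOME v. v \<in> U \<and> F x \<in> v in (s (F x) v - h x u v) / \<mu>)"

text \<open>Another chart at \<open>F x\<close> changes \<open>s\<close> and \<open>h\<close> by the
  same term, so the chart hidden in \<open>section_pull\<close> can be replaced by any
  \<open>v\<close>. The factor \<open>\<mu>\<close> appears because the link starts at
  \<open>\<mu> * c\<close>.\<close>

lemma section_pull:
  assumes c: "(U, c) \<in> cech_cocycles X A 1" and \<mu>: "\<mu> \<noteq> 0"
    and h: "cech_link X A F (U, \<lambda>s. \<mu> * c s) (U, c) h"
    and s: "\<And>u v. \<lbrakk>u \<in> U; v \<in> U; F x \<in> u; F x \<in> v\<rbrakk> \<Longrightarrow> s (F x) v = s (F x) u + c [u, v]"
    and x: "u \<in> U" "x \<in> u" "v \<in> U" "F x \<in> v"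
  shows "\<mu> * section_pull F U \<mu> h s x u = s (F x) v - h x u v"
proof -
  define v0 where "v0 = (SOME v. v \<in> U \<and> F x \<in> v)"
  have v0: "v0 \<in> U" "F x \<in> v0" using someI[of "\<lambda>v. v \<in> U \<and> F x \<in> v" v] x unfolding v0_def by auto
  have "h x u v = h x u v0 - \<mu> * c [u, u] + c [v0, v]"
    by (rule cech_link_change[OF h x(1) x(1) v0(1) x(3) x(2) x(2) v0(2) x(4)])
  moreover have "c [u, u] = 0" by (rule cech_cocycle_refl[OF c x(1,2)])
  moreover have "s (F x) v = s (F x) v0 + c [v0, v]" by (rule s[OF v0(1) x(3) v0(2) x(4)])
  ultimately have "s (F x) v - h x u v = s (F x) v0 - h x u v0" by simp
  then show ?thesis using \<mu> by (simp add: section_pull_def v0_def[symmetric])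
qed

lemma section_pull_section:
  assumes c: "(U, c) \<in> cech_cocycles X A 1" and \<mu>: "\<mu> \<noteq> 0" and F: "continuous_map X X F"
    and h: "cech_link X A F (U, \<lambda>s. \<mu> * c s) (U, c) h"
    and s: "cech_section X S U c s"
  shows "cech_section X {x \<in> topspace X. F x \<in> S} U c (section_pull F U \<mu> h s)" (is "cech_section X ?S U c ?p")
proof (rule cech_sectionI)
  note U = cech_cocycle_cover[OF c]
  have pull: "\<mu> * ?p x u = s (F x) v - h x u v"
    if "x \<in> ?S" "u \<in> U" "x \<in> u" "v \<in> U" "F x \<in> v" for x u v
  proof (rule section_pull[OF c \<mu> h _ that(2-5)])
    fix u v assume "u \<in> U" "v \<in> U" "F x \<in> u" "F x \<in> v"
    then show "s (F x) v = s (F x) u + c [u, v]"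
      using that(1) by (intro cech_section_change[OF s]) auto
  qed
  {
    fix x u u' assume a: "x \<in> ?S" "u \<in> U" "u' \<in> U" "x \<in> u" "x \<in> u'"
    obtain v w where v: "v \<in> U" and w: "openin X w" "x \<in> w" "\<And>y. y \<in> w \<Longrightarrow> F y \<in> v"
      using continuous_map_preimage_open[OF F U] a(1) by blast
    note Fx = w(3)[OF w(2)]
    have "h x u' v = h x u v - \<mu> * c [u, u'] + c [v, v]"
      by (rule cech_link_change[OF h a(2,3) v v a(4,5) Fx Fx])
    moreover have "c [v, v] = 0" by (rule cech_cocycle_refl[OF c v Fx])
    ultimately have "\<mu> * ?p x u' = \<mu> * (?p x u + c [u, u'])"
      using pull[OF a(1,2,4) v Fx] pull[OF a(1,3,5) v Fx] by (simp add: distrib_left)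
    then show "?p x u' = ?p x u + c [u, u']" using \<mu> by simp
  }
  fix x u assume a: "x \<in> ?S" "u \<in> U" "x \<in> u"
  obtain v w where v: "v \<in> U" and w: "openin X w" "x \<in> w" "\<And>y. y \<in> w \<Longrightarrow> F y \<in> v"
    using continuous_map_preimage_open[OF F U] a(1) by blast
  note Fx = w(3)[OF w(2)]
  obtain w1 where w1: "openin X w1" "x \<in> w1" "\<forall>y\<in>w1. y \<in> u \<and> F y \<in> v \<longrightarrow> h y u v = h x u v"
    using cech_link_locally_const[OF h a(2) v a(3) Fx] by blast
  obtain w2 where w2: "openin X w2" "F x \<in> w2" "\<forall>y\<in>w2 \<inter> S. y \<in> v \<longrightarrow> s y v = s (F x) v"
    using cech_section_locally_const[OF s _ v Fx] a(1) by blast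
  have "openin X {y \<in> topspace X. F y \<in> w2}" using F w2(1) by (simp add: continuous_map_def)
  then have "openin X (w \<inter> w1 \<inter> {y \<in> topspace X. F y \<in> w2})" using w w1 by blast
  moreover have "x \<in> w \<inter> w1 \<inter> {y \<in> topspace X. F y \<in> w2}" using w w1 w2 a by blast
  moreover have "?p y u = ?p x u"
    if "y \<in> w \<inter> w1 \<inter> {y \<in> topspace X. F y \<in> w2}" "y \<in> ?S" "y \<in> u" for y
  proof -
    have Fy: "F y \<in> v" using w that by blast
    have "h y u v = h x u v" using w1 Fy that by blast
    moreover have "s (F y) v = s (F x) v" using w2 Fy that by blast
    ultimately have "\<mu> * ?p y u = \<mu> * ?p x u"
      using pull[OF a v Fx] pull[OF that(2) a(2) that(3) v Fy] by simp
    then show ?thesis using \<mu> by simp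
  qed
  ultimately show "\<exists>w. openin X w \<and> x \<in> w \<and> (\<forall>y\<in>w \<inter> ?S. y \<in> u \<longrightarrow> ?p y u = ?p x u)"
    by blast
qed

section \<open>Locally constant functions and finitely many components\<close>

definition locally_constant :: "'a topology \<Rightarrow> ('a \<Rightarrow> 'b) \<Rightarrow> bool" where
  "locally_constant T e \<longleftrightarrow>
     (\<forall>x\<in>topspace T. \<exists>w. openin T w \<and> x \<in> w \<and> (\<forall>y\<in>w. e y = e x))"

lemma locally_constant_connected_component:
  assumes e: "locally_constant T e" and xy: "connected_component_of T x y"
  shows "e x = e y"
proof -
  have "continuous_map T (discrete_topology UNIV) e"
    unfolding continuous_map_def
  proof (intro conjI allI impI)
    fix V
    show "openin T {x \<in> topspace T. e x \<in> V}"
    proof (subst openin_subopen, intro ballI)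
      fix x assume x: "x \<in> {x \<in> topspace T. e x \<in> V}"
      then have "x \<in> topspace T" by simp
      from e[unfolded locally_constant_def, THEN bspec, OF this]
      obtain w where w: "openin T w" "x \<in> w" "\<forall>y\<in>w. e y = e x"
        by (elim exE conjE) (rule that)
      have "w \<subseteq> {x \<in> topspace T. e x \<in> V}"
      proof
        fix y assume y: "y \<in> w"
        have "e y = e x" using y w(3) by (rule bspec[rotated])
        then show "y \<in> {x \<in> topspace T. e x \<in> V}" using x y openin_subset[OF w(1)] by auto
      qed
      then show "\<exists>w. openin T w \<and> x \<in> w \<and> w \<subseteq> {x \<in> topspace T. e x \<in> V}"
        using w by blast
    qed
  qed simp
  moreover obtain S where S: "connectedin T S" "x \<in> S" "y \<in> S"
    using xy by (auto simp: connected_component_of_def)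
  ultimately have "connectedin (discrete_topology UNIV) (e ` S)"
    using connectedin_continuous_map_image by blast
  then obtain a where "e ` S \<subseteq> {a}" by (auto simp: connectedin_discrete_topology)
  then have "e x = a" "e y = a" using S(2,3) by auto
  then show ?thesis by simp
qed

lemma connected_component_of_image:
  assumes "continuous_map T T' F" "connected_component_of T x y"
  shows "connected_component_of T' (F x) (F y)"
  using assms connectedin_continuous_map_image unfolding connected_component_of_def by blast

text \<open>A continuous surjection induces a surjection of the finite set of components, hence a
  permutation, and this has finite order.\<close>

lemma funpow_fixes_components:
  assumes fin: "finite (connected_components_of T)"
    and F: "continuous_map T T F" and surj: "F ` topspace T = topspace T"
  obtains k where "k > 0" "\<And>x. x \<in> topspace T \<Longrightarrow> connected_component_of T x ((F ^^ k) x)"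
proof -
  define \<kappa> where "\<kappa> x = Collect (connected_component_of T x)" for x
  have \<kappa>_eq: "\<kappa> x = \<kappa> y \<longleftrightarrow> connected_component_of T x y" if "y \<in> topspace T" for x y
    using that unfolding \<kappa>_def by (metis connected_component_of_equiv connected_component_of_refl mem_Collect_eq)
  have comps: "connected_components_of T = \<kappa> ` topspace T"
    by (auto simp: connected_components_of_def \<kappa>_def)
  have FT: "F x \<in> topspace T" if "x \<in> topspace T" for x using surj that by blast
  \<comment> \<open>Extended by the identity off the set of components, as \<open>permutes\<close>
    requires.\<close>
  define p where "p C = (if C \<in> \<kappa> ` topspace T then \<kappa> (F (SOME x. x \<in> topspace T \<and> \<kappa> x = C)) else C)" for C
  have p: "p (\<kappa> x) = \<kappa> (F x)" if x: "x \<in> topspace T" for x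
  proof -
    define y where "y = (SOME y. y \<in> topspace T \<and> \<kappa> y = \<kappa> x)"
    have y: "y \<in> topspace T" "\<kappa> y = \<kappa> x"
      using someI[of "\<lambda>y. y \<in> topspace T \<and> \<kappa> y = \<kappa> x" x] x unfolding y_def by auto
    then have "connected_component_of T y x" using \<kappa>_eq[OF x] by blast
    then have "connected_component_of T (F y) (F x)" by (rule connected_component_of_image[OF F])
    then have "\<kappa> (F y) = \<kappa> (F x)" using \<kappa>_eq[OF FT[OF x]] by blast
    then show ?thesis using x by (simp add: p_def y_def)
  qed
  have pC: "p ` (\<kappa> ` topspace T) = \<kappa> ` topspace T"
  proof
    show "p ` (\<kappa> ` topspace T) \<subseteq> \<kappa> ` topspace T" using p FT by auto
    show "\<kappa> ` topspace T \<subseteq> p ` (\<kappa> ` topspace T)"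
    proof
      fix C assume "C \<in> \<kappa> ` topspace T"
      then obtain y where y: "y \<in> topspace T" "C = \<kappa> y" by blast
      then obtain x where x: "x \<in> topspace T" "y = F x" using surj by (metis imageE)
      then have "C = p (\<kappa> x)" using p[OF x(1)] y by simp
      then show "C \<in> p ` (\<kappa> ` topspace T)" using x by blast
    qed
  qed
  have finC: "finite (\<kappa> ` topspace T)" using fin comps by simp
  have "bij_betw p (\<kappa> ` topspace T) (\<kappa> ` topspace T)"
    using pC finC by (simp add: bij_betw_def eq_card_imp_inj_on)
  then have "p permutes \<kappa> ` topspace T"
    by (rule bij_imp_permutes) (auto simp: p_def)
  then have "permutation p" using finC permutation_permutes by blast
  then obtain k where k: "p ^^ k = id" "k > 0" using permutation_is_nilpotent by blast
  have pk: "(p ^^ n) (\<kappa> x) = \<kappa> ((F ^^ n) x) \<and> (F ^^ n) x \<in> topspace T" if "x \<in> topspace T" for n x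
    by (induction n) (use that p FT in auto)
  have "connected_component_of T x ((F ^^ k) x)" if "x \<in> topspace T" for x
    using pk[OF that, of k] k \<kappa>_eq[of "(F ^^ k) x" x] by simp
  then show ?thesis using that k by blast
qed

text \<open>If \<open>F ^^ k\<close> preserves the components, then \<open>e\<close> is invariant
  under it and the weighted sum \<open>S\<close> of \<open>e\<close> along \<open>k\<close> steps
  telescopes: \<open>S (F x) - \<mu> * S x = (1 - \<mu> ^ k) * e x\<close>. Division by this factor
  needs that \<open>\<mu>\<close> is no root of unity. Finiteness enters twice: it provides
  \<open>k\<close>, and it makes the components open, so that the solution is locally
  constant.\<close>

lemma locally_constant_cohomological_equation:
  fixes e :: "'a \<Rightarrow> complex"
  assumes fin: "finite (connected_components_of T)"
    and F: "continuous_map T T F" and surj: "F ` topspace T = topspace T"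
    and e: "locally_constant T e" and \<mu>: "\<forall>n::nat. n > 0 \<longrightarrow> \<mu> ^ n \<noteq> 1"
  obtains \<phi> where "locally_constant T \<phi>" "\<And>x. x \<in> topspace T \<Longrightarrow> \<phi> (F x) - \<mu> * \<phi> x = e x"
proof -
  obtain k where k: "k > 0" "\<And>x. x \<in> topspace T \<Longrightarrow> connected_component_of T x ((F ^^ k) x)"
    using funpow_fixes_components[OF fin F surj] by blast
  define S where "S x = (\<Sum>i<k. \<mu> ^ (k - Suc i) * e ((F ^^ i) x))" for x
  define \<phi> where "\<phi> x = S x / (1 - \<mu> ^ k)" for x
  have nz: "1 - \<mu> ^ k \<noteq> 0" using \<mu> k(1) by auto
  have "\<phi> (F x) - \<mu> * \<phi> x = e x" if x: "x \<in> topspace T" for x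
  proof -
    define a where "a i = \<mu> ^ (k - i) * e ((F ^^ i) x)" for i
    have "S (F x) = (\<Sum>i<k. a (Suc i))"
      unfolding S_def a_def by (simp only: funpow_Suc_right o_apply)
    moreover have "\<mu> * S x = (\<Sum>i<k. a i)"
      unfolding S_def a_def sum_distrib_left
    proof (rule sum.cong)
      fix i assume "i \<in> {..<k}"
      then have "k - i = Suc (k - Suc i)" by auto
      then show "\<mu> * (\<mu> ^ (k - Suc i) * e ((F ^^ i) x)) = \<mu> ^ (k - i) * e ((F ^^ i) x)" by simp
    qed simp
    ultimately have "S (F x) - \<mu> * S x = a k - a 0"
      by (simp add: sum_subtractf[symmetric] sum_lessThan_telescope)
    also have "\<dots> = (1 - \<mu> ^ k) * e x"
      using locally_constant_connected_component[OF e k(2)[OF x]] by (simp add: a_def algebra_simps)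
    finally have "(S (F x) - \<mu> * S x) / (1 - \<mu> ^ k) = e x" using nz by simp
    then show ?thesis by (simp add: \<phi>_def diff_divide_distrib)
  qed
  moreover have "locally_constant T \<phi>"
    unfolding locally_constant_def
  proof (intro ballI exI conjI)
    fix x assume x: "x \<in> topspace T"
    let ?w = "Collect (connected_component_of T x)"
    show "openin T ?w"
      by (rule open_in_finite_connected_components[OF fin]) (use x in \<open>auto simp: connected_components_of_def\<close>)
    show "x \<in> ?w" using x by (simp add: connected_component_of_refl)
    fix y assume y: "y \<in> ?w"
    have "e ((F ^^ i) x) = e ((F ^^ i) y)" for i
      by (rule locally_constant_connected_component[OF e]
          connected_component_of_image[OF funpow_continuous_map[OF F]])+ (use y in simp)
    then show "\<phi> y = \<phi> x" by (simp add: \<phi>_def S_def)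
  qed
  ultimately show ?thesis using that by blast
qed

lemma finite_image_locally_constant:
  assumes C: "compactin X C"
    and g: "\<And>x. x \<in> C \<Longrightarrow> \<exists>w. openin X w \<and> x \<in> w \<and> (\<forall>y\<in>w \<inter> C. g y = g x)"
  shows "finite (g ` C)"
proof -
  obtain w where w: "\<And>x. x \<in> C \<Longrightarrow> openin X (w x) \<and> x \<in> w x \<and> (\<forall>y\<in>w x \<inter> C. g y = g x)"
    using g by metis
  have "\<exists>F. finite F \<and> F \<subseteq> w ` C \<and> C \<subseteq> \<Union>F"
    using C w unfolding compactin_def by (elim conjE allE[of _ "w ` C"]) blast
  then obtain F where F: "finite F" "F \<subseteq> C" "C \<subseteq> \<Union>(w ` F)" by (metis finite_subset_image)
  have "g ` C \<subseteq> g ` F"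
  proof
    fix z assume "z \<in> g ` C"
    then obtain y where y: "y \<in> C" "z = g y" by blast
    then obtain x where x: "x \<in> F" "y \<in> w x" using F(3) by blast
    have "\<forall>y\<in>w x \<inter> C. g y = g x" using w x(1) F(2) by blast
    then have "g y = g x" using x(2) y(1) by (elim bspec) simp
    then show "z \<in> g ` F" using y(2) x(1) by simp
  qed
  then show ?thesis using F(1) finite_surj by blast
qed

section \<open>Gluing over the unstable set\<close>

lemma section_pull_shift:
  assumes "\<mu> \<noteq> 0"
  shows "section_pull F U \<mu> h (\<lambda>x u. s x u - \<phi> x) x u = section_pull F U \<mu> h s x u - \<phi> (F x) / \<mu>"
  by (simp add: section_pull_def Let_def diff_divide_distrib)

text \<open>The gluing argument in abstract form: \<open>pt\<close> is the base point,
  \<open>Y\<close> the copy of \<open>X\<close>, and \<open>T\<close> a neighbourhood of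
  \<open>pt\<close> that collapses to it in \<open>n0\<close> steps. By the hypothesis
  \<open>iso\<close>, a point of the core either reaches \<open>pt\<close> or lies in
  \<open>Y\<close>. The section \<open>s0\<close> expresses that the restricted class is zero, the
  conclusion that the class itself is.\<close>

lemma section_exists_attractor_repeller:
  fixes Q :: "'a topology"
  assumes cpt: "compact_space Q" and haus: "Hausdorff_space Q" and F: "continuous_map Q Q F"
    and pt: "pt \<in> topspace Q" "F pt = pt"
    and Y: "compactin Q Y" "F ` Y = Y" "pt \<notin> Y"
    and fin: "finite (connected_components_of (subtopology Q Y))"
    and T: "openin Q T" "pt \<in> T" "F ` T \<subseteq> T" "\<And>x. x \<in> T \<Longrightarrow> (F ^^ n0) x = pt"
    and iso: "\<And>x::int \<Rightarrow> 'a. \<lbrakk>range x \<subseteq> topspace Q - {pt}; \<And>i. F (x i) = x (i + 1)\<rbrakk> \<Longrightarrow> x 0 \<in> Y"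
    and c: "(U, c) \<in> cech_cocycles Q {pt} 1"
    and h: "cech_link Q {pt} F (U, \<lambda>s. \<mu> * c s) (U, c) h"
    and \<mu>: "\<mu> \<noteq> 0" "\<forall>n::nat. n > 0 \<longrightarrow> \<mu> ^ n \<noteq> 1"
    and s0: "cech_section Q Y U c s0"
  shows "\<exists>s. cech_section Q (topspace Q) U c s \<and> (\<forall>u\<in>U. pt \<in> u \<longrightarrow> s pt u = 0)"
proof -
  let ?Q = "topspace Q"
  note U = cech_cocycle_cover[OF c]
  have reg: "regular_space Q" using cpt haus by (rule compact_Hausdorff_imp_regular_space)
  have FQ: "F x \<in> ?Q" if "x \<in> ?Q" for x using F that by (auto simp: continuous_map_def)
  have FnQ: "(F ^^ n) x \<in> ?Q" if "x \<in> ?Q" for x n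
    by (induction n) (use that FQ in auto)
  have Fnpt: "(F ^^ n) pt = pt" for n by (induction n) (use pt in auto)
  have opre: "openin Q {x \<in> ?Q. (F ^^ n) x \<in> W}" if "openin Q W" for n W
    using funpow_continuous_map[OF F, of n] that by (simp add: continuous_map_def)
  have opre1: "openin Q {x \<in> ?Q. F x \<in> W}" if "openin Q W" for W
    using F that by (simp add: continuous_map_def)
  have YQ: "Y \<subseteq> ?Q" using Y(1) by (rule compactin_subset_topspace)
  have Ycl: "closedin Q Y" using compactin_imp_closedin[OF haus Y(1)] .
  define pull where "pull = section_pull F U \<mu> h"
  have pull_eq: "\<mu> * pull s x u = s (F x) v - h x u v"
    if "cech_section Q S U c s" "F x \<in> S" "u \<in> U" "x \<in> u" "v \<in> U" "F x \<in> v" for s S x u v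
    unfolding pull_def
    by (rule section_pull[OF c \<mu>(1) h _ that(3-6)]) (rule cech_section_change[OF that(1,2)])
  have pull_section: "cech_section Q {x \<in> ?Q. F x \<in> S} U c (pull s)"
    if "cech_section Q S U c s" for s S
    unfolding pull_def by (rule section_pull_section[OF c \<mu>(1) F h that])
  define u0 where "u0 x = (SOME u. u \<in> U \<and> x \<in> u)" for x
  have u0: "u0 x \<in> U" "x \<in> u0 x" if "x \<in> ?Q" for x
    using someI_ex[of "\<lambda>u. u \<in> U \<and> x \<in> u"] cech_cover_point[OF U that] unfolding u0_def by auto

  text \<open>After subtracting a locally constant function, the section over \<open>Y\<close> is invariant under the
    pull-back. This is where the finiteness of the set of components enters.\<close>
  have ps0: "cech_section Q Y U c (pull s0)"
    by (rule cech_section_subset[OF pull_section[OF s0]]) (use YQ Y(2) in blast)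
  \<comment> \<open>The factor \<open>- \<mu>\<close> makes invariance of \<open>s0 - \<phi>\<close>
    the same as \<open>\<phi> (F x) - \<mu> * \<phi> x = e x\<close>, since \<open>\<phi>\<close>
    enters the pull-back as \<open>\<phi> (F x) / \<mu>\<close>.\<close>
  define e where "e x = - \<mu> * (s0 x (u0 x) - pull s0 x (u0 x))" for x
  have e: "locally_constant (subtopology Q Y) e"
    unfolding locally_constant_def
  proof
    fix x assume "x \<in> topspace (subtopology Q Y)"
    then have x: "x \<in> Y" "x \<in> ?Q" by auto
    obtain w where w: "openin Q w" "x \<in> w"
      "\<And>y u v. \<lbrakk>y \<in> w; y \<in> Y; u \<in> U; v \<in> U; x \<in> u; y \<in> v\<rbrakk> \<Longrightarrow> s0 y v - pull s0 y v = s0 x u - pull s0 x u"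
      by (rule cech_section_diff_locally_const[OF U s0 ps0 x]) (rule that)
    show "\<exists>w. openin (subtopology Q Y) w \<and> x \<in> w \<and> (\<forall>y\<in>w. e y = e x)"
    proof (intro exI conjI ballI)
      show "openin (subtopology Q Y) (w \<inter> Y)" using w(1) by (rule openin_subtopology_Int)
      show "x \<in> w \<inter> Y" using w x by blast
      fix y assume y: "y \<in> w \<inter> Y"
      then have "y \<in> ?Q" using YQ by blast
      then have "s0 y (u0 y) - pull s0 y (u0 y) = s0 x (u0 x) - pull s0 x (u0 x)"
        using y x by (intro w(3) u0) auto
      then show "e y = e x" by (simp only: e_def)
    qed
  qed
  have "continuous_map (subtopology Q Y) (subtopology Q Y) F"
    using F Y(2) YQ by (auto simp: continuous_map_in_subtopology continuous_map_from_subtopology)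
  moreover have "F ` topspace (subtopology Q Y) = topspace (subtopology Q Y)"
    using Y(2) YQ by (simp add: Int_absorb1)
  ultimately obtain \<phi> where \<phi>: "locally_constant (subtopology Q Y) \<phi>"
      "\<And>x. x \<in> topspace (subtopology Q Y) \<Longrightarrow> \<phi> (F x) - \<mu> * \<phi> x = e x"
    using locally_constant_cohomological_equation[OF fin _ _ e \<mu>(2)] by metis
  define s1 where "s1 x u = s0 x u - \<phi> x" for x u
  have s1: "cech_section Q Y U c s1"
  proof (rule cech_sectionI)
    fix x u v assume "x \<in> Y" "u \<in> U" "v \<in> U" "x \<in> u" "x \<in> v"
    from cech_section_change[OF s0 this] show "s1 x v = s1 x u + c [u, v]" by (simp add: s1_def)
  next
    fix x u assume a: "x \<in> Y" "u \<in> U" "x \<in> u"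
    obtain w where w: "openin Q w" "x \<in> w" "\<forall>y\<in>w \<inter> Y. y \<in> u \<longrightarrow> s0 y u = s0 x u"
      using cech_section_locally_const[OF s0 a] by (elim exE conjE) (rule that)
    have "x \<in> topspace (subtopology Q Y)" using a YQ by auto
    from \<phi>(1)[unfolded locally_constant_def, THEN bspec, OF this]
    obtain w' where w': "openin (subtopology Q Y) w'" "x \<in> w'" "\<forall>y\<in>w'. \<phi> y = \<phi> x"
      by (elim exE conjE) (rule that)
    obtain w2 where w2: "openin Q w2" "w' = w2 \<inter> Y" using w'(1) by (auto simp: openin_subtopology)
    show "\<exists>w. openin Q w \<and> x \<in> w \<and> (\<forall>y\<in>w \<inter> Y. y \<in> u \<longrightarrow> s1 y u = s1 x u)"
    proof (intro exI conjI ballI impI)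
      show "openin Q (w \<inter> w2)" using w w2 by blast
      show "x \<in> w \<inter> w2" using w w' w2 by blast
      fix y assume y: "y \<in> w \<inter> w2 \<inter> Y" "y \<in> u"
      then have "\<phi> y = \<phi> x" by (intro bspec[OF w'(3)]) (simp add: w2)
      moreover have "s0 y u = s0 x u" by (rule w(3)[rule_format]) (use y in auto)
      ultimately show "s1 y u = s1 x u" by (simp add: s1_def)
    qed
  qed
  have s1_inv: "pull s1 x u = s1 x u" if x: "x \<in> Y" "u \<in> U" "x \<in> u" for x u
  proof -
    have "x \<in> ?Q" using x YQ by blast
    have d: "s0 x (u0 x) - pull s0 x (u0 x) = s0 x u - pull s0 x u"
      by (rule cech_section_diff_const[OF s0 ps0]) (use x u0[OF \<open>x \<in> ?Q\<close>] in auto)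
    have "\<phi> (F x) - \<mu> * \<phi> x = e x" by (rule \<phi>(2)) (use x YQ in auto)
    then have "\<phi> (F x) = \<mu> * (\<phi> x - (s0 x u - pull s0 x u))"
      unfolding e_def d by (simp add: algebra_simps)
    then have "\<phi> (F x) / \<mu> = \<phi> x - (s0 x u - pull s0 x u)" using \<mu>(1) by simp
    moreover have "pull s1 x u = pull s0 x u - \<phi> (F x) / \<mu>"
      unfolding pull_def s1_def by (rule section_pull_shift[OF \<mu>(1)])
    ultimately show ?thesis by (simp add: s1_def)
  qed
  obtain V t where V: "openin Q V" "Y \<subseteq> V" and t: "cech_section Q V U c t"
    and ts1: "\<And>x u. x \<in> Y \<Longrightarrow> u \<in> U \<Longrightarrow> x \<in> u \<Longrightarrow> t x u = s1 x u"
    by (rule cech_section_extend[OF reg Y(1) c s1]) (rule that)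
  \<comment> \<open>\<open>t\<close> is a section over \<open>V\<close> and \<open>pull t\<close>
    over the preimage of \<open>V\<close>; they can be compared on \<open>V'\<close>.\<close>
  define V' where "V' = V \<inter> {x \<in> ?Q. F x \<in> V}"
  have V': "openin Q V'" unfolding V'_def using V(1) opre1 by blast
  have tV': "cech_section Q V' U c t" and ptV': "cech_section Q V' U c (pull t)"
    by (rule cech_section_subset[OF t] cech_section_subset[OF pull_section[OF t]]; simp add: V'_def)+
  \<comment> \<open>Invariance is known on \<open>Y\<close> only. It persists on a neighbourhood
    because \<open>t - pull t\<close> is locally constant.\<close>
  define V1 where "V1 = {x \<in> V'. \<forall>u\<in>U. x \<in> u \<longrightarrow> t x u - pull t x u = 0}"
  have V1: "openin Q V1"
  proof (subst openin_subopen, intro ballI)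
    fix x assume x: "x \<in> V1"
    then have xV: "x \<in> V'" "x \<in> ?Q" by (auto simp: V1_def V'_def)
    obtain w where w: "openin Q w" "x \<in> w"
      "\<And>y u v. \<lbrakk>y \<in> w; y \<in> V'; u \<in> U; v \<in> U; x \<in> u; y \<in> v\<rbrakk> \<Longrightarrow> t y v - pull t y v = t x u - pull t x u"
      by (rule cech_section_diff_locally_const[OF U tV' ptV' xV]) (rule that)
    have z: "t x (u0 x) - pull t x (u0 x) = 0" using x u0[OF xV(2)] unfolding V1_def by blast
    have "w \<inter> V' \<subseteq> V1"
    proof
      fix y assume y: "y \<in> w \<inter> V'"
      have "t y v - pull t y v = 0" if "v \<in> U" "y \<in> v" for v
        using w(3)[of y "u0 x" v] y that u0[OF xV(2)] z by simp
      then show "y \<in> V1" using y by (simp add: V1_def)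
    qed
    moreover have "openin Q (w \<inter> V')" using w(1) V' by blast
    ultimately show "\<exists>W. openin Q W \<and> x \<in> W \<and> W \<subseteq> V1" using w(2) xV(1) by blast
  qed
  have YV1: "Y \<subseteq> V1"
  proof
    fix x assume x: "x \<in> Y"
    then have Fx: "F x \<in> Y" and xQ: "x \<in> ?Q" using Y(2) YQ by blast+
    have "t x u - pull t x u = 0" if u: "u \<in> U" "x \<in> u" for u
    proof -
      note v = u0[OF FQ[OF xQ]]
      have "\<mu> * pull t x u = t (F x) (u0 (F x)) - h x u (u0 (F x))"
        by (rule pull_eq[OF t _ u v]) (use Fx V in blast)
      moreover have "\<mu> * pull s1 x u = s1 (F x) (u0 (F x)) - h x u (u0 (F x))"
        by (rule pull_eq[OF s1 Fx u v])
      ultimately have "\<mu> * pull t x u = \<mu> * pull s1 x u" using ts1[OF Fx v] by simp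
      then have "pull t x u = pull s1 x u" using \<mu>(1) by simp
      then show ?thesis using s1_inv[OF x u] ts1[OF x u] by simp
    qed
    then show "x \<in> V1" using x Fx xQ V(2) unfolding V1_def V'_def by blast
  qed

  text \<open>The zero section over \<open>pt\<close> is pulled back to the basin of attraction of \<open>pt\<close>.\<close>
  define b where "b k = (pull ^^ k) (\<lambda>x u. 0)" for k :: nat
  define Bk where "Bk k = {x \<in> ?Q. (F ^^ k) x = pt}" for k
  define B where "B = (\<Union>k. Bk k)"
  have bSuc: "b (Suc k) = pull (b k)" for k by (simp add: b_def)
  have BkSuc: "Bk (Suc k) = {x \<in> ?Q. F x \<in> Bk k}" for k
    using FQ by (auto simp: Bk_def funpow_swap1)
  have BkMono: "Bk k \<subseteq> Bk (k + l)" for k l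
    using Fnpt by (auto simp: Bk_def funpow_add add.commute[of k])
  have b: "cech_section Q (Bk k) U c (b k)" for k
  proof (induction k)
    case 0
    show ?case
    proof (rule cech_sectionI)
      fix x u v assume "x \<in> Bk 0" "u \<in> U" "v \<in> U" "x \<in> u" "x \<in> v"
      then have "c [u, v] = 0" by (intro cech_cocycle_zero[OF c, of pt]) (auto simp: Bk_def)
      then show "b 0 x v = b 0 x u + c [u, v]" by (simp add: b_def)
    qed (use openin_topspace in \<open>auto simp: b_def Bk_def\<close>)
  next
    case (Suc k)
    show ?case unfolding bSuc BkSuc by (rule pull_section[OF Suc])
  qed
  \<comment> \<open>\<open>b (Suc k)\<close> extends \<open>b k\<close>, so the sections over the
    increasing sets \<open>Bk k\<close> fit together. The induction starts because the link vanishes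
    at \<open>pt\<close>, that is, because the class is relative to the base point.\<close>
  have bstep: "b (Suc k) x u = b k x u" if "x \<in> Bk k" "u \<in> U" "x \<in> u" for k x u
    using that
  proof (induction k arbitrary: x u)
    case 0
    then have x: "x = pt" by (simp add: Bk_def)
    have "\<mu> * pull (b 0) x u = b 0 (F x) u - h x u u"
      by (rule pull_eq[OF b[of 0]]) (use 0 x pt in \<open>auto simp: Bk_def\<close>)
    moreover have "h x u u = 0"
      by (rule cech_link_zero[OF h]) (use 0 x pt in auto)
    ultimately show ?case using \<mu>(1) by (simp add: bSuc) (simp add: b_def)
  next
    case (Suc k)
    have xQ: "x \<in> ?Q" and Fx: "F x \<in> Bk k" using Suc.prems(1) unfolding BkSuc by blast+
    have Fx2: "F x \<in> Bk (Suc k)" using Fx BkMono[of k 1] by auto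
    note v = u0[OF FQ[OF xQ]]
    have "\<mu> * pull (b (Suc k)) x u = b (Suc k) (F x) (u0 (F x)) - h x u (u0 (F x))"
      by (rule pull_eq[OF b Fx2 Suc.prems(2,3) v])
    moreover have "\<mu> * pull (b k) x u = b k (F x) (u0 (F x)) - h x u (u0 (F x))"
      by (rule pull_eq[OF b Fx Suc.prems(2,3) v])
    ultimately have "\<mu> * pull (b (Suc k)) x u = \<mu> * pull (b k) x u"
      using Suc.IH[OF Fx v] by simp
    then show ?case using \<mu>(1) bSuc by simp
  qed
  have bplus: "b (k + l) x u = b k x u" if "x \<in> Bk k" "u \<in> U" "x \<in> u" for k l x u
  proof (induction l)
    case (Suc l)
    have "x \<in> Bk (k + l)" using BkMono that by blast
    from bstep[OF this that(2,3)] Suc show ?case by simp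
  qed simp
  define \<beta> where "\<beta> x u = b (LEAST k. x \<in> Bk k) x u" for x u
  have \<beta>: "\<beta> x u = b k x u" if "x \<in> Bk k" "u \<in> U" "x \<in> u" for k x u
  proof -
    let ?l = "LEAST k. x \<in> Bk k"
    have l: "x \<in> Bk ?l" using that(1) by (rule LeastI)
    have "?l \<le> k" using that(1) by (rule Least_le)
    then have "b k x u = b ?l x u" using bplus[OF l that(2,3), of "k - ?l"] by simp
    then show ?thesis by (simp add: \<beta>_def)
  qed
  have TQ: "T \<subseteq> ?Q" using T(1) by (rule openin_subset)
  \<comment> \<open>\<open>Bk k\<close> is closed but in general not open. The open preimage of
    \<open>T\<close> under \<open>F ^^ k\<close> lies between \<open>Bk k\<close> and
    \<open>Bk (k + n0)\<close>. This makes \<open>B\<close> open and \<open>\<beta>\<close> locally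
    constant, and later it relates \<open>Bk\<close> to the sets \<open>Z\<close>.\<close>
  have preT: "{x \<in> ?Q. (F ^^ k) x \<in> T} \<subseteq> Bk (k + n0)" for k
    using T(4) by (auto simp: Bk_def funpow_add add.commute[of k])
  have BkT: "Bk k \<subseteq> {x \<in> ?Q. (F ^^ k) x \<in> T}" for k using T(2) by (auto simp: Bk_def)
  have Bo: "openin Q B"
  proof (subst openin_subopen, intro ballI)
    fix x assume "x \<in> B"
    then obtain k where "x \<in> Bk k" by (auto simp: B_def)
    then show "\<exists>W. openin Q W \<and> x \<in> W \<and> W \<subseteq> B"
      using BkT[of k] preT[of k] opre[OF T(1), of k]
      by (intro exI[of _ "{x \<in> ?Q. (F ^^ k) x \<in> T}"]) (auto simp: B_def)
  qed
  have \<beta>B: "cech_section Q B U c \<beta>"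
  proof (rule cech_sectionI)
    fix x u v assume a: "x \<in> B" "u \<in> U" "v \<in> U" "x \<in> u" "x \<in> v"
    obtain k where k: "x \<in> Bk k" using a(1) by (auto simp: B_def)
    show "\<beta> x v = \<beta> x u + c [u, v]"
      unfolding \<beta>[OF k a(2,4)] \<beta>[OF k a(3,5)] by (rule cech_section_change[OF b k a(2-5)])
  next
    fix x u assume a: "x \<in> B" "u \<in> U" "x \<in> u"
    obtain k where k: "x \<in> Bk k" using a(1) by (auto simp: B_def)
    have k': "x \<in> Bk (k + n0)" using k BkMono by blast
    obtain w where w: "openin Q w" "x \<in> w" "\<forall>y\<in>w \<inter> Bk (k + n0). y \<in> u \<longrightarrow> b (k + n0) y u = b (k + n0) x u"
      using cech_section_locally_const[OF b k' a(2,3)] by (elim exE conjE) (rule that)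
    show "\<exists>w. openin Q w \<and> x \<in> w \<and> (\<forall>y\<in>w \<inter> B. y \<in> u \<longrightarrow> \<beta> y u = \<beta> x u)"
    proof (intro exI conjI ballI impI)
      show "openin Q (w \<inter> {x \<in> ?Q. (F ^^ k) x \<in> T})" using w(1) opre[OF T(1)] by blast
      show "x \<in> w \<inter> {x \<in> ?Q. (F ^^ k) x \<in> T}" using w(2) k BkT by blast
      fix y assume y: "y \<in> w \<inter> {x \<in> ?Q. (F ^^ k) x \<in> T} \<inter> B" "y \<in> u"
      then have yk: "y \<in> Bk (k + n0)" using preT by blast
      have "b (k + n0) y u = b (k + n0) x u" by (rule w(3)[rule_format]) (use y yk in auto)
      then show "\<beta> y u = \<beta> x u" unfolding \<beta>[OF yk a(2) y(2)] \<beta>[OF k' a(2,3)] .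
    qed
  qed
  have FB: "F x \<in> B" if xB: "x \<in> B" for x
  proof -
    obtain k where "x \<in> Bk k" using xB by (auto simp: B_def)
    then have "x \<in> Bk (Suc k)" using BkMono[of k 1] by auto
    then show ?thesis unfolding BkSuc B_def by blast
  qed
  have FnB: "(F ^^ n) x \<in> B" if "x \<in> B" for x n by (induction n) (use that FB in auto)
  have \<beta>_eq: "\<mu> * \<beta> x u = \<beta> (F x) v - h x u v"
    if a: "x \<in> B" "u \<in> U" "x \<in> u" "v \<in> U" "F x \<in> v" for x u v
  proof -
    obtain k where k: "x \<in> Bk k" using a(1) by (auto simp: B_def)
    then have k': "x \<in> Bk (Suc k)" using BkMono[of k 1] by auto
    then have Fx: "F x \<in> Bk k" unfolding BkSuc by blast
    show ?thesis
      unfolding \<beta>[OF k' a(2,3)] \<beta>[OF Fx a(4,5)] bSuc by (rule pull_eq[OF b Fx a(2-5)])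
  qed
  have FY: "(F ^^ n) x \<in> Y" if "x \<in> Y" for n x by (induction n) (use that Y(2) in auto)
  have YB: "Y \<inter> B = {}" using FY Y(3) by (auto simp: B_def Bk_def)

  define g where "g x = t x (u0 x) - \<beta> x (u0 x)" for x
  have tVB: "cech_section Q (V \<inter> B) U c t" and \<beta>VB: "cech_section Q (V \<inter> B) U c \<beta>"
    by (rule cech_section_subset[OF t] cech_section_subset[OF \<beta>B]; simp)+
  have g: "t x u - \<beta> x u = g x" if "x \<in> V" "x \<in> B" "u \<in> U" "x \<in> u" for x u
  proof -
    have "x \<in> ?Q" using that V(1) openin_subset by blast
    show ?thesis unfolding g_def
      by (rule cech_section_diff_const[OF tVB \<beta>VB]) (use that u0[OF \<open>x \<in> ?Q\<close>] in auto)
  qed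
  have VB: "openin Q (V \<inter> B)" using V(1) Bo by blast
  have g_lc: "\<exists>w. openin Q w \<and> x \<in> w \<and> w \<subseteq> V \<inter> B \<and> (\<forall>y\<in>w. g y = g x)" if x: "x \<in> V" "x \<in> B" for x
  proof -
    have xQ: "x \<in> V \<inter> B" "x \<in> ?Q" using x V(1) openin_subset by blast+
    obtain w where w: "openin Q w" "x \<in> w"
      "\<And>y u v. \<lbrakk>y \<in> w; y \<in> V \<inter> B; u \<in> U; v \<in> U; x \<in> u; y \<in> v\<rbrakk> \<Longrightarrow> t y v - \<beta> y v = t x u - \<beta> x u"
      by (rule cech_section_diff_locally_const[OF U tVB \<beta>VB xQ]) (rule that)
    show ?thesis
    proof (intro exI conjI ballI)
      show "openin Q (w \<inter> (V \<inter> B))" using w(1) VB by blast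
      show "x \<in> w \<inter> (V \<inter> B)" using w(2) x by blast
      fix y assume y: "y \<in> w \<inter> (V \<inter> B)"
      then have "y \<in> ?Q" using VB openin_subset by blast
      then show "g y = g x" unfolding g_def using y by (intro w(3) u0 xQ(2)) auto
    qed blast
  qed
  \<comment> \<open>\<open>t\<close> and \<open>\<beta>\<close> satisfy the same equation at
    \<open>x\<close>, with the same term \<open>h\<close>, which cancels in the difference.\<close>
  have gF: "g (F x) = \<mu> * g x" if x: "x \<in> V1" "x \<in> B" for x
  proof -
    have xV: "x \<in> V" "F x \<in> V" "x \<in> ?Q" using x by (auto simp: V1_def V'_def)
    note u = u0[OF xV(3)] and v = u0[OF FQ[OF xV(3)]]
    have "t x (u0 x) - pull t x (u0 x) = 0" using x(1) u unfolding V1_def by blast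
    then have A: "\<mu> * t x (u0 x) = t (F x) (u0 (F x)) - h x (u0 x) (u0 (F x))"
      using pull_eq[OF t xV(2) u v] by simp
    show ?thesis
      using A \<beta>_eq[OF x(2) u v] by (simp add: g_def right_diff_distrib)
  qed

  define K where "K = core Q F"
  have Kcl: "closedin Q K" unfolding K_def by (rule closedin_core[OF cpt haus F])
  have FK: "F ` K = K" unfolding K_def by (rule image_core[OF cpt haus F])
  have KQ: "K \<subseteq> ?Q" using Kcl by (rule closedin_subset)
  have FnK: "(F ^^ n) x \<in> K" if "x \<in> K" for n x by (induction n) (use that FK in auto)
  have ptK: "pt \<in> K" using Fnpt pt(1) unfolding K_def core_def by (metis INT_I image_eqI)
  \<comment> \<open>A full orbit through \<open>p\<close> in the core cannot meet \<open>pt\<close>: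
    at a negative time this would force \<open>p = pt\<close>, at another time it would put
    \<open>p\<close> into \<open>B\<close>.\<close>
  have KB: "p \<in> Y" if p: "p \<in> K" "p \<notin> B" for p
  proof -
    obtain x :: "int \<Rightarrow> 'a" where x: "range x \<subseteq> K" "x 0 = p" "\<And>i. F (x i) = x (i + 1)"
      by (rule full_orbit_exists[OF FK p(1)]) (rule that)
    have xn: "(F ^^ n) (x i) = x (i + int n)" for n i
      by (induction n) (auto simp: x(3) add.commute add.left_commute)
    have "x i \<noteq> pt" for i
    proof
      assume i: "x i = pt"
      have "\<exists>n. (F ^^ n) p = pt"
      proof (cases "i \<ge> 0")
        case True
        then show ?thesis using xn[of "nat i" 0] x(2) i by auto
      next
        case False
        then have "p = pt" using xn[of "nat (- i)" i] x(2) i Fnpt by simp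
        then show ?thesis using Fnpt by blast
      qed
      then show False using p KQ by (auto simp: B_def Bk_def)
    qed
    then have "x 0 \<in> Y" using x(1,3) KQ by (intro iso) auto
    then show ?thesis using x(2) by simp
  qed
  \<comment> \<open>These compact sets shrink to the part of the core that never enters
    \<open>T\<close>, which lies in \<open>Y\<close>. From some \<open>N\<close> on they are inside
    \<open>V1\<close>, where \<open>gF\<close> is available.\<close>
  define Z where "Z n = {x \<in> K. (F ^^ n) x \<notin> T}" for n
  have FT: "(F ^^ n) x \<in> T" if "x \<in> T" for n x by (induction n) (use that T(3) in auto)
  have Zdec: "decseq Z"
    by (rule decseq_SucI) (use T(3) in \<open>auto simp: Z_def\<close>)
  have Zcl: "closedin Q (Z n)" for n
  proof -
    have "Z n = K - {x \<in> ?Q. (F ^^ n) x \<in> T}" using KQ by (auto simp: Z_def)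
    then show ?thesis using Kcl opre[OF T(1)] by (simp add: closedin_diff)
  qed
  have "(\<Inter>n. Z n) \<subseteq> V1"
  proof
    fix x assume x: "x \<in> (\<Inter>n. Z n)"
    have "x \<notin> B" using x BkT unfolding B_def Z_def by blast
    moreover have "x \<in> K" using x by (auto simp: Z_def)
    ultimately show "x \<in> V1" using KB YV1 by blast
  qed
  then obtain N where N: "Z N \<subseteq> V1"
    using nested_closed_subset_open[OF cpt Zcl Zdec V1] by blast
  have V1V: "V1 \<subseteq> V" by (auto simp: V1_def V'_def)
  \<comment> \<open>If \<open>p\<close> is in \<open>Z N\<close> and \<open>F p\<close> is not, then
    \<open>N + 1\<close> steps lead from \<open>p\<close> into \<open>T\<close> and
    \<open>n0\<close> more to \<open>pt\<close>. The set of these exit points need not be closed;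
    \<open>C\<close> is a compact set that contains it.\<close>
  define C where "C = Z N \<inter> Bk (N + 1 + n0)"
  have BkB: "Bk k \<subseteq> B" for k by (auto simp: B_def)
  have Bkcl: "closedin Q (Bk k)" for k
  proof -
    have "closedin Q {x \<in> ?Q. (F ^^ k) x \<in> {pt}}"
      by (rule closedin_continuous_map_preimage[OF funpow_continuous_map[OF F]])
        (use pt haus in \<open>simp add: Hausdorff_imp_t1_space closedin_t1_singleton\<close>)
    then show ?thesis by (simp add: Bk_def)
  qed
  have Ccpt: "compactin Q C" unfolding C_def
    using closedin_compact_space[OF cpt] Zcl Bkcl by blast
  have CV: "x \<in> V \<and> x \<in> B" if "x \<in> C" for x using that N V1V BkB unfolding C_def by blast
  define \<Gamma> where "\<Gamma> = g ` C"
  have \<Gamma>: "finite \<Gamma>" unfolding \<Gamma>_def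
  proof (rule finite_image_locally_constant[OF Ccpt])
    fix x assume "x \<in> C"
    then obtain w where w: "openin Q w" "x \<in> w" "\<forall>y\<in>w. g y = g x"
      using g_lc CV by metis
    then show "\<exists>w. openin Q w \<and> x \<in> w \<and> (\<forall>y\<in>w \<inter> C. g y = g x)" by (metis IntD1)
  qed
  \<comment> \<open>The orbit of \<open>p\<close> stays in \<open>Z N\<close> for \<open>k\<close>
    steps, with \<open>k\<close> at least \<open>m\<close>, and is in \<open>C\<close> just before
    it leaves. Up to there it runs in \<open>V1\<close>, so each step multiplies \<open>g\<close> by
    \<open>\<mu>\<close>.\<close>
  have exit: "\<exists>k\<ge>m. \<mu> ^ k * g p \<in> \<Gamma>" if p: "p \<in> Z (N + m)" "p \<in> B" for p m
  proof -
    have pZ: "p \<in> Z N" using p(1) decseqD[OF Zdec, of N "N + m"] by auto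
    have pK: "p \<in> K" using pZ by (auto simp: Z_def)
    have ex: "\<exists>k. (F ^^ Suc k) p \<notin> Z N"
    proof -
      obtain j where "p \<in> Bk j" using p(2) by (auto simp: B_def)
      then have "(F ^^ Suc j) p = pt" using pt by (simp add: Bk_def)
      then show ?thesis using Fnpt T(2) by (metis (mono_tags, lifting) Z_def mem_Collect_eq)
    qed
    define k where "k = (LEAST k. (F ^^ Suc k) p \<notin> Z N)"
    have k1: "(F ^^ Suc k) p \<notin> Z N" unfolding k_def using ex by (rule LeastI_ex)
    have k2: "(F ^^ i) p \<in> Z N" if "i \<le> k" for i
    proof (cases i)
      case 0
      then show ?thesis using pZ by simp
    next
      case (Suc i')
      then have "i' < k" using that by simp
      then show ?thesis using not_less_Least[of i' "\<lambda>k. (F ^^ Suc k) p \<notin> Z N"] Suc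
        unfolding k_def by blast
    qed
    have "m \<le> k"
    proof (rule ccontr)
      assume "\<not> m \<le> k"
      then have "p \<in> Z (N + Suc k)" using p(1) decseqD[OF Zdec, of "N + Suc k" "N + m"] by auto
      then have "(F ^^ (N + Suc k)) p \<notin> T" unfolding Z_def by blast
      then have "(F ^^ N) ((F ^^ Suc k) p) \<notin> T" unfolding funpow_add o_apply .
      then have "(F ^^ Suc k) p \<in> Z N" using FnK[OF pK, of "Suc k"] by (simp add: Z_def)
      then show False using k1 by blast
    qed
    have gi: "g ((F ^^ i) p) = \<mu> ^ i * g p" if "i \<le> k" for i
      using that
    proof (induction i)
      case (Suc i)
      have "g (F ((F ^^ i) p)) = \<mu> * g ((F ^^ i) p)"
        by (rule gF) (use Suc.prems k2[of i] N FnB[OF p(2)] in auto)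
      then show ?case using Suc by simp
    qed simp
    have "(F ^^ k) p \<in> C"
    proof -
      have "(F ^^ N) ((F ^^ Suc k) p) \<in> T" using k1 FnK[OF pK, of "Suc k"] by (simp add: Z_def)
      then have "(F ^^ (N + 1)) ((F ^^ k) p) \<in> T" by (simp add: funpow_swap1)
      then have "(F ^^ k) p \<in> Bk (N + 1 + n0)" using preT[of "N + 1"] FnQ pK KQ by blast
      then show ?thesis using k2[of k] by (simp add: C_def)
    qed
    then have "\<mu> ^ k * g p \<in> \<Gamma>" unfolding \<Gamma>_def using gi[of k] by (metis image_eqI order_refl)
    then show ?thesis using \<open>m \<le> k\<close> by blast
  qed
  text \<open>Since \<open>\<mu>\<close> is not a root of unity, values of \<open>g\<close> that occur close to \<open>Y\<close>, namely those of the form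
    \<open>\<mu>\<^sup>-\<^sup>k \<gamma>\<close> with \<open>k \<ge> m\<close>, do not occur on the fundamental domain \<open>C\<close>. Hence \<open>g\<close> can be cut off there.\<close>
  have "finite {k. \<exists>z\<in>\<Gamma>. z \<noteq> 0 \<and> \<mu> ^ k * z \<in> \<Gamma>}"
  proof -
    have "finite {k. z \<noteq> 0 \<and> \<mu> ^ k * z = z'}" for z z' :: complex
    proof (cases "\<exists>k. z \<noteq> 0 \<and> \<mu> ^ k * z = z'")
      case True
      then obtain k where k: "z \<noteq> 0" "\<mu> ^ k * z = z'" by blast
      have "l = k" if l: "\<mu> ^ l * z = z'" for l
      proof (rule ccontr)
        have eq: "\<mu> ^ l = \<mu> ^ k" using l k by (metis mult_right_cancel)
        have *: "\<mu> ^ i \<noteq> \<mu> ^ j" if "i < j" for i j :: nat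
        proof
          assume "\<mu> ^ i = \<mu> ^ j"
          moreover have "\<mu> ^ j = \<mu> ^ i * \<mu> ^ (j - i)" using that by (simp add: power_add[symmetric])
          ultimately have "\<mu> ^ (j - i) = 1" using \<mu>(1) by simp
          then show False using \<mu>(2) that by auto
        qed
        assume "l \<noteq> k"
        then show False using *[of l k] *[of k l] eq by (metis linorder_neqE_nat)
      qed
      then have "{k. z \<noteq> 0 \<and> \<mu> ^ k * z = z'} \<subseteq> {k}" by blast
      then show ?thesis using finite_subset by blast
    next
      case False
      then have "{k. z \<noteq> 0 \<and> \<mu> ^ k * z = z'} = {}" by blast
      then show ?thesis by (simp only: finite.emptyI)
    qed
    then have "finite (\<Union>z\<in>\<Gamma>. \<Union>z'\<in>\<Gamma>. {k. z \<noteq> 0 \<and> \<mu> ^ k * z = z'})" using \<Gamma> by blast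
    then show ?thesis by (rule rev_finite_subset) blast
  qed
  then obtain m where m: "\<And>k z. z \<in> \<Gamma> \<Longrightarrow> z \<noteq> 0 \<Longrightarrow> \<mu> ^ k * z \<in> \<Gamma> \<Longrightarrow> k < m"
    unfolding finite_nat_set_iff_bounded by blast
  define good where "good z \<longleftrightarrow> z \<noteq> 0 \<and> (\<exists>k\<ge>m. \<mu> ^ k * z \<in> \<Gamma>)" for z
  have not_good: "\<not> good z" if "z \<in> \<Gamma>" for z
    using m[OF that] unfolding good_def by (meson linorder_not_le)
  \<comment> \<open>Within the core, \<open>cut\<close> equals \<open>g\<close> near
    \<open>Y\<close>, because there \<open>g\<close> is 0 or \<open>good\<close> by
    \<open>exit\<close>; it is 0 on \<open>C\<close> and off \<open>Z N\<close>. On \<open>Y\<close>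
    itself \<open>\<beta>\<close> and \<open>g\<close> carry no information, so
    \<open>\<Phi>\<close> uses \<open>t\<close>.\<close>
  define cut where "cut x = (if x \<in> Z N \<and> good (g x) then g x else 0)" for x
  define \<Phi> where "\<Phi> x u = (if x \<in> Y then t x u else \<beta> x u + cut x)" for x u
  have ZNB: "x \<in> V" "x \<in> B" if "x \<in> Z N" "x \<notin> Y" for x
    using that N V1V KB by (auto simp: Z_def)
  \<comment> \<open>Off \<open>Y\<close>, \<open>cut\<close> could jump only at the boundary of
    \<open>Z N\<close> in the core. Boundary points lie in \<open>C\<close>, where the value of
    \<open>g\<close> is not \<open>good\<close>, so \<open>cut\<close> is 0 on both sides.\<close>
  have cut_lc: "\<exists>w. openin Q w \<and> x \<in> w \<and> w \<inter> Y = {} \<and> (\<forall>y\<in>w \<inter> K. cut y = cut x)"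
    if x: "x \<in> K" "x \<notin> Y" for x
  proof (cases "x \<in> Z N")
    case False
    then have "x \<in> {y \<in> ?Q. (F ^^ N) y \<in> T} - Y" using x KQ by (auto simp: Z_def)
    moreover have "openin Q ({y \<in> ?Q. (F ^^ N) y \<in> T} - Y)" using opre[OF T(1)] Ycl by blast
    moreover have "cut y = cut x" if "y \<in> ({y \<in> ?Q. (F ^^ N) y \<in> T} - Y) \<inter> K" for y
      using that False by (auto simp: cut_def Z_def)
    ultimately show ?thesis by (intro exI[of _ "{y \<in> ?Q. (F ^^ N) y \<in> T} - Y"]) auto
  next
    case True
    note xVB = ZNB[OF True x(2)]
    obtain w where w: "openin Q w" "x \<in> w" "w \<subseteq> V \<inter> B" "\<forall>y\<in>w. g y = g x"
      using g_lc[OF xVB] by (elim exE conjE) (rule that)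
    show ?thesis
    proof (cases "x \<in> C")
      case True
      then have ng: "\<not> good (g x)" by (intro not_good) (simp add: \<Gamma>_def)
      show ?thesis
      proof (intro exI conjI ballI)
        show "openin Q w" "x \<in> w" using w by auto
        show "w \<inter> Y = {}" using w(3) YB by blast
        fix y assume "y \<in> w \<inter> K"
        then have "g y = g x" by (intro bspec[OF w(4)]) blast
        then show "cut y = cut x" using ng by (simp add: cut_def)
      qed
    next
      case False
      \<comment> \<open>By \<open>preT\<close>, points of the core outside the closed set
        \<open>Bk (N + n0)\<close> lie in \<open>Z N\<close>. So \<open>x\<close> has a
        neighbourhood in the core that stays inside \<open>Z N\<close>.\<close>
      then have xn: "x \<notin> Bk (N + n0)" using True BkMono[of "N + n0" 1] by (auto simp: C_def)
      show ?thesis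
      proof (intro exI conjI ballI)
        show "openin Q (w - Bk (N + n0))" using w(1) Bkcl by blast
        show "x \<in> w - Bk (N + n0)" using w(2) xn by blast
        show "(w - Bk (N + n0)) \<inter> Y = {}" using w(3) YB by blast
        fix y assume y: "y \<in> (w - Bk (N + n0)) \<inter> K"
        then have "g y = g x" by (intro bspec[OF w(4)]) blast
        moreover have "y \<in> Z N" using y preT[of N] KQ by (auto simp: Z_def)
        ultimately show "cut y = cut x" using True by (simp add: cut_def)
      qed
    qed
  qed
  have \<Phi>: "cech_section Q K U c \<Phi>"
  proof (rule cech_sectionI)
    fix x u v assume a: "x \<in> K" "u \<in> U" "v \<in> U" "x \<in> u" "x \<in> v"
    show "\<Phi> x v = \<Phi> x u + c [u, v]"
    proof (cases "x \<in> Y")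
      case True
      then show ?thesis using cech_section_change[OF t _ a(2-5)] V(2) by (auto simp: \<Phi>_def)
    next
      case False
      then show ?thesis using cech_section_change[OF \<beta>B _ a(2-5)] KB[OF a(1)] by (auto simp: \<Phi>_def)
    qed
  next
    fix x u assume a: "x \<in> K" "u \<in> U" "x \<in> u"
    show "\<exists>w. openin Q w \<and> x \<in> w \<and> (\<forall>y\<in>w \<inter> K. y \<in> u \<longrightarrow> \<Phi> y u = \<Phi> x u)"
    proof (cases "x \<in> Y")
      case True
      then have xV: "x \<in> V" using V(2) by blast
      obtain w where w: "openin Q w" "x \<in> w" "\<forall>y\<in>w \<inter> V. y \<in> u \<longrightarrow> t y u = t x u"
        using cech_section_locally_const[OF t xV a(2,3)] by (elim exE conjE) (rule that)
      show ?thesis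
      proof (intro exI conjI ballI impI)
        \<comment> \<open>What remains in the core after removing \<open>Bk (N + m + n0)\<close>
          lies in \<open>Z (N + m)\<close>. There \<open>exit\<close> gives \<open>cut = g\<close>
          off \<open>Y\<close>, and hence \<open>\<Phi> = t\<close>.\<close>
        show "openin Q (w \<inter> V - Bk (N + m + n0))" using w(1) V(1) Bkcl by blast
        show "x \<in> w \<inter> V - Bk (N + m + n0)" using w(2) xV True YB BkB by blast
        fix y assume y: "y \<in> (w \<inter> V - Bk (N + m + n0)) \<inter> K" "y \<in> u"
        have ty: "t y u = t x u" by (rule w(3)[rule_format]) (use y in auto)
        show "\<Phi> y u = \<Phi> x u"
        proof (cases "y \<in> Y")
          case True
          then show ?thesis using ty \<open>x \<in> Y\<close> by (simp add: \<Phi>_def)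
        next
          case False
          have yZ: "y \<in> Z (N + m)" using y preT[of "N + m"] KQ by (auto simp: Z_def)
          then have yN: "y \<in> Z N" using decseqD[OF Zdec, of N "N + m"] by auto
          note yVB = ZNB[OF yN False]
          have "g y = 0 \<or> good (g y)" using exit[OF yZ yVB(2)] by (auto simp: good_def)
          then have "cut y = g y" using yN by (auto simp: cut_def)
          then have "\<Phi> y u = \<beta> y u + g y" using False by (simp add: \<Phi>_def)
          also have "\<dots> = t y u" using g[OF yVB a(2) y(2)] by (simp add: algebra_simps)
          finally show ?thesis using ty \<open>x \<in> Y\<close> by (simp add: \<Phi>_def)
        qed
      qed
    next
      case False
      obtain w where w: "openin Q w" "x \<in> w" "w \<inter> Y = {}" "\<forall>y\<in>w \<inter> K. cut y = cut x"
        using cut_lc[OF a(1) False] by (elim exE conjE) (rule that)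
      have xB: "x \<in> B" using KB a(1) False by blast
      obtain w' where w': "openin Q w'" "x \<in> w'" "\<forall>y\<in>w' \<inter> B. y \<in> u \<longrightarrow> \<beta> y u = \<beta> x u"
        using cech_section_locally_const[OF \<beta>B xB a(2,3)] by (elim exE conjE) (rule that)
      show ?thesis
      proof (intro exI conjI ballI impI)
        show "openin Q (w \<inter> w')" using w w' by blast
        show "x \<in> w \<inter> w'" using w w' by blast
        fix y assume y: "y \<in> w \<inter> w' \<inter> K" "y \<in> u"
        then have yY: "y \<notin> Y" and yB: "y \<in> B" using w(3) KB by blast+
        have "cut y = cut x" by (rule bspec[OF w(4)]) (use y in blast)
        moreover have "\<beta> y u = \<beta> x u" by (rule w'(3)[rule_format]) (use y yB in auto)
        ultimately show "\<Phi> y u = \<Phi> x u" using False yY by (simp add: \<Phi>_def)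
      qed
    qed
  qed
  have \<Phi>pt: "\<Phi> pt u = 0" if "u \<in> U" "pt \<in> u" for u
  proof -
    have "pt \<in> Bk 0" using pt by (simp add: Bk_def)
    then have "\<beta> pt u = 0" using \<beta>[of pt 0 u] that by (simp add: b_def)
    moreover have "pt \<notin> Z N" using Fnpt T(2) by (simp add: Z_def)
    ultimately show ?thesis using Y(3) by (simp add: \<Phi>_def cut_def)
  qed

  \<comment> \<open>A neighbourhood of the core absorbs the whole space after \<open>j\<close>
    steps, so \<open>j\<close> pull-backs make the extended section global. They keep the value 0 at
    \<open>pt\<close> because \<open>h\<close> vanishes there.\<close>
  obtain W r where W: "openin Q W" "K \<subseteq> W" and r: "cech_section Q W U c r"
    and r\<Phi>: "\<And>x u. x \<in> K \<Longrightarrow> u \<in> U \<Longrightarrow> x \<in> u \<Longrightarrow> r x u = \<Phi> x u"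
    by (rule cech_section_extend[OF reg closedin_compact_space[OF cpt Kcl] c \<Phi>]) (rule that)
  obtain j where j: "(F ^^ j) ` ?Q \<subseteq> W"
    using core_absorbing[OF cpt haus F W(1)] W(2) unfolding K_def by blast
  have R: "cech_section Q {x \<in> ?Q. (F ^^ n) x \<in> W} U c ((pull ^^ n) r) \<and>
      (\<forall>u\<in>U. pt \<in> u \<longrightarrow> (pull ^^ n) r pt u = 0)" for n
  proof (induction n)
    case 0
    have "{x \<in> ?Q. (F ^^ 0) x \<in> W} = W" using openin_subset[OF W(1)] by auto
    then show ?case using r r\<Phi>[OF ptK] \<Phi>pt by simp
  next
    case (Suc n)
    have eq: "{x \<in> ?Q. (F ^^ Suc n) x \<in> W} = {x \<in> ?Q. F x \<in> {x \<in> ?Q. (F ^^ n) x \<in> W}}"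
      using FQ by (auto simp: funpow_swap1)
    have "(pull ^^ Suc n) r pt u = 0" if u: "u \<in> U" "pt \<in> u" for u
    proof -
      have "\<mu> * pull ((pull ^^ n) r) pt u = (pull ^^ n) r (F pt) u - h pt u u"
        by (rule pull_eq[OF Suc[THEN conjunct1]]) (use u pt Fnpt ptK W(2) in auto)
      moreover have "h pt u u = 0" by (rule cech_link_zero[OF h]) (use u pt in auto)
      moreover have "(pull ^^ n) r (F pt) u = 0" using Suc u pt by simp
      ultimately show ?thesis using \<mu>(1) by simp
    qed
    then show ?case unfolding eq using pull_section[OF Suc[THEN conjunct1]] by simp
  qed
  have "{x \<in> ?Q. (F ^^ j) x \<in> W} = ?Q" using j by blast
  then show ?thesis using R[of j] by auto
qed

section \<open>The index map\<close>

text \<open>Otherwise the points whose forward orbit stays in \<open>H\<close> form, by nesting, a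
  nonempty compact set that \<open>f\<close> maps into itself. Its core is nonempty and consists of
  points with full orbits in \<open>H\<close>, contrary to \<open>inv\<close>.\<close>

lemma bounded_orbit_segments:
  assumes haus: "Hausdorff_space M" and H: "compactin M H"
    and f: "continuous_map (subtopology M H) M f" and inv: "Inv f H = {}"
  obtains n where "\<And>p. \<not> (\<forall>i\<le>n. (f ^^ i) p \<in> H)"
proof (rule ccontr)
  assume no: "\<not> thesis"
  let ?H = "subtopology M H"
  have HM: "H \<subseteq> topspace M" using H by (rule compactin_subset_topspace)
  define S where "S n = {p. \<forall>i\<le>n. (f ^^ i) p \<in> H}" for n
  have SSuc: "S (Suc n) = {p \<in> H. f p \<in> S n}" for n
  proof (intro Set.set_eqI iffI)
    fix p assume "p \<in> S (Suc n)"
    then have a: "(f ^^ i) p \<in> H" if "i \<le> Suc n" for i using that by (simp add: S_def)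
    have "(f ^^ i) (f p) \<in> H" if "i \<le> n" for i using a[of "Suc i"] that by (simp add: funpow_swap1)
    then show "p \<in> {p \<in> H. f p \<in> S n}" using a[of 0] by (simp add: S_def)
  next
    fix p assume p: "p \<in> {p \<in> H. f p \<in> S n}"
    have "(f ^^ i) p \<in> H" if "i \<le> Suc n" for i
      using that p by (cases i) (auto simp: S_def funpow_swap1)
    then show "p \<in> S (Suc n)" by (simp add: S_def)
  qed
  have cpt: "compact_space ?H" using H by (simp add: compact_space_subtopology)
  have hausH: "Hausdorff_space ?H" using haus by (rule Hausdorff_space_subtopology)
  have cl: "closedin ?H (S n)" for n
  proof (induction n)
    case 0
    have "S 0 = topspace ?H" using HM by (auto simp: S_def)
    then show ?case by (metis closedin_topspace)
  next
    case (Suc n)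
    have "compactin M (S n)"
      using closedin_compact_space[OF cpt Suc] by (simp add: compactin_subtopology)
    then have "closedin M (S n)" by (rule compactin_imp_closedin[OF haus])
    then have "closedin ?H {p \<in> topspace ?H. f p \<in> S n}" by (rule closedin_continuous_map_preimage[OF f])
    moreover have "{p \<in> topspace ?H. f p \<in> S n} = S (Suc n)" using HM unfolding SSuc by auto
    ultimately show ?case by simp
  qed
  have ne: "S n \<noteq> {}" for n using that no unfolding S_def by blast
  have dec: "decseq S" by (auto simp: decseq_def S_def)
  define I where "I = (\<Inter>n. S n)"
  have Ine: "I \<noteq> {}" unfolding I_def by (rule compact_space_imp_nest[OF cpt cl ne dec])
  have IH: "I \<subseteq> H"
  proof
    fix p assume "p \<in> I"
    then have "p \<in> S 0" unfolding I_def by blast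
    then show "p \<in> H" by (simp add: S_def)
  qed
  have fI: "f p \<in> I" if "p \<in> I" for p
    using that SSuc unfolding I_def by blast
  have "closedin ?H I" unfolding I_def using cl by blast
  then have Icpt: "compactin M I"
    using closedin_compact_space[OF cpt] by (simp add: compactin_subtopology)
  let ?I = "subtopology M I"
  have 1: "compact_space ?I" using Icpt by (simp add: compact_space_subtopology)
  have 2: "Hausdorff_space ?I" using haus by (rule Hausdorff_space_subtopology)
  have tI: "topspace ?I = I" using IH HM by auto
  have 3: "continuous_map ?I ?I f"
    using continuous_map_from_subtopology_mono[OF f IH] fI tI
    by (auto simp: continuous_map_in_subtopology)
  obtain p where p: "p \<in> core ?I f" using core_nonempty[OF 1 2 3] Ine tI by blast
  obtain x :: "int \<Rightarrow> _" where x: "range x \<subseteq> core ?I f" "x 0 = p" "\<And>i. f (x i) = x (i + 1)"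
    by (rule full_orbit_exists[OF image_core[OF 1 2 3] p]) (rule that)
  have "core ?I f \<subseteq> I" using closedin_subset[OF closedin_core[OF 1 2 3]] tI by simp
  then have "p \<in> Inv f H" unfolding Inv_def using x p IH by blast
  then show False using inv by blast
qed

lemma finite_connected_components_of_image:
  assumes "finite (connected_components_of T)" "continuous_map T T' F" "F ` topspace T = topspace T'"
  shows "finite (connected_components_of T')"
proof (rule finite_subset)
  show "finite ((\<lambda>C. Collect (connected_component_of T' (F (SOME x. x \<in> C)))) ` connected_components_of T)"
    using assms(1) by simp
  show "connected_components_of T' \<subseteq> (\<lambda>C. Collect (connected_component_of T' (F (SOME x. x \<in> C)))) ` connected_components_of T"
  proof
    fix C' assume "C' \<in> connected_components_of T'"
    then obtain y where y: "y \<in> topspace T'" "C' = Collect (connected_component_of T' y)"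
      by (auto simp: connected_components_of_def)
    then obtain x where x: "x \<in> topspace T" "y = F x" using assms(3) by (metis imageE)
    let ?C = "Collect (connected_component_of T x)"
    have "x \<in> ?C" using x(1) by (simp add: connected_component_of_refl)
    then have "(SOME x. x \<in> ?C) \<in> ?C" by (rule someI)
    then have "connected_component_of T x (SOME x. x \<in> ?C)" by simp
    then have "connected_component_of T' y (F (SOME x. x \<in> ?C))"
      unfolding x(2) by (rule connected_component_of_image[OF assms(2)])
    from iffD1[OF connected_component_of_equiv this]
    have "C' = Collect (connected_component_of T' (F (SOME x. x \<in> ?C)))"
      unfolding y(2) by (elim conjE) (erule arg_cong)
    moreover have "?C \<in> connected_components_of T"
      using x(1) by (auto simp: connected_components_of_def)
    ultimately show "C' \<in> (\<lambda>C. Collect (connected_component_of T' (F (SOME x. x \<in> C)))) ` connected_components_of T"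
      by (rule image_eqI)
  qed
qed

section \<open>The pointed quotient and its dynamics\<close>

locale index_pair_context =
  fixes M :: "'a topology" and D X N L :: "'a set" and f :: "'a \<Rightarrow> 'a"
  assumes haus: "Hausdorff_space M" and f: "continuous_map (subtopology M D) M f"
    and inv: "isolated_invariant_set M D f X" and ip: "index_pair M D f X N L"
begin

abbreviation "Q \<equiv> pointed_quotient M N L"
abbreviation "F \<equiv> index_map f N L"

lemma
  shows N_compact: "compactin M N" and L_compact: "compactin M L" and LN: "L \<subseteq> N" and ND: "N \<subseteq> D"
    and XL: "X \<inter> L = {}" and fN: "\<And>p. p \<in> N \<Longrightarrow> p \<notin> L \<Longrightarrow> f p \<in> N"
    and fL: "\<And>p. p \<in> L \<Longrightarrow> f p \<in> N \<Longrightarrow> f p \<in> L"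
    and X_Inv: "X = Inv f (M closure_of (N - L))"
    and A_compact: "compactin M (M closure_of (N - L))"
  using ip unfolding index_pair_def isolating_neighbourhood_def by auto

lemma X_compact: "compactin M X" and fX: "f ` X = X"
  using inv unfolding isolated_invariant_set_def by auto

lemma NM: "N \<subseteq> topspace M" using N_compact by (rule compactin_subset_topspace)

lemma N_closed: "closedin M N" using compactin_imp_closedin[OF haus N_compact] .

lemma L_closed: "closedin M L" using compactin_imp_closedin[OF haus L_compact] .

lemma A_N: "M closure_of (N - L) \<subseteq> N"
  by (rule closure_of_minimal[OF _ N_closed]) blast

lemma NL_A: "N - L \<subseteq> M closure_of (N - L)"
  by (rule closure_of_subset) (use NM in blast)

lemma XNL: "X \<subseteq> N - L"
proof -
  have "X \<subseteq> M closure_of (N - L)" using X_Inv by (auto simp: Inv_def)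
  then show ?thesis using A_N XL by blast
qed

lemma topspace_Q: "topspace Q = insert None (Some ` (N - L))"
  using topspace_pointed_quotient[OF NM] .

lemma f_N: "continuous_map (subtopology M N) M f"
  by (rule continuous_map_from_subtopology_mono[OF f ND])

lemma topspace_N: "topspace (subtopology M N) = N" using NM by auto

lemma openin_Some:
  assumes "openin M W"
  shows "openin Q (Some ` (W \<inter> (N - L)))"
  unfolding openin_pointed_quotient topspace_N
proof
  have "{p \<in> N. collapse L p \<in> Some ` (W \<inter> (N - L))} = (W - L) \<inter> N"
    by (auto simp: collapse_def)
  moreover have "openin M (W - L)" using assms L_closed by blast
  ultimately show "openin (subtopology M N) {p \<in> N. collapse L p \<in> Some ` (W \<inter> (N - L))}"
    by (simp add: openin_subtopology_Int)
qed blast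

lemma openin_None:
  assumes "openin M W" "L \<subseteq> W"
  shows "openin Q (insert None (Some ` (W \<inter> (N - L))))"
  unfolding openin_pointed_quotient topspace_N
proof
  have "{p \<in> N. collapse L p \<in> insert None (Some ` (W \<inter> (N - L)))} = W \<inter> N"
    using assms(2) by (auto simp: collapse_def)
  then show "openin (subtopology M N) {p \<in> N. collapse L p \<in> insert None (Some ` (W \<inter> (N - L)))}"
    using assms(1) by (simp add: openin_subtopology_Int)
qed blast

lemma openin_QD:
  assumes "openin Q W"
  obtains O' where "openin M O'" "{p \<in> N. collapse L p \<in> W} = O' \<inter> N"
proof -
  have "openin (subtopology M N) {p \<in> N. collapse L p \<in> W}"
    using assms unfolding openin_pointed_quotient topspace_N by blast
  then obtain T where "openin M T" "{p \<in> N. collapse L p \<in> W} = T \<inter> N"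
    unfolding openin_subtopology by blast
  then show ?thesis by (rule that)
qed

lemma continuous_collapse: "continuous_map (subtopology M N) Q (collapse L)"
  unfolding continuous_map_def
proof (intro conjI allI impI)
  show "collapse L \<in> topspace (subtopology M N) \<rightarrow> topspace Q"
    unfolding topspace_N topspace_Q by (auto simp: collapse_def)
  fix W assume "openin Q W"
  then show "openin (subtopology M N) {p \<in> topspace (subtopology M N). collapse L p \<in> W}"
    unfolding openin_pointed_quotient by blast
qed

lemma compact_Q: "compact_space Q"
proof -
  have "compactin Q (collapse L ` N)"
    by (rule image_compactin[OF _ continuous_collapse]) (simp add: compactin_subtopology N_compact)
  \<comment> \<open>For \<open>L = {}\<close> the base point is not in the image of
    \<open>N\<close>.\<close>
  moreover have "compactin Q {None}" by (simp add: topspace_Q)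
  ultimately have "compactin Q (collapse L ` N \<union> {None})" by (rule compactin_Un)
  moreover have "collapse L ` N \<union> {None} = topspace Q"
    unfolding topspace_Q by (auto simp: collapse_def)
  ultimately show ?thesis by (simp add: compact_space_def)
qed

lemma Hausdorff_Q: "Hausdorff_space Q"
proof -
  have 1: "\<exists>U V. openin Q U \<and> openin Q V \<and> Some p \<in> U \<and> None \<in> V \<and> disjnt U V" if p: "p \<in> N - L" for p
  proof -
    have pM: "p \<in> topspace M" using p NM by blast
    have "compactin M {p}" using pM by simp
    moreover have "disjnt {p} L" using p by simp
    ultimately obtain U V where UV: "openin M U" "openin M V" "{p} \<subseteq> U" "L \<subseteq> V" "disjnt U V"
      using haus L_compact unfolding Hausdorff_space_compact_sets by metis
    show ?thesis
      using openin_Some[OF UV(1)] openin_None[OF UV(2,4)] UV(3,5) p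
      by (intro exI[of _ "Some ` (U \<inter> (N - L))"] exI[of _ "insert None (Some ` (V \<inter> (N - L)))"])
        (auto simp: disjnt_iff)
  qed
  have 2: "\<exists>U V. openin Q U \<and> openin Q V \<and> Some p \<in> U \<and> Some q \<in> V \<and> disjnt U V"
    if p: "p \<in> N - L" "q \<in> N - L" "p \<noteq> q" for p q
  proof -
    obtain U V where UV: "openin M U" "openin M V" "p \<in> U" "q \<in> V" "disjnt U V"
      using haus[unfolded Hausdorff_space_def, rule_format, of p q] p NM by (metis DiffD1 subsetD)
    show ?thesis
      using openin_Some[OF UV(1)] openin_Some[OF UV(2)] UV(3-5) p
      by (intro exI[of _ "Some ` (U \<inter> (N - L))"] exI[of _ "Some ` (V \<inter> (N - L))"])
        (auto simp: disjnt_iff)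
  qed
  show ?thesis
    unfolding Hausdorff_space_def
  proof (intro allI impI, elim conjE)
    fix a b assume a: "a \<in> topspace Q" "b \<in> topspace Q" "a \<noteq> b"
    consider p q where "a = Some p" "b = Some q" "p \<in> N - L" "q \<in> N - L"
      | p where "a = Some p" "b = None" "p \<in> N - L"
      | q where "a = None" "b = Some q" "q \<in> N - L"
      using a unfolding topspace_Q by blast
    then show "\<exists>U V. openin Q U \<and> openin Q V \<and> a \<in> U \<and> b \<in> V \<and> disjnt U V"
    proof cases
      case 1
      then show ?thesis using 2 a(3) by blast
    next
      case 2
      then show ?thesis using 1 by blast
    next
      case 3
      then show ?thesis using 1[OF 3(3)] disjnt_sym by blast
    qed
  qed
qed

lemma F_None: "F None = None" by (simp add: index_map_def)

lemma F_Some: "p \<in> N \<Longrightarrow> p \<notin> L \<Longrightarrow> F (Some p) = collapse L (f p)"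
  using fN by (auto simp: index_map_def collapse_def)

lemma F_Some_eqD: "F (Some p) = Some q \<Longrightarrow> q = f p"
  by (auto simp: index_map_def split: if_splits)

lemma F_SomeX: "p \<in> X \<Longrightarrow> F (Some p) = Some (f p)"
  using XNL fX by (auto simp: index_map_def)

text \<open>Let \<open>O'\<close> be an open set that describes \<open>W\<close> on
  \<open>N\<close>. If the base point is not in \<open>W\<close>, the preimage is the set where
  \<open>f p\<close> is in \<open>O'\<close>, minus the closed set \<open>L\<close>. If it is in
  \<open>W\<close>, the preimage is the complement of the closed set where \<open>f p\<close> is in
  \<open>N - O'\<close>; it contains \<open>L\<close>, as \<open>f\<close> maps a point of
  \<open>L\<close> into \<open>L\<close> or out of \<open>N\<close>.\<close>

lemma continuous_F: "continuous_map Q Q F"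
  unfolding continuous_map_def
proof (intro conjI allI impI)
  show "F \<in> topspace Q \<rightarrow> topspace Q"
  proof
    have col: "collapse L q \<in> topspace Q" if "q \<in> N" for q
      using that by (simp add: collapse_def topspace_Q)
    fix z assume z: "z \<in> topspace Q"
    show "F z \<in> topspace Q"
    proof (cases z)
      case None
      then show ?thesis by (simp add: F_None topspace_Q)
    next
      case (Some p)
      then have p: "p \<in> N" "p \<notin> L" using z by (auto simp: topspace_Q)
      show ?thesis unfolding Some F_Some[OF p] by (rule col[OF fN[OF p]])
    qed
  qed
  fix W assume W: "openin Q W"
  obtain O' where O: "openin M O'" "{p \<in> N. collapse L p \<in> W} = O' \<inter> N"
    by (rule openin_QD[OF W]) (rule that)
  have FW: "F (Some p) \<in> W \<longleftrightarrow> f p \<in> O'" if "p \<in> N" "p \<notin> L" for p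
    using O(2) fN[OF that] unfolding F_Some[OF that] by blast
  let ?P = "{p \<in> N. collapse L p \<in> {z \<in> topspace Q. F z \<in> W}}"
  have "openin (subtopology M N) ?P"
  proof (cases "None \<in> W")
    case True
    have LO: "L \<subseteq> O'"
    proof
      fix p assume "p \<in> L"
      then have "p \<in> {p \<in> N. collapse L p \<in> W}" using True LN by (auto simp: collapse_def)
      then show "p \<in> O'" using O(2) by blast
    qed
    have "closedin M (N - O')" using N_closed O(1) by blast
    then have "closedin (subtopology M N) {p \<in> topspace (subtopology M N). f p \<in> N - O'}"
      by (rule closedin_continuous_map_preimage[OF f_N])
    moreover have "?P = topspace (subtopology M N) - {p \<in> topspace (subtopology M N). f p \<in> N - O'}"
    proof (intro Set.set_eqI)
      fix p
      show "p \<in> ?P \<longleftrightarrow> p \<in> topspace (subtopology M N) - {p \<in> topspace (subtopology M N). f p \<in> N - O'}"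
      proof (cases "p \<in> L")
        case True
        then show ?thesis using \<open>None \<in> W\<close> F_None fL LO LN unfolding topspace_N
          by (auto simp: collapse_def topspace_Q)
      next
        case False
        then show ?thesis using FW fN unfolding topspace_N
          by (auto simp: collapse_def topspace_Q)
      qed
    qed
    ultimately show ?thesis by (metis (no_types, lifting) openin_diff openin_topspace)
  next
    case False
    have "openin (subtopology M N) {p \<in> topspace (subtopology M N). f p \<in> O'}"
      using f_N O(1) by (simp add: continuous_map_def)
    moreover have "closedin (subtopology M N) L"
      using L_closed LN by (simp add: closedin_subset_topspace)
    ultimately have "openin (subtopology M N) ({p \<in> topspace (subtopology M N). f p \<in> O'} - L)"
      by (rule openin_diff)
    moreover have "?P = {p \<in> topspace (subtopology M N). f p \<in> O'} - L"
      using FW F_None False unfolding topspace_N by (auto simp: collapse_def topspace_Q)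
    ultimately show ?thesis by simp
  qed
  then show "openin Q {z \<in> topspace Q. F z \<in> W}"
    unfolding openin_pointed_quotient topspace_N using topspace_Q by blast
qed

lemma continuous_Some: "continuous_map (subtopology M X) Q Some"
proof -
  have "continuous_map (subtopology M X) Q (collapse L)"
    by (rule continuous_map_from_subtopology_mono[OF continuous_collapse]) (use XNL in blast)
  then show ?thesis
    by (rule continuous_map_eq) (use XL in \<open>auto simp: collapse_def\<close>)
qed

lemma topspace_X: "topspace (subtopology M X) = X"
  using compactin_subset_topspace[OF X_compact] by auto

lemma isolated_Some_X:
  fixes x :: "int \<Rightarrow> 'a option"
  assumes "range x \<subseteq> topspace Q - {None}" "\<And>i. F (x i) = x (i + 1)"
  shows "x 0 \<in> Some ` X"
proof -
  have "\<exists>p. x i = Some p \<and> p \<in> N - L" for i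
  proof -
    have "x i \<in> topspace Q - {None}" using assms(1) by blast
    then show ?thesis unfolding topspace_Q by blast
  qed
  then obtain y where y: "\<And>i. x i = Some (y i)" "\<And>i. y i \<in> N - L" by metis
  have "f (y i) = y (i + 1)" for i
    using assms(2)[of i] F_Some_eqD unfolding y(1) by metis
  moreover have "range y \<subseteq> M closure_of (N - L)" using y(2) NL_A by blast
  ultimately have "y 0 \<in> Inv f (M closure_of (N - L))" unfolding Inv_def by blast
  then show ?thesis using X_Inv y(1) by simp
qed

text \<open>The base point and \<open>X\<close> are separated by open sets \<open>U\<close> and
  \<open>V\<close>. No full orbit of \<open>f\<close> stays in the compact set \<open>H\<close> cut
  out by removing \<open>V\<close>, so orbit segments in \<open>H\<close> have bounded length. An
  orbit of \<open>F\<close> that remains in \<open>U\<close> for that long must have reached the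
  base point.\<close>

lemma attracting_neighbourhood:
  obtains T n where "openin Q T" "None \<in> T" "F ` T \<subseteq> T" "\<And>z. z \<in> T \<Longrightarrow> (F ^^ n) z = None"
proof -
  have Ycpt: "compactin Q (Some ` X)"
    by (rule image_compactin[OF _ continuous_Some]) (simp add: compactin_subtopology X_compact)
  have "compactin Q {None}" by (simp add: topspace_Q)
  moreover have "disjnt {None} (Some ` X)" by auto
  ultimately obtain U V where UV: "openin Q U" "openin Q V" "{None} \<subseteq> U" "Some ` X \<subseteq> V" "disjnt U V"
    using Hausdorff_Q Ycpt unfolding Hausdorff_space_compact_sets by metis
  obtain O' where O: "openin M O'" "{p \<in> N. collapse L p \<in> V} = O' \<inter> N"
    by (rule openin_QD[OF UV(2)]) (rule that)
  define H where "H = M closure_of (N - L) - O'"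
  have XO: "X \<subseteq> O'"
  proof
    fix p assume "p \<in> X"
    then have "p \<in> {p \<in> N. collapse L p \<in> V}" using UV(4) XNL by (auto simp: collapse_def)
    then show "p \<in> O'" using O(2) by blast
  qed
  have Hcl: "closedin M H" unfolding H_def by (rule closedin_diff[OF closedin_closure_of O(1)])
  have Hcpt: "compactin M H"
    by (rule closed_compactin[OF A_compact _ Hcl]) (auto simp: H_def)
  have HN: "H \<subseteq> N" using A_N by (auto simp: H_def)
  have "Inv f H \<subseteq> X" unfolding X_Inv Inv_def H_def by blast
  moreover have "Inv f H \<subseteq> H" by (auto simp: Inv_def)
  ultimately have "Inv f H = {}" using XO unfolding H_def by blast
  then obtain n where n: "\<And>p. \<not> (\<forall>i\<le>n. (f ^^ i) p \<in> H)"
    using bounded_orbit_segments[OF haus Hcpt continuous_map_from_subtopology_mono[OF f_N HN]] by blast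
  have UH: "p \<in> H" if "Some p \<in> U" for p
  proof -
    have p: "p \<in> N - L" using that openin_subset[OF UV(1)] unfolding topspace_Q by blast
    have "Some p \<notin> V" using that UV(5) by (auto simp: disjnt_iff)
    then have "p \<notin> {p \<in> N. collapse L p \<in> V}" using p by (auto simp: collapse_def)
    then have "p \<notin> O'" using O(2) p by blast
    then show ?thesis using p NL_A unfolding H_def by blast
  qed
  \<comment> \<open>With \<open>n\<close> from the bound on segments, the iterate of index
    \<open>n\<close> is already \<open>None\<close>, so the next one is again in \<open>U\<close>:
    \<open>T\<close> is forward invariant.\<close>
  define T where "T = {z \<in> topspace Q. \<forall>i\<le>n. (F ^^ i) z \<in> U}"
  have FnNone: "(F ^^ i) None = None" for i by (induction i) (auto simp: F_None)
  have Tn: "(F ^^ n) z = None" if z: "z \<in> T" for z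
  proof (rule ccontr)
    assume nz: "(F ^^ n) z \<noteq> None"
    have ne: "(F ^^ i) z \<noteq> None" if "i \<le> n" for i
    proof
      assume "(F ^^ i) z = None"
      then have "(F ^^ (n - i)) ((F ^^ i) z) = None" using FnNone by simp
      then show False using nz that by (simp add: funpow_add[symmetric, THEN fun_cong, simplified])
    qed
    then obtain p where p: "z = Some p" using ne[of 0] by auto
    have "(F ^^ i) z = Some ((f ^^ i) p)" if "i \<le> n" for i
      using that
    proof (induction i)
      case (Suc i)
      then have "(F ^^ i) z = Some ((f ^^ i) p)" by simp
      then obtain q where "F (Some ((f ^^ i) p)) = Some q" using ne[OF Suc.prems] by auto
      then show ?case using \<open>(F ^^ i) z = Some ((f ^^ i) p)\<close> F_Some_eqD by fastforce
    qed (simp add: p)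
    then have "(f ^^ i) p \<in> H" if "i \<le> n" for i using z that UH unfolding T_def by force
    then show False using n by blast
  qed
  have Teq: "T = topspace Q \<inter> (\<Inter>i\<in>{..n}. {z \<in> topspace Q. (F ^^ i) z \<in> U})" by (auto simp: T_def)
  have opI: "openin Q (\<Inter>i\<in>{..n}. {z \<in> topspace Q. (F ^^ i) z \<in> U})"
    by (rule openin_INT2) (use funpow_continuous_map[OF continuous_F] UV(1) in \<open>auto simp: continuous_map_def\<close>)
  have "openin Q T" unfolding Teq by (rule openin_Int[OF openin_topspace opI])
  moreover have "None \<in> T" using FnNone UV(3) by (auto simp: T_def topspace_Q)
  moreover have "F ` T \<subseteq> T"
  proof
    fix y assume "y \<in> F ` T"
    then obtain z where z: "z \<in> T" "y = F z" by blast
    have "(F ^^ i) (F z) \<in> U" if "i \<le> n" for i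
    proof (cases "i = n")
      case True
      then have "(F ^^ i) (F z) = None" using Tn[OF z(1)] F_None by (simp add: funpow_swap1[symmetric])
      then show ?thesis using UV(3) by simp
    next
      case False
      then have "Suc i \<le> n" using that by simp
      then have "(F ^^ Suc i) z \<in> U" using z(1) unfolding T_def by blast
      then show ?thesis by (simp add: funpow_swap1)
    qed
    moreover have "F z \<in> topspace Q" using continuous_F z(1) by (auto simp: continuous_map_def T_def)
    ultimately show "y \<in> T" using z by (auto simp: T_def)
  qed
  ultimately show ?thesis using that Tn by blast
qed

end

lemma cech_link_cong:
  assumes U: "cech_cover X U" and eq: "\<And>x. x \<in> topspace X \<Longrightarrow> g x = g' x"
    and h: "cech_link X A g (U, c) (V, d) h"
  shows "cech_link X A g' (U, c) (V, d) h"
proof (rule cech_linkI)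
  note eq' = eq[OF cech_cover_mem[OF U]]
  {
    fix x u u' v v'
    assume a: "u \<in> U" "u' \<in> U" "v \<in> V" "v' \<in> V" "x \<in> u" "x \<in> u'" "g' x \<in> v" "g' x \<in> v'"
    show "h x u' v' = h x u v - c [u, u'] + d [v, v']"
      by (rule cech_link_change[OF h a(1-6)]) (use eq'[OF a(1,5)] a in simp_all)
  next
    fix x u v assume a: "u \<in> U" "v \<in> V" "x \<in> u" "g' x \<in> v"
    have "g x \<in> v" using eq'[OF a(1,3)] a(4) by simp
    then obtain w where w: "openin X w" "x \<in> w" "\<forall>y\<in>w. y \<in> u \<and> g y \<in> v \<longrightarrow> h y u v = h x u v"
      using cech_link_locally_const[OF h a(1-3)] by blast
    show "\<exists>w. openin X w \<and> x \<in> w \<and> (\<forall>y\<in>w. y \<in> u \<and> g' y \<in> v \<longrightarrow> h y u v = h x u v)"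
    proof (intro exI conjI ballI impI)
      show "openin X w" "x \<in> w" using w(1,2) by auto
      fix y assume y0: "y \<in> w" "y \<in> u \<and> g' y \<in> v"
      then have y: "y \<in> w" "y \<in> u" "g' y \<in> v" by auto
      show "h y u v = h x u v" by (rule w(3)[rule_format]) (use y eq'[OF a(1) y(2)] in simp_all)
    qed
  next
    fix x u v assume a: "u \<in> U" "v \<in> V" "x \<in> u" "g' x \<in> v" "x \<in> A"
    show "h x u v = 0"
      by (rule cech_link_zero[OF h a(1-3) _ a(5)]) (use eq'[OF a(1,3)] a in simp)
  }
qed

context index_pair_context
begin

text \<open>On \<open>X\<close> the index map satisfies
  \<open>F \<circ> Some = Some \<circ> f\<close>, so restricting along \<open>Some\<close> turns the
  link of the eigenclass into a link over \<open>f\<close>. If the restriction were zero, its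
  section would carry over to the copy of \<open>X\<close> in the quotient, and the gluing would
  make the class itself zero.\<close>

lemma eigenvalue_on_invariant_set:
  assumes fin: "finite (connected_components_of (subtopology M X))"
    and \<mu>: "\<mu> \<noteq> 0" "\<forall>n::nat. n > 0 \<longrightarrow> \<mu> ^ n \<noteq> 1"
    and ev: "linear_eigenvalue (cech Q {None} 1) (cech_map Q {None} 1 F) \<mu>"
  shows "linear_eigenvalue (cech (subtopology M X) {} 1) (cech_map (subtopology M X) {} 1 f) \<mu>"
proof -
  let ?X = "subtopology M X"
  have FN: "F ` {None} \<subseteq> {None}" by (simp add: F_None)
  from ev[unfolded linear_eigenvalue_cech1_iff[OF continuous_F FN]]
  obtain U c h where c: "(U, c) \<in> cech_cocycles Q {None} 1"
    and h: "cech_link Q {None} F (U, \<lambda>s. \<mu> * c s) (U, c) h"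
    and no: "\<not> (\<exists>s. cech_section Q (topspace Q) U c s \<and> (\<forall>x\<in>{None}. \<forall>u\<in>U. x \<in> u \<longrightarrow> s x u = 0))"
    by (elim exE conjE) (rule that)
  note U = cech_cocycle_cover[OF c]
  have fXX: "continuous_map ?X ?X f"
  proof -
    have "X \<subseteq> N" using XNL by blast
    from continuous_map_from_subtopology_mono[OF f_N this] show ?thesis
      using fX topspace_X by (auto simp: continuous_map_in_subtopology)
  qed
  obtain V r where V: "cech_cover ?X V" and r: "cech_refines Some V U r"
    using cech_refines_exists[OF continuous_Some U] by blast
  define d where "d = cech_pullback r V c"
  have e0: "Some ` {} \<subseteq> {None}" by simp
  have d: "(V, d) \<in> cech_cocycles ?X {} 1"
    unfolding d_def by (rule cech_pullback_cocycle[OF c e0 V r])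
  obtain k where k: "cech_link ?X {} Some (V, d) (U, c) k"
    using cech_pullback_link[OF c e0 V r] unfolding d_def by blast
  obtain W q where W: "cech_cover ?X W" and q: "cech_refines f W V q"
    using cech_refines_exists[OF fXX V] by blast
  define e where "e = cech_pullback q W d"
  have e1: "f ` {} \<subseteq> {}" by simp
  have ew: "cech_link ?X {} f (W, e) (V, d) (\<lambda>x v u. d [q v, u])"
    unfolding e_def by (rule cech_pullback_link[OF d e1 W q])
  \<comment> \<open>\<open>k1\<close> and \<open>k2'\<close> are links to \<open>(U, c)\<close> over
    the same map \<open>Some \<circ> f\<close>, one from the pull-back \<open>e\<close> of
    \<open>d\<close>, the other from \<open>\<mu> * d\<close>. Comparing them shows that
    \<open>e\<close> and \<open>\<mu> * d\<close> represent the same class.\<close>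
  obtain k1 where k1: "cech_link ?X {} (Some \<circ> f) (W, e) (U, c) k1"
    using cech_link_compose[OF W V fXX _ ew k] by blast
  obtain k2 where k2: "cech_link ?X {} (F \<circ> Some) (V, \<lambda>s. \<mu> * d s) (U, c) k2"
    using cech_link_compose[OF V U continuous_Some _ cech_link_smult[OF k] h] by blast
  have k2': "cech_link ?X {} (Some \<circ> f) (V, \<lambda>s. \<mu> * d s) (U, c) k2"
    by (rule cech_link_cong[OF V _ k2]) (simp add: topspace_X F_SomeX)
  obtain k3 where k3: "cech_link ?X {} id (V, \<lambda>s. \<mu> * d s) (W, e) k3"
    using cech_link_diff[OF V W U continuous_map_compose[OF fXX continuous_Some] k2' k1] by blast
  obtain k4 where k4: "cech_link ?X {} (f \<circ> id) (V, \<lambda>s. \<mu> * d s) (V, d) k4"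
    using cech_link_compose[OF V W continuous_map_id _ k3 ew] by blast
  have link: "cech_link ?X {} f (V, \<lambda>s. \<mu> * d s) (V, d) k4" using k4 by simp
  have "\<not> (\<exists>s. cech_section ?X (topspace ?X) V d s)"
  proof
    assume "\<exists>s. cech_section ?X (topspace ?X) V d s"
    then obtain s where s: "cech_section ?X X V d s" unfolding topspace_X by blast
    define v0 where "v0 x = (SOME v. v \<in> V \<and> x \<in> v)" for x
    have v0: "v0 x \<in> V" "x \<in> v0 x" if "x \<in> X" for x
      using someI_ex[of "\<lambda>v. v \<in> V \<and> x \<in> v"] cech_cover_point[OF V, of x] that topspace_X
      unfolding v0_def by auto
    \<comment> \<open>The section over \<open>X\<close> is carried by the link \<open>k\<close> into
      the charts of the quotient.\<close>
    define s0 where "s0 z u = s (the z) (v0 (the z)) + k (the z) (v0 (the z)) u" for z u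
    have s0: "s0 (Some x) u = s x v + k x v u" if "x \<in> X" "u \<in> U" "Some x \<in> u" "v \<in> V" "x \<in> v" for x u v
    proof -
      note w = v0[OF that(1)]
      have "s x v = s x (v0 x) + d [v0 x, v]"
        by (rule cech_section_change[OF s that(1) w(1) that(4) w(2) that(5)])
      moreover have "k x v u = k x (v0 x) u - d [v0 x, v] + c [u, u]"
        by (rule cech_link_change[OF k w(1) that(4,2,2) w(2) that(5,3,3)])
      moreover have "c [u, u] = 0" by (rule cech_cocycle_refl[OF c that(2,3)])
      ultimately show ?thesis by (simp add: s0_def)
    qed
    have "cech_section Q (Some ` X) U c s0"
    proof (rule cech_sectionI)
      fix z u u' assume a: "z \<in> Some ` X" "u \<in> U" "u' \<in> U" "z \<in> u" "z \<in> u'"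
      then obtain x where x: "z = Some x" "x \<in> X" by blast
      note v = v0[OF x(2)]
      have "d [v0 x, v0 x] = 0" by (rule cech_cocycle_refl[OF d v])
      moreover have "k x (v0 x) u' = k x (v0 x) u - d [v0 x, v0 x] + c [u, u']"
        by (rule cech_link_change[OF k v(1) v(1) a(2,3) v(2) v(2)]) (use a x in auto)
      ultimately show "s0 z u' = s0 z u + c [u, u']" by (simp add: s0_def x)
    next
      fix z u assume a: "z \<in> Some ` X" "u \<in> U" "z \<in> u"
      then obtain x where x: "z = Some x" "x \<in> X" by blast
      note v = v0[OF x(2)]
      have xu: "Some x \<in> u" using a x by simp
      obtain w where w: "openin ?X w" "x \<in> w" "\<forall>y\<in>w \<inter> X. y \<in> v0 x \<longrightarrow> s y (v0 x) = s x (v0 x)"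
        using cech_section_locally_const[OF s x(2) v] by (elim exE conjE) (rule that)
      obtain w' where w': "openin ?X w'" "x \<in> w'"
        "\<forall>y\<in>w'. y \<in> v0 x \<and> Some y \<in> u \<longrightarrow> k y (v0 x) u = k x (v0 x) u"
        using cech_link_locally_const[OF k v(1) a(2) v(2) xu] by (elim exE conjE) (rule that)
      have "openin ?X (w \<inter> w' \<inter> v0 x)" using w w' cech_cover_open[OF V v(1)] by blast
      then obtain O' where O: "openin M O'" "w \<inter> w' \<inter> v0 x = O' \<inter> X"
        unfolding openin_subtopology by blast
      show "\<exists>w. openin Q w \<and> z \<in> w \<and> (\<forall>y\<in>w \<inter> Some ` X. y \<in> u \<longrightarrow> s0 y u = s0 z u)"
      proof (intro exI conjI ballI impI)
        show "openin Q (Some ` (O' \<inter> (N - L)))" by (rule openin_Some[OF O(1)])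
        show "z \<in> Some ` (O' \<inter> (N - L))" using w w' v x O(2) XNL by blast
        fix y assume y: "y \<in> Some ` (O' \<inter> (N - L)) \<inter> Some ` X" "y \<in> u"
        then obtain p where p: "y = Some p" "p \<in> X" "p \<in> O'" by blast
        then have pw: "p \<in> w" "p \<in> w'" "p \<in> v0 x" using O(2) by blast+
        have pu: "Some p \<in> u" using y p by simp
        have "s p (v0 x) = s x (v0 x)" by (rule w(3)[rule_format]) (use p pw in auto)
        moreover have "k p (v0 x) u = k x (v0 x) u" by (rule w'(3)[rule_format]) (use pu pw in auto)
        ultimately show "s0 y u = s0 z u"
          unfolding p(1) x(1) s0[OF p(2) a(2) pu v(1) pw(3)] s0[OF x(2) a(2) xu v] by simp
      qed
    qed
    note sec = this
    have Ycpt: "compactin Q (Some ` X)"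
      by (rule image_compactin[OF _ continuous_Some]) (simp add: compactin_subtopology X_compact)
    have FY: "F ` Some ` X = Some ` X"
      using fX F_SomeX by (simp add: image_image cong: image_cong_simp) (metis image_image)
    have XQ: "Some ` X \<subseteq> topspace Q" using XNL topspace_Q by blast
    have finY: "finite (connected_components_of (subtopology Q (Some ` X)))"
      by (rule finite_connected_components_of_image[OF fin, where F = Some])
        (use continuous_Some topspace_X XQ in \<open>auto simp: continuous_map_in_subtopology\<close>)
    obtain T n where T: "openin Q T" "None \<in> T" "F ` T \<subseteq> T" "\<And>z. z \<in> T \<Longrightarrow> (F ^^ n) z = None"
      by (rule attracting_neighbourhood) (rule that)
    have "\<exists>s. cech_section Q (topspace Q) U c s \<and> (\<forall>u\<in>U. None \<in> u \<longrightarrow> s None u = 0)"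
    proof (rule section_exists_attractor_repeller[where Q = Q and F = F and pt = None and Y = "Some ` X"
          and T = T and ?n0.0 = n and U = U and c = c and h = h and \<mu> = \<mu> and ?s0.0 = s0])
      fix x :: "int \<Rightarrow> 'a option"
      assume "range x \<subseteq> topspace Q - {None}" "\<And>i. F (x i) = x (i + 1)"
      then show "x 0 \<in> Some ` X" by (rule isolated_Some_X)
    next
      show "None \<in> topspace Q" by (simp add: topspace_Q)
    qed (fact compact_Q Hausdorff_Q continuous_F F_None Ycpt FY finY T c h \<mu> sec | simp)+
    with no show False by simp
  qed
  then show ?thesis
    unfolding linear_eigenvalue_cech1_iff[OF fXX e1]
    by (intro exI conjI, rule_tac [1] d, rule_tac [1] link) simp
qed

end

section \<open>Maps to the punctured plane\<close>

lemma exp_powi: "exp (of_int n * (z::complex)) = exp z powi n"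
  by (cases n rule: int_cases4) (auto simp: exp_of_nat_mult power_int_minus exp_minus)

text \<open>The exponent is the winding number, read off from the end points of a logarithm
  \<open>q\<close> along the parametrised circle. Subtracting a linear function closes
  \<open>q\<close> to a loop \<open>k\<close> in the contractible plane; so
  \<open>exp \<circ> k\<close> is inessential in the punctured plane and has a logarithm on the
  circle.\<close>

lemma unit_circle_logarithm:
  assumes g: "continuous_on (sphere 0 1) g" and nz: "\<And>z::complex. z \<in> sphere 0 1 \<Longrightarrow> g z \<noteq> (0::complex)"
  obtains n l where "continuous_on (sphere 0 1) l" "\<And>z. z \<in> sphere 0 1 \<Longrightarrow> g z = z powi n * exp (l z)"
proof -
  define e where "e t = exp (2 * pi * \<i> * of_real t)" for t :: real
  have e: "continuous_on S e" for S unfolding e_def by (intro continuous_intros)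
  have e1: "e t \<in> sphere 0 1" for t by (simp add: e_def)
  have "continuous_on {0..1} (\<lambda>t. g (e t))"
    by (rule continuous_on_compose2[OF g e]) (use e1 in auto)
  then obtain q where q: "continuous_on {0..1} q" "\<And>t. t \<in> {0..1} \<Longrightarrow> g (e t) = exp (q t)"
    using continuous_logarithm_on_contractible[of "{0..1::real}" "\<lambda>t. g (e t)"] nz e1
    by (metis convex_imp_contractible convex_real_interval(5))
  have "exp (q 1) = exp (q 0)" using q(2)[of 0] q(2)[of 1] by (simp add: e_def)
  then obtain n where n: "q 1 = q 0 + complex_of_real (of_int (2 * n) * pi) * \<i>"
    unfolding exp_eq by auto
  define k where "k t = q t - of_int n * (2 * pi * \<i> * of_real t)" for t :: real
  have k: "path k" unfolding path_def k_def by (intro continuous_intros q(1))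
  have "homotopic_loops UNIV k (\<lambda>t. 0)"
    by (rule homotopic_loops_linear) (use k n in \<open>auto simp: pathfinish_def pathstart_def k_def path_def\<close>)
  then have "homotopic_loops (- {0}) (exp \<circ> k) (exp \<circ> (\<lambda>t. 0))"
    by (rule homotopic_loops_continuous_image) (auto intro: continuous_intros)
  then have "homotopic_with_canon (\<lambda>h. True) (sphere 0 1) (- {0})
      ((exp \<circ> k) \<circ> (\<lambda>z. Arg2pi z / (2 * pi))) ((exp \<circ> (\<lambda>t. 0)) \<circ> (\<lambda>z. Arg2pi z / (2 * pi)))"
    by (rule homotopic_loops_imp_homotopic_circlemaps)
  then have "\<exists>a. homotopic_with_canon (\<lambda>h. True) (sphere 0 1) (- {0})
      ((exp \<circ> k) \<circ> (\<lambda>z. Arg2pi z / (2 * pi))) (\<lambda>t. a)" by (auto simp: o_def)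
  then obtain l where l: "continuous_on (sphere 0 1) l"
    "\<And>z. z \<in> sphere 0 1 \<Longrightarrow> exp (k (Arg2pi z / (2 * pi))) = exp (l z)"
    unfolding inessential_eq_continuous_logarithm by auto
  have "g z = z powi n * exp (l z)" if z: "z \<in> sphere 0 1" for z
  proof -
    define t where "t = Arg2pi z / (2 * pi)"
    have t: "t \<in> {0..1}" using Arg2pi_ge_0[of z] Arg2pi_lt_2pi[of z] by (auto simp: t_def)
    have ze: "z = e t"
      using z Arg2pi_eq[of z] by (simp add: e_def t_def mult.commute)
    have "exp (q t) = exp (of_int n * (2 * pi * \<i> * of_real t)) * exp (k t)"
      by (simp add: k_def exp_diff)
    also have "\<dots> = e t powi n * exp (k t)" by (simp only: exp_powi e_def)
    finally have "g z = z powi n * exp (k t)" using q(2)[OF t] by (simp only: ze)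
    moreover have "exp (k t) = exp (l z)" using l(2)[OF z] by (simp only: t_def)
    ultimately show ?thesis by (simp only:)
  qed
  then show ?thesis using that l(1) by blast
qed

lemma circle_logarithm:
  fixes a :: complex
  assumes r: "r > 0" and g: "continuous_on (sphere a r) g" and nz: "\<And>z. z \<in> sphere a r \<Longrightarrow> g z \<noteq> (0::complex)"
  obtains n l where "continuous_on (sphere a r) l" "\<And>z. z \<in> sphere a r \<Longrightarrow> g z = (z - a) powi n * exp (l z)"
proof -
  have S: "a + of_real r * w \<in> sphere a r" if "w \<in> sphere 0 1" for w
    using that r by (simp add: dist_norm norm_mult)
  have S': "(z - a) / of_real r \<in> sphere 0 1" if "z \<in> sphere a r" for z
    using that r by (simp add: dist_norm norm_divide norm_minus_commute)
  have "continuous_on (sphere 0 1) (\<lambda>w. g (a + of_real r * w))"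
    by (rule continuous_on_compose2[OF g]) (use S in \<open>auto intro!: continuous_intros\<close>)
  then obtain n l where l: "continuous_on (sphere 0 1) l"
    "\<And>w. w \<in> sphere 0 1 \<Longrightarrow> g (a + of_real r * w) = w powi n * exp (l w)"
    using unit_circle_logarithm[of "\<lambda>w. g (a + of_real r * w)"] nz S by metis
  \<comment> \<open>Rescaling produces the factor \<open>r powi n\<close>, which is absorbed into
    the logarithm as \<open>n * ln r\<close>.\<close>
  have "continuous_on (sphere a r) (\<lambda>z. l ((z - a) / of_real r) - of_int n * of_real (ln r))"
    by (intro continuous_intros continuous_on_compose2[OF l(1)]) (use S' r in auto)
  moreover have "g z = (z - a) powi n * exp (l ((z - a) / of_real r) - of_int n * of_real (ln r))"
    if z: "z \<in> sphere a r" for z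
  proof -
    have "exp (of_int n * of_real (ln r) :: complex) = of_real r powi n"
      using r by (simp only: exp_powi) (simp add: exp_of_real)
    then show ?thesis using l(2)[OF S'[OF z]] r
      by (simp add: exp_diff power_int_divide_distrib)
  qed
  ultimately show ?thesis using that by blast
qed

text \<open>\<open>h\<close> compares \<open>l\<close> with the evident logarithm of the power along
  the circle, in units of \<open>2 * pi * \<i>\<close>. It is continuous and integer valued, hence
  constant, but its values at 0 and 1 differ by \<open>n\<close>.\<close>

lemma circle_power_logarithm_imp_zero:
  fixes a :: complex
  assumes r: "r > 0" and l: "continuous_on (sphere a r) l"
    and eq: "\<And>z. z \<in> sphere a r \<Longrightarrow> (z - a) powi n = exp (l z)"
  shows "n = 0"
proof -
  define e where "e t = a + of_real r * exp (2 * pi * \<i> * of_real t)" for t :: real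
  define h where "h t = (l (e t) - of_int n * (2 * pi * \<i> * of_real t + of_real (ln r))) / (2 * pi * \<i>)" for t :: real
  have eS: "e t \<in> sphere a r" for t using r by (simp add: e_def dist_norm norm_mult)
  have h: "continuous_on {0..1} h"
    unfolding h_def by (intro continuous_intros continuous_on_compose2[OF l])
      (use eS in \<open>auto simp: e_def intro!: continuous_intros\<close>)
  have int: "h t \<in> \<int>" for t
  proof -
    have "exp (l (e t)) = exp (of_int n * (2 * pi * \<i> * of_real t + of_real (ln r)))"
      using eq[OF eS[of t]] r unfolding exp_powi by (simp add: e_def exp_add exp_of_real mult.commute)
    then obtain m :: int where "l (e t) = of_int n * (2 * pi * \<i> * of_real t + of_real (ln r)) + complex_of_real (of_int (2 * m) * pi) * \<i>"
      unfolding exp_eq by auto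
    then have "h t = of_int m" by (simp add: h_def)
    then show ?thesis by simp
  qed
  have "h constant_on {0..1}"
  proof (rule continuous_discrete_range_constant[OF _ h])
    fix x :: real
    have "1 \<le> norm (h y - h x)" if "h y \<noteq> h x" for y
    proof -
      obtain i j :: int where ij: "h y = of_int i" "h x = of_int j" using int by (meson Ints_cases)
      then have "norm (h y - h x) = of_int \<bar>i - j\<bar>" by (metis norm_of_int of_int_abs of_int_diff)
      moreover have "\<bar>i - j\<bar> \<ge> 1" using that ij by auto
      ultimately show ?thesis by simp
    qed
    then show "\<exists>e>0. \<forall>y. y \<in> {0..1} \<and> h y \<noteq> h x \<longrightarrow> e \<le> norm (h y - h x)"
      by (intro exI[of _ 1]) auto
  qed simp
  then have "h 0 = h 1" unfolding constant_on_def by auto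
  moreover have "e 0 = e 1" by (simp add: e_def)
  ultimately show "n = 0" by (simp add: h_def field_simps)
qed

text \<open>The punctures are filled one at a time. Dividing by \<open>(z - a) powi n\<close>, with
  \<open>n\<close> the winding number on a small circle about \<open>a\<close>, leaves a function
  with a logarithm on that circle, and a Tietze extension of this logarithm redefines the function
  on the disc. The disc avoids \<open>X\<close>, so only the power of \<open>z - a\<close> has to be
  recorded there. Without punctures, contractibility of the plane gives the logarithm.\<close>

lemma punctured_plane_logarithm:
  fixes K X :: "complex set"
  assumes "finite K" and "compact X" and "X \<inter> K = {}"
    and "continuous_on (- K) g" and "\<And>z. z \<notin> K \<Longrightarrow> g z \<noteq> (0::complex)"
  shows "\<exists>n l. continuous_on X l \<and> (\<forall>z\<in>X. g z = (\<Prod>a\<in>K. (z - a) powi n a) * exp (l z))"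
  using assms
proof (induction K arbitrary: g rule: finite_induct)
  case empty
  then have "continuous_on UNIV g" by simp
  then obtain l where "continuous_on UNIV l" "\<And>z. g z = exp (l z)"
    using continuous_logarithm_on_contractible[of UNIV g] empty.prems(4)
    by (metis UNIV_I convex_UNIV convex_imp_contractible empty_iff)
  then show ?case by (auto intro: continuous_on_subset)
next
  case (insert a K)
  have "closed (K \<union> X)" using insert by (simp add: closed_Un compact_imp_closed finite_imp_closed)
  moreover have "a \<notin> K \<union> X" using insert by auto
  ultimately have "open (- (K \<union> X))" "a \<in> - (K \<union> X)" by (simp_all only: open_Compl Compl_iff not_False_eq_True)
  then obtain r where "r > 0" "ball a r \<subseteq> - (K \<union> X)" by (rule openE)
  then have r: "r > 0" "ball a r \<inter> (K \<union> X) = {}" by auto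
  define \<rho> where "\<rho> = r / 2"
  have \<rho>: "\<rho> > 0" "cball a \<rho> \<inter> (K \<union> X) = {}"
    using r by (auto simp: \<rho>_def disjoint_iff)
  have sph: "sphere a \<rho> \<subseteq> - insert a K" using \<rho> by auto
  obtain n l where l: "continuous_on (sphere a \<rho>) l"
    "\<And>z. z \<in> sphere a \<rho> \<Longrightarrow> g z = (z - a) powi n * exp (l z)"
    using circle_logarithm[OF \<rho>(1), of a g] continuous_on_subset[OF insert.prems(3) sph] insert.prems(4) sph
    by (metis ComplD subsetD)
  obtain l' where l': "continuous_on UNIV l'" "\<And>z. z \<in> sphere a \<rho> \<Longrightarrow> l' z = l z"
    using Tietze_unbounded[OF l(1), of UNIV] by auto
  define G where "G z = (if z \<in> cball a \<rho> then exp (l' z) else g z * (z - a) powi (- n))" for z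
  have un: "cball a \<rho> \<union> (- K - ball a \<rho>) = - K" using \<rho> by auto
  have "continuous_on (cball a \<rho> \<union> (- K - ball a \<rho>)) G"
    unfolding G_def
  proof (rule continuous_on_cases_local)
    show "closedin (top_of_set (cball a \<rho> \<union> (- K - ball a \<rho>))) (cball a \<rho>)"
      by (rule closed_subset) auto
    have "- K - ball a \<rho> = (- K) \<inter> (- ball a \<rho>)" by auto
    then show "closedin (top_of_set (cball a \<rho> \<union> (- K - ball a \<rho>))) (- K - ball a \<rho>)"
      unfolding un by (simp add: closedin_closed_Int closed_Compl)
    show "continuous_on (cball a \<rho>) (\<lambda>z. exp (l' z))"
      by (intro continuous_intros continuous_on_subset[OF l'(1)]) auto
    show "continuous_on (- K - ball a \<rho>) (\<lambda>z. g z * (z - a) powi (- n))"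
      by (intro continuous_intros continuous_on_subset[OF insert.prems(3)]) (use \<rho> in auto)
    fix z assume "z \<in> cball a \<rho> \<and> z \<notin> cball a \<rho> \<or> z \<in> - K - ball a \<rho> \<and> z \<in> cball a \<rho>"
    then have z: "z \<in> sphere a \<rho>" by auto
    then have "z \<noteq> a" using \<rho> by auto
    then show "exp (l' z) = g z * (z - a) powi (- n)"
      using l(2)[OF z] l'(2)[OF z] by (simp add: power_int_minus field_simps)
  qed
  then have G: "continuous_on (- K) G" unfolding un .
  have Gnz: "G z \<noteq> 0" if "z \<notin> K" for z
  proof (cases "z \<in> cball a \<rho>")
    case False
    then have "z \<noteq> a" using \<rho>(1) by auto
    then show ?thesis using that insert.prems(4)[of z] False by (auto simp: G_def power_int_eq_0_iff)
  qed (simp add: G_def)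
  obtain m L where L: "continuous_on X L" "\<forall>z\<in>X. G z = (\<Prod>a\<in>K. (z - a) powi m a) * exp (L z)"
    using insert.IH[OF insert.prems(1) _ G Gnz] insert.prems(2) by auto
  have "g z = (\<Prod>b\<in>insert a K. (z - b) powi ((m(a := n)) b)) * exp (L z)" if z: "z \<in> X" for z
  proof -
    have za: "z \<noteq> a" "z \<notin> cball a \<rho>" using z insert.prems(2) \<rho>(2) by auto
    have "g z = (z - a) powi n * G z" using za by (simp add: G_def power_int_minus)
    moreover have "(\<Prod>b\<in>K. (z - b) powi ((m(a := n)) b)) = (\<Prod>b\<in>K. (z - b) powi m b)"
      by (rule prod.cong) (use insert.hyps in auto)
    ultimately show ?thesis using L(2) z insert.hyps by (simp add: mult.assoc)
  qed
  then show ?case using L(1) by blast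
qed

text \<open>A map from a compact plane set to the circle extends to the plane minus finitely many
  points, which may be taken in any set that meets all bounded complementary components. The
  extension has no zeros, so its punctures can be filled.\<close>

lemma circle_valued_map_logarithm:
  fixes X :: "complex set"
  assumes X: "compact X" and g: "continuous_on X g" "\<And>z. z \<in> X \<Longrightarrow> g z \<in> sphere (0::complex) 1"
    and L: "\<And>C. \<lbrakk>C \<in> components (- X); bounded C\<rbrakk> \<Longrightarrow> C \<inter> L \<noteq> {}"
  shows "\<exists>K n l. finite K \<and> K \<subseteq> L \<and> K \<inter> X = {} \<and> continuous_on X l \<and>
    (\<forall>z\<in>X. g z = (\<Prod>a\<in>K. (z - a) powi n a) * exp (l z))"
proof -
  have "g \<in> X \<rightarrow> sphere 0 1" using g(2) by auto
  then obtain K G where K: "finite K" "K \<subseteq> L" "disjnt K X" "continuous_on (- K) G"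
    "G \<in> (- K) \<rightarrow> sphere 0 1" "\<And>x. x \<in> X \<Longrightarrow> G x = g x"
    using extend_map_UNIV_to_sphere_cofinite[of 1 X g 0 L] X g(1) L by auto
  have "G z \<noteq> 0" if "z \<notin> K" for z
  proof -
    have "G z \<in> sphere 0 1" using K(5) by (rule funcset_mem) (use that in simp)
    then show ?thesis by auto
  qed
  moreover have "X \<inter> K = {}" using K(3) by (auto simp: disjnt_iff)
  ultimately obtain n l where "continuous_on X l" "\<forall>z\<in>X. G z = (\<Prod>a\<in>K. (z - a) powi n a) * exp (l z)"
    using punctured_plane_logarithm[OF K(1) X _ K(4)] by metis
  then show ?thesis using K \<open>X \<inter> K = {}\<close> by (intro exI[of _ K] exI[of _ n] exI[of _ l]) auto
qed

text \<open>An embedding of the plane has local degree 1 or -1. The inverse \<open>f\<close> has an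
  exponent \<open>m\<close> on a small circle about \<open>\<phi> b\<close>; substituting its
  factorisation into that of \<open>\<phi>\<close> gives \<open>m * n b = 1\<close>.\<close>

lemma plane_embedding_logarithm:
  fixes \<phi> :: "complex \<Rightarrow> complex"
  assumes \<phi>: "continuous_on UNIV \<phi>" "inj \<phi>" and X: "compact X" and b: "b \<notin> X"
  shows "\<exists>n\<in>{1, -1}. \<exists>l. continuous_on X l \<and> (\<forall>z\<in>X. \<phi> z - \<phi> b = (z - b) powi n * exp (l z))"
proof -
  define a where "a = \<phi> b"
  obtain f where f: "homeomorphism UNIV (range \<phi>) \<phi> f"
    using invariance_of_domain_homeomorphism[OF open_UNIV \<phi>(1) _ \<phi>(2)] by auto
  have f\<phi>: "f (\<phi> z) = z" for z using f by (simp add: homeomorphism_def)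
  have \<phi>f: "\<phi> (f w) = w" if "w \<in> range \<phi>" for w using that f\<phi> by auto
  have fc: "continuous_on (range \<phi>) f" using f by (simp add: homeomorphism_def)
  have "open (range \<phi>)" by (rule invariance_of_domain[OF \<phi>(1) open_UNIV \<phi>(2)])
  then obtain r0 where r0: "r0 > 0" "ball a r0 \<subseteq> range \<phi>"
    unfolding a_def by (metis openE rangeI)
  define r where "r = r0 / 2"
  have r: "r > 0" "sphere a r \<subseteq> range \<phi>" using r0 by (auto simp: r_def subset_iff)
  have fb: "f w \<noteq> b" if "w \<in> sphere a r" for w
  proof
    assume "f w = b"
    then have "w = a" using \<phi>f[of w] that r(2) by (auto simp: a_def)
    then show False using that r(1) by simp
  qed
  have fs: "continuous_on (sphere a r) f" using continuous_on_subset[OF fc r(2)] .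
  \<comment> \<open>The image of the circle is added so that the same exponent serves on
    \<open>X\<close> and in the computation on the circle.\<close>
  define X' where "X' = X \<union> f ` sphere a r"
  have X': "compact X'" unfolding X'_def using X fs by (intro compact_Un compact_continuous_image) auto
  have bX': "X' \<inter> {b} = {}" using b fb unfolding X'_def by blast
  have "continuous_on (- {b}) (\<lambda>z. \<phi> z - a)"
    by (intro continuous_intros continuous_on_subset[OF \<phi>(1)]) auto
  moreover have "\<phi> z - a \<noteq> 0" if "z \<notin> {b}" for z using that \<phi>(2) by (auto simp: a_def inj_def)
  ultimately obtain n l where l: "continuous_on X' l"
    "\<forall>z\<in>X'. \<phi> z - a = (\<Prod>c\<in>{b}. (z - c) powi n c) * exp (l z)"
    using punctured_plane_logarithm[OF _ X' bX', of "\<lambda>z. \<phi> z - a"] by auto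
  have "continuous_on (sphere a r) (\<lambda>w. f w - b)" by (intro continuous_intros fs)
  then obtain m k where k: "continuous_on (sphere a r) k"
    "\<And>w. w \<in> sphere a r \<Longrightarrow> f w - b = (w - a) powi m * exp (k w)"
    using circle_logarithm[OF r(1), of a "\<lambda>w. f w - b"] fb by (metis right_minus_eq)
  have "1 - m * n b = 0"
  proof (rule circle_power_logarithm_imp_zero[OF r(1)])
    show "continuous_on (sphere a r) (\<lambda>w. of_int (n b) * k w + l (f w))"
      by (intro continuous_intros k(1) continuous_on_compose2[OF l(1) fs]) (auto simp: X'_def)
    fix w assume w: "w \<in> sphere a r"
    have wa: "w - a \<noteq> 0" using w r(1) by auto
    have "w - a = \<phi> (f w) - a" using \<phi>f w r(2) by auto
    also have "\<dots> = (f w - b) powi n b * exp (l (f w))" using l(2) w by (auto simp: X'_def)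
    also have "\<dots> = (w - a) powi (m * n b) * exp (of_int (n b) * k w + l (f w))"
      unfolding k(2)[OF w] by (simp add: power_int_mult_distrib power_int_mult exp_add exp_powi)
    finally have e: "(w - a) powi (m * n b) * exp (of_int (n b) * k w + l (f w)) = w - a" by simp
    have "(w - a) powi (1 - m * n b) = (w - a) / (w - a) powi (m * n b)"
      using wa by (simp add: power_int_diff)
    also have "\<dots> = exp (of_int (n b) * k w + l (f w))"
      using e wa by (simp add: field_simps)
    finally show "(w - a) powi (1 - m * n b) = exp (of_int (n b) * k w + l (f w))" .
  qed
  then have "m * n b = 1" by simp
  then have "n b \<in> {1, -1}" by (metis insert_iff zmult_eq_1_iff)
  moreover have "continuous_on X l" by (rule continuous_on_subset[OF l(1)]) (auto simp: X'_def)
  moreover have "\<forall>z\<in>X. \<phi> z - \<phi> b = (z - b) powi n b * exp (l z)"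
    using l(2) by (auto simp: X'_def a_def)
  ultimately show ?thesis by blast
qed

text \<open>Off \<open>H\<close>, take the product of the factors with \<open>p i\<close> in
  \<open>H\<close>; on the closure of \<open>H\<close>, take the extended exponential divided by the
  other factors. They agree on the frontier, which lies in \<open>X\<close>, and form a function
  without zeros on the plane. It has a logarithm, while on a large circle it winds as often as the
  sum says.\<close>

lemma sum_windings_zero:
  fixes p :: "'i \<Rightarrow> complex" and m :: "'i \<Rightarrow> int"
  assumes X: "compact X" and I: "finite I" and p: "\<And>i. i \<in> I \<Longrightarrow> p i \<notin> X"
    and H: "H \<in> components (- X)" "bounded H"
    and l: "continuous_on X l" and eq: "\<And>z. z \<in> X \<Longrightarrow> (\<Prod>i\<in>I. (z - p i) powi m i) = exp (l z)"
  shows "(\<Sum>i | i \<in> I \<and> p i \<in> H. m i) = 0"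
proof -
  define J where "J = {i \<in> I. p i \<in> H}"
  have J: "finite J" "J \<subseteq> I" using I by (auto simp: J_def)
  obtain l' where l': "continuous_on UNIV l'" "\<And>z. z \<in> X \<Longrightarrow> l' z = l z"
    using Tietze_unbounded[OF l, of UNIV] X by (auto simp: compact_imp_closed)
  have oH: "open H" using H(1) X open_components[of "- X" H] by (simp add: compact_imp_closed open_Compl)
  have HX: "H \<inter> X = {}" using in_components_subset[OF H(1)] by auto
  have fr: "closure H \<subseteq> H \<union> X"
  proof -
    have "frontier H \<subseteq> X"
      using frontier_of_components_closed_complement[OF compact_imp_closed[OF X] H(1)] .
    then show ?thesis using oH by (auto simp: frontier_def interior_open)
  qed
  define G where "G z = (if z \<in> closure H then exp (l' z) * (\<Prod>i\<in>I - J. (z - p i) powi (- m i))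
     else (\<Prod>i\<in>J. (z - p i) powi m i))" for z
  have pcl: "p i \<notin> closure H" if "i \<in> I - J" for i
    using that fr p by (auto simp: J_def)
  have "continuous_on (closure H \<union> (- H)) G"
    unfolding G_def
  proof (rule continuous_on_cases)
    show "continuous_on (closure H) (\<lambda>z. exp (l' z) * (\<Prod>i\<in>I - J. (z - p i) powi (- m i)))"
      by (intro continuous_intros continuous_on_subset[OF l'(1)]) (use pcl in auto)
    show "continuous_on (- H) (\<lambda>z. \<Prod>i\<in>J. (z - p i) powi m i)"
      by (intro continuous_intros) (auto simp: J_def)
    show "\<forall>z. z \<in> closure H \<and> z \<notin> closure H \<or> z \<in> - H \<and> z \<in> closure H \<longrightarrow>
        exp (l' z) * (\<Prod>i\<in>I - J. (z - p i) powi (- m i)) = (\<Prod>i\<in>J. (z - p i) powi m i)"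
    proof (intro allI impI)
      fix z assume "z \<in> closure H \<and> z \<notin> closure H \<or> z \<in> - H \<and> z \<in> closure H"
      then have z: "z \<in> X" using fr by auto
      have nz: "z - p i \<noteq> 0" if "i \<in> I" for i using p[OF that] z by auto
      have "exp (l' z) = (\<Prod>i\<in>I - J. (z - p i) powi m i) * (\<Prod>i\<in>J. (z - p i) powi m i)"
        using eq[OF z] l'(2)[OF z] prod.subset_diff[OF J(2) I, of "\<lambda>i. (z - p i) powi m i"] by simp
      moreover have "(\<Prod>i\<in>I - J. (z - p i) powi m i) * (\<Prod>i\<in>I - J. (z - p i) powi (- m i)) = 1"
        unfolding prod.distrib[symmetric]
        by (rule prod.neutral) (use nz in \<open>auto simp: power_int_minus\<close>)
      ultimately show "exp (l' z) * (\<Prod>i\<in>I - J. (z - p i) powi (- m i)) = (\<Prod>i\<in>J. (z - p i) powi m i)"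
        by (simp add: mult.assoc mult.left_commute)
    qed
  qed (use oH in auto)
  moreover have "closure H \<union> - H = UNIV" using closure_subset[of H] by auto
  ultimately have G: "continuous_on UNIV G" by simp
  have Gnz: "G z \<noteq> 0" for z
  proof (cases "z \<in> closure H")
    case True
    then show ?thesis using pcl I by (auto simp: G_def power_int_eq_0_iff)
  next
    case False
    then have "z \<notin> H" using closure_subset by auto
    then show ?thesis using False J by (auto simp: G_def power_int_eq_0_iff J_def)
  qed
  obtain k where k: "continuous_on UNIV k" "\<And>z. G z = exp (k z)"
    using continuous_logarithm_on_contractible[OF G] Gnz convex_imp_contractible[OF convex_UNIV] by auto
  \<comment> \<open>On a circle that encloses the closure of \<open>H\<close>, each
    \<open>1 - p i / z\<close> has positive real part. So its principal logarithm is continuous, and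
    only a power of \<open>z\<close> remains.\<close>
  obtain R where R: "R > 0" "\<And>z. z \<in> closure H \<Longrightarrow> norm z < R"
    using H(2) bounded_closure bounded_pos_less by metis
  have pR: "norm (p i) < R" if "i \<in> J" for i
    using that R(2) closure_subset[of H] by (auto simp: J_def)
  have "(\<Sum>i\<in>J. m i) = 0"
  proof (rule circle_power_logarithm_imp_zero[OF R(1), of 0])
    have re: "1 - p i / z \<notin> \<real>\<^sub>\<le>\<^sub>0" if "i \<in> J" "z \<in> sphere 0 R" for i z
    proof -
      have "norm (p i / z) < 1" using pR[OF that(1)] that(2) R(1) by (simp add: norm_divide)
      then have "Re (p i / z) < 1" using complex_Re_le_cmod[of "p i / z"] by linarith
      then show ?thesis by (auto simp: complex_nonpos_Reals_iff)
    qed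
    show "continuous_on (sphere 0 R) (\<lambda>z. k z - (\<Sum>i\<in>J. of_int (m i) * Ln (1 - p i / z)))"
      by (intro continuous_intros continuous_on_subset[OF k(1)] re) (use R(1) in auto)
    fix z :: complex assume z: "z \<in> sphere 0 R"
    then have z0: "z \<noteq> 0" using R(1) by auto
    have zH: "z \<notin> closure H" using R(2) z by force
    have "(z - p i) powi m i = z powi m i * exp (of_int (m i) * Ln (1 - p i / z))" if "i \<in> J" for i
    proof -
      have nz: "1 - p i / z \<noteq> 0" using re[OF that z] by auto
      have "z - p i = z * (1 - p i / z)" using z0 by (simp add: field_simps)
      then show ?thesis using nz by (simp add: exp_powi power_int_mult_distrib)
    qed
    then have "exp (k z) = (\<Prod>i\<in>J. z powi m i) * exp (\<Sum>i\<in>J. of_int (m i) * Ln (1 - p i / z))"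
      using k(2)[of z, symmetric] zH J(1) by (simp add: G_def exp_sum prod.distrib)
    moreover have "(\<Prod>i\<in>J. z powi m i) = z powi (\<Sum>i\<in>J. m i)"
      using J(1) z0 by (induction J rule: finite_induct) (auto simp: power_int_add)
    ultimately show "(z - 0) powi (\<Sum>i\<in>J. m i) = exp (k z - (\<Sum>i\<in>J. of_int (m i) * Ln (1 - p i / z)))"
      by (simp add: exp_diff)
  qed
  then show ?thesis by (simp add: J_def)
qed

section \<open>Germs of cocycles along the diagonal\<close>

text \<open>Eventual equality along this filter is equality of germs at the diagonal, which is how
  Alexander-Spanier cochains of degree one are identified.\<close>

definition diag :: "'a::metric_space set \<Rightarrow> ('a \<times> 'a) filter" where
  "diag X = inf uniformity (principal (X \<times> X))"

lemma eventually_diag: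
  "eventually P (diag X) \<longleftrightarrow>
     (\<exists>d>0. \<forall>x\<in>X. \<forall>y\<in>X. dist x y < d \<longrightarrow> P (x, y))"
  unfolding diag_def eventually_inf_principal eventually_uniformity_metric by auto

lemma eventually_diagI:
  assumes "d > 0" "\<And>x y. \<lbrakk>x \<in> X; y \<in> X; dist x y < d\<rbrakk> \<Longrightarrow> P (x, y)"
  shows "eventually P (diag X)"
  unfolding eventually_diag using assms by blast

lemma tendsto_diag_iff:
  fixes A :: "'a::metric_space \<times> 'a \<Rightarrow> 'b::real_normed_vector"
  shows "(A \<longlongrightarrow> 0) (diag X) \<longleftrightarrow>
     (\<forall>e>0. \<exists>d>0. \<forall>x\<in>X. \<forall>y\<in>X. dist x y < d \<longrightarrow> norm (A (x, y)) < e)"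
  unfolding tendsto_iff eventually_diag by (simp add: dist_norm)

lemma tendsto_diag_diff:
  fixes l :: "'a::metric_space \<Rightarrow> 'b::real_normed_vector"
  assumes "compact X" "continuous_on X l"
  shows "((\<lambda>(x, y). l y - l x) \<longlongrightarrow> 0) (diag X)"
  unfolding tendsto_diag_iff
proof (intro allI impI)
  fix e :: real assume "e > 0"
  then obtain d where d: "d > 0" "\<forall>x\<in>X. \<forall>x'\<in>X. dist x' x < d \<longrightarrow> dist (l x') (l x) < e"
    using compact_uniformly_continuous[OF assms(2,1)] unfolding uniformly_continuous_on_def by meson
  then show "\<exists>d>0. \<forall>x\<in>X. \<forall>y\<in>X. dist x y < d \<longrightarrow> norm (case (x, y) of (x, y) \<Rightarrow> l y - l x) < e"
    by (intro exI[of _ d]) (auto simp: dist_norm[of "l _"] dist_commute)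
qed

lemma filterlim_diag:
  assumes "compact X" "continuous_on X \<phi>" "\<phi> ` X \<subseteq> Y"
  shows "filterlim (\<lambda>(x, y). (\<phi> x, \<phi> y)) (diag Y) (diag X)"
  unfolding filterlim_iff
proof (intro allI impI)
  fix P assume "eventually P (diag Y)"
  then obtain d where d: "d > 0" "\<forall>x\<in>Y. \<forall>y\<in>Y. dist x y < d \<longrightarrow> P (x, y)"
    unfolding eventually_diag by blast
  obtain e where e: "e > 0" "\<forall>x\<in>X. \<forall>y\<in>X. dist y x < e \<longrightarrow> dist (\<phi> y) (\<phi> x) < d"
    using compact_uniformly_continuous[OF assms(2,1)] d(1) unfolding uniformly_continuous_on_def by metis
  show "\<forall>\<^sub>F x in diag X. P (case x of (x, y) \<Rightarrow> (\<phi> x, \<phi> y))"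
    by (rule eventually_diagI[OF e(1)]) (use d(2) e(2) assms(3) in \<open>auto simp: image_subset_iff\<close>)
qed

text \<open>The Alexander-Spanier cocycle of the class of \<open>z \<mapsto> z - a\<close>. Only its germ along the diagonal is
  additive.\<close>

definition Lam :: "complex \<Rightarrow> complex \<times> complex \<Rightarrow> complex" where
  "Lam a = (\<lambda>(x, y). Ln ((y - a) / (x - a)))"

lemma exp_Lam: "\<lbrakk>x \<noteq> a; y \<noteq> a\<rbrakk> \<Longrightarrow> exp (Lam a (x, y)) = (y - a) / (x - a)"
  by (simp add: Lam_def)

lemma tendsto_Lam:
  assumes X: "closed X" and a: "a \<notin> X"
  shows "(Lam a \<longlongrightarrow> 0) (diag X)"
proof -
  obtain r where r: "r > 0" "\<forall>x\<in>X. r \<le> dist a x" using separate_point_closed[OF X a] by blast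
  have "((\<lambda>(x, y). (y - a) / (x - a) - 1) \<longlongrightarrow> 0) (diag X)"
    unfolding tendsto_diag_iff
  proof (intro allI impI)
    fix e :: real assume e: "e > 0"
    have "norm ((y - a) / (x - a) - 1) < e" if xy: "x \<in> X" "y \<in> X" "dist x y < e * r" for x y
    proof -
      have rx: "r \<le> norm (x - a)" using r(2) xy(1) by (metis dist_commute dist_norm)
      then have "x - a \<noteq> 0" using r(1) by auto
      then have "(y - a) / (x - a) - 1 = (y - x) / (x - a)" by (simp add: field_simps)
      then have "norm ((y - a) / (x - a) - 1) = dist x y / norm (x - a)"
        by (simp add: norm_divide dist_norm norm_minus_commute)
      also have "\<dots> < e"
      proof -
        have "e * r \<le> e * norm (x - a)" using rx e by (intro mult_left_mono) auto
        then have "dist x y < e * norm (x - a)" using xy(3) by linarith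
        then show ?thesis using rx r(1) e by (simp add: divide_less_eq)
      qed
      finally show ?thesis .
    qed
    then show "\<exists>d>0. \<forall>x\<in>X. \<forall>y\<in>X. dist x y < d \<longrightarrow>
        norm (case (x, y) of (x, y) \<Rightarrow> (y - a) / (x - a) - 1) < e"
      using e r(1) by (intro exI[of _ "e * r"]) auto
  qed
  then have "((\<lambda>(x, y). (y - a) / (x - a)) \<longlongrightarrow> 1) (diag X)"
    by (simp add: LIM_zero_iff case_prod_unfold)
  then have "((\<lambda>p. Ln ((\<lambda>(x, y). (y - a) / (x - a)) p)) \<longlongrightarrow> Ln 1) (diag X)"
    by (rule tendsto_Ln) simp
  then show ?thesis by (simp add: Lam_def case_prod_unfold)
qed

text \<open>The difference is a multiple of \<open>2 * pi * \<i>\<close>, and both functions are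
  eventually too small for a nonzero multiple.\<close>

lemma eventually_eq_of_exp_eq:
  fixes A B :: "'a \<Rightarrow> complex"
  assumes "(A \<longlongrightarrow> 0) F" "(B \<longlongrightarrow> 0) F" "\<forall>\<^sub>F p in F. exp (A p) = exp (B p)"
  shows "\<forall>\<^sub>F p in F. A p = B p"
proof -
  have "\<forall>\<^sub>F p in F. norm (A p - 0) < pi" "\<forall>\<^sub>F p in F. norm (B p - 0) < pi"
    using assms(1,2)[THEN tendstoD, of pi] by (simp_all add: dist_norm)
  then show ?thesis using assms(3)
  proof eventually_elim
    case (elim p)
    have "\<bar>Im (A p)\<bar> < pi" "\<bar>Im (B p)\<bar> < pi"
      using elim abs_Im_le_cmod[of "A p"] abs_Im_le_cmod[of "B p"] by auto
    then have "\<bar>Im (A p) - Im (B p)\<bar> < 2 * pi" by linarith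
    then show ?case using elim(3) by (rule exp_complex_eqI)
  qed
qed

text \<open>Turns the exponents of a factorisation of \<open>g\<close> into coefficients of
  cocycles: both sides tend to 0 at the diagonal and have the exponential
  \<open>g y / g x\<close>.\<close>

lemma eventually_Lam_sum:
  fixes p :: "'i \<Rightarrow> complex"
  assumes X: "compact X" and I: "finite I" and p: "\<And>i. i \<in> I \<Longrightarrow> p i \<notin> X"
    and l: "continuous_on X l"
    and A: "(A \<longlongrightarrow> 0) (diag X)"
    and g: "\<And>z. z \<in> X \<Longrightarrow> g z = (\<Prod>i\<in>I. (z - p i) powi n i) * exp (l z)"
    and gA: "\<forall>\<^sub>F (x, y) in diag X. exp (A (x, y)) = g y / g x"
  shows "\<forall>\<^sub>F (x, y) in diag X. A (x, y) = (\<Sum>i\<in>I. of_int (n i) * Lam (p i) (x, y)) + (l y - l x)"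
proof -
  define B where "B = (\<lambda>q. (\<Sum>i\<in>I. of_int (n i) * Lam (p i) q) + (\<lambda>(x, y). l y - l x) q)"
  have "((\<lambda>q. (\<Sum>i\<in>I. of_int (n i) * Lam (p i) q) + (\<lambda>(x, y). l y - l x) q) \<longlongrightarrow> (\<Sum>i\<in>I. of_int (n i) * 0) + 0) (diag X)"
    by (intro tendsto_intros tendsto_Lam tendsto_diag_diff X l compact_imp_closed p)
  then have B: "(B \<longlongrightarrow> 0) (diag X)" by (simp add: B_def)
  have "\<forall>\<^sub>F q in diag X. exp (B q) = (case q of (x, y) \<Rightarrow> g y / g x)"
  proof (rule eventually_diagI[of 1])
    fix x y assume xy: "x \<in> X" "y \<in> X"
    have ne: "x \<noteq> p i" "y \<noteq> p i" if "i \<in> I" for i using p[OF that] xy by auto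
    have "exp (\<Sum>i\<in>I. of_int (n i) * Lam (p i) (x, y)) = (\<Prod>i\<in>I. ((y - p i) / (x - p i)) powi n i)"
      unfolding exp_sum[OF I] by (rule prod.cong) (auto simp: exp_powi exp_Lam ne)
    also have "\<dots> = (\<Prod>i\<in>I. (y - p i) powi n i) / (\<Prod>i\<in>I. (x - p i) powi n i)"
      by (simp add: power_int_divide_distrib prod_dividef)
    finally show "exp (B (x, y)) = (case (x, y) of (x, y) \<Rightarrow> g y / g x)"
      unfolding B_def by (simp add: exp_add exp_diff g xy)
  qed simp
  with gA have e: "\<forall>\<^sub>F q in diag X. exp (A q) = exp (B q)"
    by eventually_elim (auto simp: case_prod_unfold)
  have "\<forall>\<^sub>F q in diag X. A q = B q" by (rule eventually_eq_of_exp_eq[OF A B e])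
  then show ?thesis by eventually_elim (auto simp: B_def)
qed

text \<open>The function \<open>\<theta>\<close> is arbitrary and not assumed continuous, as befits
  Alexander-Spanier cochains with discrete coefficients.\<close>

definition cob :: "'a::metric_space set \<Rightarrow> ('a \<times> 'a \<Rightarrow> complex) \<Rightarrow> bool" where
  "cob X A \<longleftrightarrow> (\<exists>\<theta>. \<forall>\<^sub>F q in diag X. A q = \<theta> (snd q) - \<theta> (fst q))"

lemma cob_cong:
  assumes "cob X A" "\<forall>\<^sub>F q in diag X. A q = B q"
  shows "cob X B"
proof -
  obtain \<theta> where "\<forall>\<^sub>F q in diag X. A q = \<theta> (snd q) - \<theta> (fst q)" using assms(1) by (auto simp: cob_def)
  then have "\<forall>\<^sub>F q in diag X. B q = \<theta> (snd q) - \<theta> (fst q)" using assms(2) by eventually_elim auto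
  then show ?thesis by (auto simp: cob_def)
qed

lemma cob_zero: "cob X (\<lambda>q. 0)"
  unfolding cob_def by (rule exI[of _ "\<lambda>x. 0"]) simp

lemma cob_diff_function: "cob X (\<lambda>q. \<theta> (snd q) - \<theta> (fst q))"
  unfolding cob_def by (rule exI[of _ \<theta>]) simp

lemma cob_add:
  assumes "cob X A" "cob X B"
  shows "cob X (\<lambda>q. A q + B q)"
proof -
  obtain \<theta> \<eta> where "\<forall>\<^sub>F q in diag X. A q = \<theta> (snd q) - \<theta> (fst q)"
    "\<forall>\<^sub>F q in diag X. B q = \<eta> (snd q) - \<eta> (fst q)" using assms by (auto simp: cob_def)
  then have "\<forall>\<^sub>F q in diag X. A q + B q = (\<theta> (snd q) + \<eta> (snd q)) - (\<theta> (fst q) + \<eta> (fst q))"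
    by eventually_elim auto
  then show ?thesis unfolding cob_def by (intro exI[of _ "\<lambda>x. \<theta> x + \<eta> x"])
qed

lemma cob_cmult:
  assumes "cob X A"
  shows "cob X (\<lambda>q. k * A q)"
proof -
  obtain \<theta> where "\<forall>\<^sub>F q in diag X. A q = \<theta> (snd q) - \<theta> (fst q)" using assms by (auto simp: cob_def)
  then have "\<forall>\<^sub>F q in diag X. k * A q = k * \<theta> (snd q) - k * \<theta> (fst q)"
    by eventually_elim (simp add: right_diff_distrib)
  then show ?thesis unfolding cob_def by (intro exI[of _ "\<lambda>x. k * \<theta> x"])
qed

lemma cob_sum:
  assumes "\<And>i. i \<in> I \<Longrightarrow> cob X (A i)"
  shows "cob X (\<lambda>q. \<Sum>i\<in>I. A i q)"
proof (cases "finite I")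
  case True
  then show ?thesis using assms
    by (induction I rule: finite_induct) (auto intro: cob_add cob_zero)
qed (simp add: cob_zero)

lemma cob_pullback:
  assumes "cob X A" "compact Y" "continuous_on Y \<phi>" "\<phi> ` Y \<subseteq> X"
  shows "cob Y (\<lambda>q. A (\<phi> (fst q), \<phi> (snd q)))"
proof -
  obtain \<theta> where "\<forall>\<^sub>F q in diag X. A q = \<theta> (snd q) - \<theta> (fst q)" using assms by (auto simp: cob_def)
  from eventually_compose_filterlim[OF this filterlim_diag[OF assms(2-4)]]
  have "\<forall>\<^sub>F q in diag Y. A (\<phi> (fst q), \<phi> (snd q)) = \<theta> (\<phi> (snd q)) - \<theta> (\<phi> (fst q))"
    by (simp add: case_prod_unfold)
  then show ?thesis unfolding cob_def by (intro exI[of _ "\<lambda>x. \<theta> (\<phi> x)"])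
qed

text \<open>The local degree in cohomological form: the pull-back takes the class of the puncture
  \<open>\<phi> b\<close> to plus or minus the class of \<open>b\<close>.\<close>

lemma cob_Lam_embedding:
  assumes \<phi>: "continuous_on UNIV \<phi>" "inj \<phi>" and X: "compact X" and \<phi>X: "\<phi> ` X \<subseteq> X" and b: "b \<notin> X" "\<phi> b \<notin> X"
  shows "\<exists>e\<in>{1, -1}. cob X (\<lambda>q. Lam (\<phi> b) (\<phi> (fst q), \<phi> (snd q)) - e * Lam b q)"
proof -
  obtain n l where n: "n \<in> {1, -1}" and l: "continuous_on X l"
      "\<forall>z\<in>X. \<phi> z - \<phi> b = (z - b) powi n * exp (l z)"
    using plane_embedding_logarithm[OF \<phi> X b(1)] by blast
  have \<phi>c: "continuous_on X \<phi>" using continuous_on_subset[OF \<phi>(1)] by simp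
  have "\<forall>\<^sub>F (x, y) in diag X. (\<lambda>q. Lam (\<phi> b) (\<phi> (fst q), \<phi> (snd q))) (x, y) =
      (\<Sum>i\<in>{b}. of_int n * Lam i (x, y)) + (l y - l x)"
  proof (rule eventually_Lam_sum[OF X, where g = "\<lambda>z. \<phi> z - \<phi> b"])
    have "filterlim (\<lambda>q. (\<phi> (fst q), \<phi> (snd q))) (diag X) (diag X)"
      using filterlim_diag[OF X \<phi>c \<phi>X] by (simp add: case_prod_unfold)
    from filterlim_compose[OF tendsto_Lam[OF compact_imp_closed[OF X] b(2)] this]
    show "((\<lambda>q. Lam (\<phi> b) (\<phi> (fst q), \<phi> (snd q))) \<longlongrightarrow> 0) (diag X)" .
    show "\<forall>\<^sub>F (x, y) in diag X. exp (Lam (\<phi> b) (\<phi> (fst (x, y)), \<phi> (snd (x, y)))) = (\<phi> y - \<phi> b) / (\<phi> x - \<phi> b)"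
      by (rule eventually_diagI[of 1]) (use \<phi>X b(2) in \<open>auto intro!: exp_Lam\<close>)
  qed (use b l in auto)
  then have "\<forall>\<^sub>F q in diag X. l (snd q) - l (fst q) =
      Lam (\<phi> b) (\<phi> (fst q), \<phi> (snd q)) - of_int n * Lam b q"
    by eventually_elim auto
  from cob_cong[OF cob_diff_function this]
  have "cob X (\<lambda>q. Lam (\<phi> b) (\<phi> (fst q), \<phi> (snd q)) - of_int n * Lam b q)" .
  then show ?thesis using n by (intro bexI[of _ "of_int n"]) auto
qed

text \<open>\<open>\<phi> z - a\<close> has no zero in the plane, hence a global logarithm. This
  accounts for embeddings that are not onto.\<close>

lemma cob_Lam_omitted:
  assumes \<phi>: "continuous_on UNIV \<phi>" and X: "compact X" and \<phi>X: "\<phi> ` X \<subseteq> X" and a: "a \<notin> range \<phi>" "a \<notin> X"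
  shows "cob X (\<lambda>q. Lam a (\<phi> (fst q), \<phi> (snd q)))"
proof -
  have "continuous_on UNIV (\<lambda>z. \<phi> z - a)" by (intro continuous_intros \<phi>)
  then obtain l where l: "continuous_on UNIV l" "\<And>z. \<phi> z - a = exp (l z)"
    using continuous_logarithm_on_contractible[of UNIV "\<lambda>z. \<phi> z - a"] a(1) convex_imp_contractible[OF convex_UNIV]
    by auto
  have lX: "continuous_on X l" using continuous_on_subset[OF l(1)] by simp
  have \<phi>c: "continuous_on X \<phi>" using continuous_on_subset[OF \<phi>] by simp
  have "\<forall>\<^sub>F (x, y) in diag X. (\<lambda>q. Lam a (\<phi> (fst q), \<phi> (snd q))) (x, y) =
      (\<Sum>i\<in>{}. of_int 0 * Lam i (x, y)) + (l y - l x)"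
  proof (rule eventually_Lam_sum[OF X, where g = "\<lambda>z. \<phi> z - a"])
    have "filterlim (\<lambda>q. (\<phi> (fst q), \<phi> (snd q))) (diag X) (diag X)"
      using filterlim_diag[OF X \<phi>c \<phi>X] by (simp add: case_prod_unfold)
    from filterlim_compose[OF tendsto_Lam[OF compact_imp_closed[OF X] a(2)] this]
    show "((\<lambda>q. Lam a (\<phi> (fst q), \<phi> (snd q))) \<longlongrightarrow> 0) (diag X)" .
    show "\<forall>\<^sub>F (x, y) in diag X. exp (Lam a (\<phi> (fst (x, y)), \<phi> (snd (x, y)))) = (\<phi> y - a) / (\<phi> x - a)"
      by (rule eventually_diagI[of 1]) (use \<phi>X a(2) in \<open>auto intro!: exp_Lam\<close>)
  qed (use l lX in auto)
  then have "\<forall>\<^sub>F q in diag X. l (snd q) - l (fst q) = Lam a (\<phi> (fst q), \<phi> (snd q))"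
    by eventually_elim auto
  from cob_cong[OF cob_diff_function this] show ?thesis .
qed

section \<open>The complex numbers as a rational vector space\<close>

interpretation complex_over_rat: vector_space "\<lambda>(r::rat) (z::complex). of_rat r * z"
  by unfold_locales (auto simp: of_rat_add of_rat_mult algebra_simps)

text \<open>A coordinate functional of a Hamel basis that contains \<open>v\<close>.\<close>

lemma rational_functional_exists:
  fixes v :: complex
  assumes "v \<noteq> 0"
  obtains q :: "complex \<Rightarrow> rat"
  where "\<And>u w. q (u + w) = q u + q w" "\<And>r u. q (of_rat r * u) = r * q u" "q v = 1"
proof -
  let ?B = "complex_over_rat.extend_basis {v}"
  have ind: "\<not> complex_over_rat.dependent {v}"
    using assms complex_over_rat.independent_insertI[of v "{}"] complex_over_rat.independent_empty by simp
  have B: "\<not> complex_over_rat.dependent ?B" by (rule complex_over_rat.independent_extend_basis[OF ind])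
  have sp: "z \<in> complex_over_rat.span ?B" for z using complex_over_rat.span_extend_basis[OF ind] by simp
  have vB: "v \<in> ?B" using complex_over_rat.extend_basis_superset[OF ind] by simp
  let ?q = "\<lambda>z. complex_over_rat.representation ?B z v"
  have "?q (u + w) = ?q u + ?q w" for u w
    by (simp add: complex_over_rat.representation_add[OF B sp sp])
  moreover have "?q (of_rat r * u) = r * ?q u" for r u
    by (simp add: complex_over_rat.representation_scale[OF B sp])
  moreover have "?q v = 1" by (simp add: complex_over_rat.representation_basis[OF B vB])
  ultimately show ?thesis by (rule that)
qed

lemma common_denominator:
  fixes T :: "rat set"
  assumes "finite T"
  shows "\<exists>N::int. N > 0 \<and> (\<forall>t\<in>T. \<exists>m::int. of_int N * t = of_int m)"
  using assms
proof (induction T rule: finite_induct)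
  case empty
  then show ?case by (intro exI[of _ 1]) simp
next
  case (insert t T)
  then obtain N :: int where N: "N > 0" "\<forall>t\<in>T. \<exists>m::int. of_int N * t = of_int m" by blast
  obtain a b where ab: "t = Rat.Fract a b" "b > 0" by (cases t rule: Rat.Rat_cases) auto
  have "of_int (N * b) * t = of_int (N * a)"
    using ab by (simp add: Rat.Fract_of_int_quotient)
  then have "\<exists>m::int. of_int (N * b) * t = of_int m" by blast
  moreover have "\<exists>m::int. of_int (N * b) * s = of_int m" if "s \<in> T" for s
  proof -
    obtain m :: int where "of_int N * s = of_int m" using N(2) \<open>s \<in> T\<close> by blast
    then have "of_int (N * b) * s = of_int (b * m)" by (simp add: mult.commute mult.left_commute)
    then show ?thesis by blast
  qed
  moreover have "N * b > 0" using N(1) ab(2) by simp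
  ultimately show ?case by (metis insert_iff)
qed

text \<open>Coordinates in a rational basis chosen from \<open>S\<close>, multiplied by a common
  denominator, are integers and respect sums inside \<open>S\<close>. Applied to the values of a
  cocycle, this splits it into integer-valued cocycles.\<close>

lemma integral_coordinates:
  fixes S :: "complex set"
  assumes S: "finite S"
  shows "\<exists>(B :: complex set) (\<beta> :: complex \<Rightarrow> complex) (\<nu> :: complex \<Rightarrow> complex \<Rightarrow> int). finite B \<and>
    (\<forall>s\<in>S. s = (\<Sum>b\<in>B. of_int (\<nu> b s) * \<beta> b)) \<and>
    (\<forall>s\<in>S. \<forall>t\<in>S. \<forall>u\<in>S. \<forall>b\<in>B. s = t + u \<longrightarrow> \<nu> b s = \<nu> b t + \<nu> b u)"
proof -
  obtain B where B: "B \<subseteq> S" "\<not> complex_over_rat.dependent B" "S \<subseteq> complex_over_rat.span B"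
    using complex_over_rat.maximal_independent_subset[of S] by blast
  have finB: "finite B" using B(1) S finite_subset by blast
  define r where "r b s = complex_over_rat.representation B s b" for b s
  obtain N :: int where N: "N > 0" "\<And>s b. s \<in> S \<Longrightarrow> b \<in> B \<Longrightarrow> \<exists>m::int. of_int N * r b s = of_int m"
    using common_denominator[of "(\<lambda>(s, b). r b s) ` (S \<times> B)"] S finB by auto
  define \<nu> where "\<nu> b s = (SOME m. of_int N * r b s = rat_of_int m)" for b s
  have \<nu>: "of_int N * r b s = of_int (\<nu> b s)" if "s \<in> S" "b \<in> B" for s b
    unfolding \<nu>_def using N(2)[OF that] by (rule someI_ex)
  have \<nu>c: "of_int (\<nu> b s) = of_int N * (of_rat (r b s) :: complex)" if "s \<in> S" "b \<in> B" for s b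
    using arg_cong[OF \<nu>[OF that], of "of_rat :: rat \<Rightarrow> complex"] by (simp add: of_rat_mult)
  have "s = (\<Sum>b\<in>B. of_int (\<nu> b s) * (b / of_int N))" if s: "s \<in> S" for s
  proof -
    have "s \<in> complex_over_rat.span B" using s B(3) by blast
    then have "(\<Sum>b\<in>B. of_rat (r b s) * b) = s"
      unfolding r_def by (rule complex_over_rat.sum_representation_eq[OF B(2) _ finB order_refl])
    moreover have "(\<Sum>b\<in>B. of_int (\<nu> b s) * (b / of_int N)) = (\<Sum>b\<in>B. of_rat (r b s) * b)"
      by (rule sum.cong) (use N(1) \<nu>c[OF s] in auto)
    ultimately show ?thesis by simp
  qed
  moreover have "\<nu> b s = \<nu> b t + \<nu> b u" if a: "s \<in> S" "t \<in> S" "u \<in> S" "s = t + u" "b \<in> B" for s t u b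
  proof -
    have "r b s = r b t + r b u"
      unfolding r_def a(4) using a B(3) by (subst complex_over_rat.representation_add[OF B(2)]) auto
    then have "rat_of_int (\<nu> b s) = of_int (\<nu> b t + \<nu> b u)"
      using \<nu>[OF a(1,5)] \<nu>[OF a(2,5)] \<nu>[OF a(3,5)] by (simp add: distrib_left)
    then show ?thesis by (simp only: of_int_eq_iff)
  qed
  ultimately show ?thesis using finB
    by (intro exI[of _ B] exI[of _ "\<lambda>b. b / of_int N"] exI[of _ \<nu>] conjI ballI impI)
qed

section \<open>Independence of the logarithmic classes\<close>

lemma continuous_on_of_tendsto_diag:
  fixes l :: "'a::metric_space \<Rightarrow> 'b::real_normed_vector"
  assumes "((\<lambda>q. l (snd q) - l (fst q)) \<longlongrightarrow> 0) (diag X)"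
  shows "continuous_on X l"
  unfolding continuous_on_iff
proof (intro ballI allI impI)
  fix x and e :: real assume x: "x \<in> X" "e > 0"
  then obtain d where d: "d > 0" "\<forall>x\<in>X. \<forall>y\<in>X. dist x y < d \<longrightarrow> norm (l y - l x) < e"
    using assms unfolding tendsto_diag_iff by auto
  show "\<exists>d>0. \<forall>x'\<in>X. dist x' x < d \<longrightarrow> dist (l x') (l x) < e"
    using d x by (intro exI[of _ d]) (auto simp: dist_norm[of "l _"] dist_commute)
qed

lemma cob_Lam_independent_int:
  fixes p :: "'i \<Rightarrow> complex" and m :: "'i \<Rightarrow> int"
  assumes X: "compact X" and I: "finite I" and p: "\<And>i. i \<in> I \<Longrightarrow> p i \<notin> X"
    and H: "H \<in> components (- X)" "bounded H"
    and c: "cob X (\<lambda>q. \<Sum>i\<in>I. of_int (m i) * Lam (p i) q)"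
  shows "(\<Sum>i | i \<in> I \<and> p i \<in> H. m i) = 0"
proof -
  obtain \<theta> where \<theta>: "\<forall>\<^sub>F q in diag X. (\<Sum>i\<in>I. of_int (m i) * Lam (p i) q) = \<theta> (snd q) - \<theta> (fst q)"
    using c by (auto simp: cob_def)
  have "((\<lambda>q. \<Sum>i\<in>I. of_int (m i) * Lam (p i) q) \<longlongrightarrow> (\<Sum>i\<in>I. of_int (m i) * 0)) (diag X)"
    by (intro tendsto_intros tendsto_Lam compact_imp_closed X p)
  then have "((\<lambda>q. \<Sum>i\<in>I. of_int (m i) * Lam (p i) q) \<longlongrightarrow> 0) (diag X)" by simp
  from Lim_transform_eventually[OF this \<theta>]
  have \<theta>0: "((\<lambda>q. \<theta> (snd q) - \<theta> (fst q)) \<longlongrightarrow> 0) (diag X)" .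
  define P where "P z = (\<Prod>i\<in>I. (z - p i) powi m i)" for z
  have Pnz: "P z \<noteq> 0" if "z \<in> X" for z using p that I by (auto simp: P_def power_int_eq_0_iff)
  \<comment> \<open>Nearby increments of \<open>\<theta>\<close> are logarithms of ratios of
    \<open>P\<close>, so \<open>\<kappa>\<close> takes equal values at nearby points. Adding
    \<open>Ln (\<kappa> z)\<close> leaves small increments unchanged and turns
    \<open>\<theta>\<close> into a continuous logarithm of \<open>P\<close>.\<close>
  define \<kappa> where "\<kappa> z = P z * exp (- \<theta> z)" for z
  have "\<forall>\<^sub>F q in diag X. fst q \<in> X \<and> snd q \<in> X" by (rule eventually_diagI[of 1]) auto
  with \<theta> have "\<forall>\<^sub>F q in diag X. \<theta> (snd q) - \<theta> (fst q) = (\<theta> (snd q) + Ln (\<kappa> (snd q))) - (\<theta> (fst q) + Ln (\<kappa> (fst q)))"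
  proof eventually_elim
    case (elim q)
    obtain x y where q: "q = (x, y)" by (cases q)
    have xy: "x \<in> X" "y \<in> X" using elim q by auto
    have ne: "x \<noteq> p i" "y \<noteq> p i" if "i \<in> I" for i using p[OF that] xy by auto
    have "exp (\<theta> y - \<theta> x) = exp (\<Sum>i\<in>I. of_int (m i) * Lam (p i) (x, y))" using elim by (simp add: q)
    also have "\<dots> = (\<Prod>i\<in>I. ((y - p i) / (x - p i)) powi m i)"
      unfolding exp_sum[OF I] by (rule prod.cong) (auto simp: exp_powi exp_Lam ne)
    also have "\<dots> = P y / P x" by (simp add: power_int_divide_distrib prod_dividef P_def)
    finally have "\<kappa> y = \<kappa> x" using Pnz[OF xy(1)]
      by (simp add: \<kappa>_def exp_diff exp_minus field_simps)
    then show ?case by (simp add: q)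
  qed
  from Lim_transform_eventually[OF \<theta>0 this]
  have "((\<lambda>q. (\<theta> (snd q) + Ln (\<kappa> (snd q))) - (\<theta> (fst q) + Ln (\<kappa> (fst q)))) \<longlongrightarrow> 0) (diag X)" .
  then have lc: "continuous_on X (\<lambda>z. \<theta> z + Ln (\<kappa> z))" by (rule continuous_on_of_tendsto_diag)
  show ?thesis
  proof (rule sum_windings_zero[OF X I p H lc])
    fix z assume "z \<in> X"
    then have "\<kappa> z \<noteq> 0" using Pnz by (simp add: \<kappa>_def)
    then show "(\<Prod>i\<in>I. (z - p i) powi m i) = exp (\<theta> z + Ln (\<kappa> z))"
      by (simp add: exp_add \<kappa>_def P_def exp_minus)
  qed
qed

text \<open>A functional that is linear over the rationals only cannot be applied to the functions
  \<open>Lam (p i)\<close>. It is applied to coefficients of integers: \<open>Lam\<close> is an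
  increment of the principal logarithm plus \<open>2 * pi * \<i>\<close> times an integer. The
  resulting relation is rational with sum 1 over the hole; clearing denominators contradicts the
  integral case.\<close>

lemma cob_Lam_independent:
  fixes p :: "'i \<Rightarrow> complex" and \<tau> :: "'i \<Rightarrow> complex"
  assumes X: "compact X" and I: "finite I" and p: "\<And>i. i \<in> I \<Longrightarrow> p i \<notin> X"
    and H: "H \<in> components (- X)" "bounded H"
    and c: "cob X (\<lambda>q. \<Sum>i\<in>I. \<tau> i * Lam (p i) q)"
  shows "(\<Sum>i | i \<in> I \<and> p i \<in> H. \<tau> i) = 0"
proof (rule ccontr)
  assume nz: "(\<Sum>i | i \<in> I \<and> p i \<in> H. \<tau> i) \<noteq> 0"
  obtain q where q: "\<And>u w. q (u + w) = q u + q w" "\<And>r u. q (of_rat r * u) = r * q u"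
    "q (\<Sum>i | i \<in> I \<and> p i \<in> H. \<tau> i) = 1"
    by (rule rational_functional_exists[OF nz]) (rule that)
  have q0: "q 0 = 0" using q(1)[of 0 0] by simp
  have qsum: "q (sum f J) = (\<Sum>j\<in>J. q (f j))" if "finite J" for f and J :: "'i set"
    using that by (induction J rule: finite_induct) (auto simp: q q0)
  have qdiff: "q (u - w) = q u - q w" for u w using q(1)[of "u - w" w] by simp
  have qint: "q (of_int n * u) = of_int n * q u" for n u
    using q(2)[of "of_int n" u] by simp
  obtain \<theta> where \<theta>: "\<forall>\<^sub>F r in diag X. (\<Sum>i\<in>I. \<tau> i * Lam (p i) r) = \<theta> (snd r) - \<theta> (fst r)"
    using c by (auto simp: cob_def)
  \<comment> \<open>A potential for the integer part: its increments near the diagonal are sums of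
    integer multiples of the \<open>\<tau> i\<close>, so \<open>q\<close> can be applied.
    \<open>\<eta>\<close> then restores the principal logarithms.\<close>
  define \<theta>' where "\<theta>' x = (\<theta> x - (\<Sum>i\<in>I. \<tau> i * Ln (x - p i))) / (2 * pi * \<i>)" for x
  define \<eta> where "\<eta> x = (\<Sum>i\<in>I. of_rat (q (\<tau> i)) * Ln (x - p i)) + 2 * pi * \<i> * of_rat (q (\<theta>' x))" for x
  have "\<forall>\<^sub>F r in diag X. fst r \<in> X \<and> snd r \<in> X" by (rule eventually_diagI[of 1]) auto
  with \<theta> have "\<forall>\<^sub>F r in diag X. \<eta> (snd r) - \<eta> (fst r) = (\<Sum>i\<in>I. of_rat (q (\<tau> i)) * Lam (p i) r)"
  proof eventually_elim
    case (elim r)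
    obtain x y where r: "r = (x, y)" by (cases r)
    have xy: "x \<in> X" "y \<in> X" using elim r by auto
    have "\<exists>n::int. Lam (p i) (x, y) = Ln (y - p i) - Ln (x - p i) + 2 * pi * \<i> * of_int n" if "i \<in> I" for i
    proof -
      have ne: "x \<noteq> p i" "y \<noteq> p i" using p[OF that] xy by auto
      then have "exp (Lam (p i) (x, y)) = exp (Ln (y - p i) - Ln (x - p i))"
        by (simp add: exp_Lam exp_diff)
      then obtain n :: int where "Lam (p i) (x, y) = Ln (y - p i) - Ln (x - p i) + complex_of_real (of_int (2 * n) * pi) * \<i>"
        unfolding exp_eq by blast
      then show ?thesis by (intro exI[of _ n]) (simp add: mult.commute mult.left_commute)
    qed
    then obtain n :: "'i \<Rightarrow> int" where n:
      "\<And>i. i \<in> I \<Longrightarrow> Lam (p i) (x, y) = Ln (y - p i) - Ln (x - p i) + 2 * pi * \<i> * of_int (n i)"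
      by metis
    have sumLam: "(\<Sum>i\<in>I. a i * Lam (p i) (x, y)) =
        (\<Sum>i\<in>I. a i * Ln (y - p i)) - (\<Sum>i\<in>I. a i * Ln (x - p i)) + 2 * pi * \<i> * (\<Sum>i\<in>I. of_int (n i) * a i)"
      for a :: "'i \<Rightarrow> complex"
    proof -
      have "(\<Sum>i\<in>I. a i * Lam (p i) (x, y)) =
          (\<Sum>i\<in>I. a i * Ln (y - p i) - a i * Ln (x - p i) + 2 * pi * \<i> * (of_int (n i) * a i))"
        by (rule sum.cong) (auto simp: n algebra_simps)
      then show ?thesis by (simp add: sum.distrib sum_subtractf sum_distrib_left)
    qed
    have "\<theta> y - \<theta> x = (\<Sum>i\<in>I. \<tau> i * Lam (p i) (x, y))" using elim(1) r by simp
    then have "2 * pi * \<i> * (\<Sum>i\<in>I. of_int (n i) * \<tau> i) =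
        (\<theta> y - (\<Sum>i\<in>I. \<tau> i * Ln (y - p i))) - (\<theta> x - (\<Sum>i\<in>I. \<tau> i * Ln (x - p i)))"
      unfolding sumLam by (simp add: algebra_simps)
    then have "\<theta>' y - \<theta>' x = (\<Sum>i\<in>I. of_int (n i) * \<tau> i)"
      unfolding \<theta>'_def diff_divide_distrib[symmetric] by (simp add: eq_divide_eq[symmetric] divide_eq_eq mult.commute)
    then have "q (\<theta>' y) - q (\<theta>' x) = (\<Sum>i\<in>I. of_int (n i) * q (\<tau> i))"
      by (simp only: qdiff[symmetric] qsum[OF I] qint)
    then have "of_rat (q (\<theta>' y)) - of_rat (q (\<theta>' x)) = (\<Sum>i\<in>I. of_int (n i) * (of_rat (q (\<tau> i)) :: complex))"
      by (simp add: of_rat_diff[symmetric] of_rat_sum of_rat_mult)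
    then show ?case
      unfolding r \<eta>_def fst_conv snd_conv sumLam by (simp add: algebra_simps)
  qed
  from cob_cong[OF cob_diff_function this]
  have cq: "cob X (\<lambda>r. \<Sum>i\<in>I. of_rat (q (\<tau> i)) * Lam (p i) r)" .
  obtain N :: int where N: "N > 0" "\<forall>t\<in>(\<lambda>i. q (\<tau> i)) ` I. \<exists>m::int. of_int N * t = of_int m"
    using common_denominator[of "(\<lambda>i. q (\<tau> i)) ` I"] I by blast
  then have "\<forall>i\<in>I. \<exists>m::int. of_int N * q (\<tau> i) = of_int m" by simp
  then obtain m :: "'i \<Rightarrow> int" where m: "\<And>i. i \<in> I \<Longrightarrow> of_int N * q (\<tau> i) = of_int (m i)" by metis
  have mc: "of_int (m i) = of_int N * (of_rat (q (\<tau> i)) :: complex)" if "i \<in> I" for i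
    using arg_cong[OF m[OF that], of "of_rat :: rat \<Rightarrow> complex"] by (simp add: of_rat_mult)
  have "cob X (\<lambda>r. of_int N * (\<Sum>i\<in>I. of_rat (q (\<tau> i)) * Lam (p i) r))" by (rule cob_cmult[OF cq])
  moreover have "of_int N * (\<Sum>i\<in>I. of_rat (q (\<tau> i)) * Lam (p i) r) = (\<Sum>i\<in>I. of_int (m i) * Lam (p i) r)" for r
    unfolding sum_distrib_left by (rule sum.cong) (auto simp: mc mult.assoc)
  ultimately have "cob X (\<lambda>r. \<Sum>i\<in>I. of_int (m i) * Lam (p i) r)" by simp
  from cob_Lam_independent_int[OF X I p H this]
  have "(\<Sum>i | i \<in> I \<and> p i \<in> H. m i) = 0" .
  moreover have "rat_of_int (\<Sum>i | i \<in> I \<and> p i \<in> H. m i) = of_int N * (\<Sum>i | i \<in> I \<and> p i \<in> H. q (\<tau> i))"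
    unfolding of_int_sum sum_distrib_left by (rule sum.cong) (auto simp: m)
  ultimately have "(\<Sum>i | i \<in> I \<and> p i \<in> H. q (\<tau> i)) = 0" using N(1) by simp
  then show False using q(3) qsum[of "{i \<in> I. p i \<in> H}" \<tau>] I by simp
qed

section \<open>Representation of cocycles by logarithmic classes\<close>

definition log_rep :: "complex set \<Rightarrow> complex set \<Rightarrow> (complex \<times> complex \<Rightarrow> complex) \<Rightarrow> bool" where
  "log_rep X L A \<longleftrightarrow> (\<exists>K \<kappa>. finite K \<and> K \<subseteq> L \<and> K \<inter> X = {} \<and>
     cob X (\<lambda>q. A q - (\<Sum>a\<in>K. \<kappa> a * Lam a q)))"

lemma log_rep_zero: "log_rep X L (\<lambda>q. 0)"
  unfolding log_rep_def by (rule exI[of _ "{}"]) (simp add: cob_zero)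

lemma log_rep_add:
  assumes "log_rep X L A" "log_rep X L B"
  shows "log_rep X L (\<lambda>q. A q + B q)"
proof -
  obtain K \<kappa> where K: "finite K" "K \<subseteq> L" "K \<inter> X = {}" "cob X (\<lambda>q. A q - (\<Sum>a\<in>K. \<kappa> a * Lam a q))"
    using assms(1) by (auto simp: log_rep_def)
  obtain K' \<kappa>' where K': "finite K'" "K' \<subseteq> L" "K' \<inter> X = {}" "cob X (\<lambda>q. B q - (\<Sum>a\<in>K'. \<kappa>' a * Lam a q))"
    using assms(2) by (auto simp: log_rep_def)
  define \<sigma> where "\<sigma> a = (if a \<in> K then \<kappa> a else 0) + (if a \<in> K' then \<kappa>' a else 0)" for a
  have ext: "(\<Sum>a\<in>J. f a * Lam a q) = (\<Sum>a\<in>K \<union> K'. (if a \<in> J then f a else 0) * Lam a q)"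
    if "J \<subseteq> K \<union> K'" for J f q
  proof -
    have "(\<Sum>a\<in>K \<union> K'. (if a \<in> J then f a else 0) * Lam a q) = (\<Sum>a\<in>K \<union> K'. if a \<in> J then f a * Lam a q else 0)"
      by (rule sum.cong) auto
    also have "\<dots> = (\<Sum>a\<in>(K \<union> K') \<inter> J. f a * Lam a q)"
      using K(1) K'(1) by (simp add: sum.inter_restrict)
    also have "(K \<union> K') \<inter> J = J" using that by blast
    finally show ?thesis by simp
  qed
  have "A q + B q - (\<Sum>a\<in>K \<union> K'. \<sigma> a * Lam a q) =
      (A q - (\<Sum>a\<in>K. \<kappa> a * Lam a q)) + (B q - (\<Sum>a\<in>K'. \<kappa>' a * Lam a q))" for q
    unfolding ext[OF Un_upper1] ext[OF Un_upper2] \<sigma>_def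
    by (simp add: distrib_right sum.distrib)
  then have "cob X (\<lambda>q. A q + B q - (\<Sum>a\<in>K \<union> K'. \<sigma> a * Lam a q))"
    using cob_add[OF K(4) K'(4)] by (simp only:)
  then show ?thesis unfolding log_rep_def
    using K K' by (intro exI[of _ "K \<union> K'"] exI[of _ \<sigma>]) auto
qed

lemma log_rep_cmult:
  assumes "log_rep X L A"
  shows "log_rep X L (\<lambda>q. k * A q)"
proof -
  obtain K \<kappa> where K: "finite K" "K \<subseteq> L" "K \<inter> X = {}" "cob X (\<lambda>q. A q - (\<Sum>a\<in>K. \<kappa> a * Lam a q))"
    using assms(1) by (auto simp: log_rep_def)
  have "k * A q - (\<Sum>a\<in>K. (k * \<kappa> a) * Lam a q) = k * (A q - (\<Sum>a\<in>K. \<kappa> a * Lam a q))" for q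
    by (simp add: right_diff_distrib sum_distrib_left mult.assoc)
  then have "cob X (\<lambda>q. k * A q - (\<Sum>a\<in>K. (k * \<kappa> a) * Lam a q))"
    using cob_cmult[OF K(4), of k] by (simp only:)
  then show ?thesis unfolding log_rep_def using K(1-3) by (intro exI[of _ K] exI[of _ "\<lambda>a. k * \<kappa> a"]) auto
qed

lemma log_rep_sum:
  assumes "\<And>i. i \<in> I \<Longrightarrow> log_rep X L (A i)"
  shows "log_rep X L (\<lambda>q. \<Sum>i\<in>I. A i q)"
proof (cases "finite I")
  case True
  then show ?thesis using assms
    by (induction I rule: finite_induct) (auto intro: log_rep_add log_rep_zero)
qed (simp add: log_rep_zero)

lemma log_rep_cong:
  assumes "log_rep X L A" "\<forall>\<^sub>F q in diag X. A q = B q"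
  shows "log_rep X L B"
proof -
  obtain K \<kappa> where K: "finite K" "K \<subseteq> L" "K \<inter> X = {}" "cob X (\<lambda>q. A q - (\<Sum>a\<in>K. \<kappa> a * Lam a q))"
    using assms(1) by (auto simp: log_rep_def)
  have "\<forall>\<^sub>F q in diag X. A q - (\<Sum>a\<in>K. \<kappa> a * Lam a q) = B q - (\<Sum>a\<in>K. \<kappa> a * Lam a q)"
    using assms(2) by eventually_elim simp
  from cob_cong[OF K(4) this] show ?thesis unfolding log_rep_def using K(1-3) by blast
qed

text \<open>The correspondence between integral classes of degree one and maps to the circle.
  Averaging \<open>\<nu> (j, x)\<close> over a partition of unity gives a real function
  \<open>t\<close> whose increments are nearly the integers \<open>\<nu>\<close>, with an error
  controlled by \<open>M\<close>. So \<open>exp (2 * pi * \<i> * t)\<close> is continuous even where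
  \<open>t\<close> jumps, and its factorisation by punctures gives the representation.\<close>

lemma log_rep_integer_cocycle:
  fixes \<nu> :: "complex \<times> complex \<Rightarrow> int"
  assumes X: "compact X" and L: "\<And>C. \<lbrakk>C \<in> components (- X); bounded C\<rbrakk> \<Longrightarrow> C \<inter> L \<noteq> {}"
    and \<delta>: "\<delta> > 0"
    and cocycle: "\<And>x y z. \<lbrakk>x \<in> X; y \<in> X; z \<in> X; dist x y < \<delta>; dist x z < \<delta>; dist y z < \<delta>\<rbrakk> \<Longrightarrow>
      \<nu> (x, z) = \<nu> (x, y) + \<nu> (y, z)"
    and M: "\<And>x y. x \<in> X \<Longrightarrow> y \<in> X \<Longrightarrow> \<bar>\<nu> (x, y)\<bar> \<le> M"
  shows "log_rep X L (\<lambda>q. of_int (\<nu> q))"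
proof -
  \<comment> \<open>If \<open>j\<close> is within \<open>\<epsilon>\<close> of \<open>y\<close> and
    \<open>y\<close> within \<open>\<epsilon>\<close> of \<open>x\<close>, all three distances are
    below \<open>\<delta>\<close> and the cocycle identity applies.\<close>
  define \<epsilon> where "\<epsilon> = \<delta> / 2"
  have \<epsilon>: "\<epsilon> > 0" "\<epsilon> + \<epsilon> = \<delta>" using \<delta> by (auto simp: \<epsilon>_def)
  obtain J where J: "finite J" "J \<subseteq> X" "X \<subseteq> (\<Union>j\<in>J. ball j \<epsilon>)"
    using compactE_image[OF X, of X "\<lambda>j. ball j \<epsilon>"] \<epsilon>(1) by (metis UN_I centre_in_ball open_ball subsetI)
  define w where "w j x = max 0 (\<epsilon> - dist j x)" for j x :: complex
  define W where "W x = (\<Sum>j\<in>J. w j x)" for x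
  define \<rho> where "\<rho> j x = w j x / W x" for j x
  have w0: "w j x \<ge> 0" for j x by (simp add: w_def)
  have Wpos: "W x > 0" if x: "x \<in> X" for x
  proof -
    obtain j where j: "j \<in> J" "dist j x < \<epsilon>" using x J(3) by auto
    have "w j x > 0" using j by (simp add: w_def)
    then show ?thesis unfolding W_def by (rule sum_pos2[OF J(1) j(1)]) (rule w0)
  qed
  have wc: "continuous_on X (w j)" for j unfolding w_def by (intro continuous_intros)
  have \<rho>c: "continuous_on X (\<rho> j)" for j
    unfolding \<rho>_def W_def
    by (intro continuous_intros wc) (use Wpos in \<open>force simp: W_def\<close>)
  have \<rho>1: "(\<Sum>j\<in>J. \<rho> j x) = 1" if "x \<in> X" for x
    using Wpos[OF that] by (simp add: \<rho>_def sum_divide_distrib[symmetric] W_def[symmetric])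
  have \<rho>d: "dist j x < \<epsilon>" if "\<rho> j x \<noteq> 0" for j x
    using that by (auto simp: \<rho>_def w_def max_def split: if_splits)
  define t where "t x = (\<Sum>j\<in>J. \<rho> j x * of_int (\<nu> (j, x)))" for x
  \<comment> \<open>After subtracting \<open>\<nu> (x, y)\<close>, the value at \<open>y\<close>
    averages the same integers \<open>\<nu> (j, x)\<close> as the value at \<open>x\<close>; only
    the continuous weights differ.\<close>
  have tu: "t y - of_int (\<nu> (x, y)) = (\<Sum>j\<in>J. \<rho> j y * of_int (\<nu> (j, x)))"
    if xy: "x \<in> X" "y \<in> X" "dist x y < \<epsilon>" for x y
  proof -
    have "\<rho> j y * of_int (\<nu> (j, y)) = \<rho> j y * of_int (\<nu> (j, x)) + \<rho> j y * of_int (\<nu> (x, y))" if "j \<in> J" for j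
    proof (cases "\<rho> j y = 0")
      case False
      note jy = \<rho>d[OF this]
      have "dist j x \<le> dist j y + dist x y" by (metis dist_commute dist_triangle)
      then have "dist j x < \<delta>" using jy xy(3) \<epsilon> by linarith
      moreover have "dist j y < \<delta>" "dist x y < \<delta>" using jy xy(3) \<epsilon> by linarith+
      ultimately have "\<nu> (j, y) = \<nu> (j, x) + \<nu> (x, y)"
        using that J(2) xy by (intro cocycle) auto
      then show ?thesis by (simp add: distrib_left)
    qed simp
    then have "t y = (\<Sum>j\<in>J. \<rho> j y * of_int (\<nu> (j, x)) + \<rho> j y * of_int (\<nu> (x, y)))"
      unfolding t_def by (intro sum.cong) auto
    also have "\<dots> = (\<Sum>j\<in>J. \<rho> j y * of_int (\<nu> (j, x))) + of_int (\<nu> (x, y))"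
      using \<rho>1[OF xy(2)] by (simp add: sum.distrib sum_distrib_right[symmetric])
    finally show ?thesis by simp
  qed
  define A where "A q = t (snd q) - t (fst q) - of_int (\<nu> q)" for q
  have A0: "(A \<longlongrightarrow> 0) (diag X)"
  proof (rule Lim_null_comparison)
    have "((\<lambda>q. \<Sum>j\<in>J. norm (\<rho> j (snd q) - \<rho> j (fst q)) * of_int M) \<longlongrightarrow> (\<Sum>j\<in>J. norm (0::real) * of_int M)) (diag X)"
      using tendsto_diag_diff[OF X \<rho>c] by (intro tendsto_intros) (simp add: case_prod_unfold)
    then show "((\<lambda>q. \<Sum>j\<in>J. norm (\<rho> j (snd q) - \<rho> j (fst q)) * of_int M) \<longlongrightarrow> 0) (diag X)" by simp
    show "\<forall>\<^sub>F q in diag X. norm (A q) \<le> (\<Sum>j\<in>J. norm (\<rho> j (snd q) - \<rho> j (fst q)) * of_int M)"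
    proof (rule eventually_diagI[OF \<epsilon>(1)])
      fix x y assume xy: "x \<in> X" "y \<in> X" "dist x y < \<epsilon>"
      have "\<nu> (x, x) = 0" using cocycle[of x x x] xy \<delta> by simp
      then have "t x = (\<Sum>j\<in>J. \<rho> j x * of_int (\<nu> (j, x)))" using tu[of x x] xy \<epsilon> by simp
      then have "A (x, y) = (\<Sum>j\<in>J. (\<rho> j y - \<rho> j x) * of_int (\<nu> (j, x)))"
        using tu[OF xy] by (simp add: A_def left_diff_distrib sum_subtractf)
      also have "norm \<dots> \<le> (\<Sum>j\<in>J. norm ((\<rho> j y - \<rho> j x) * of_int (\<nu> (j, x))))" by (rule norm_sum)
      also have "\<dots> \<le> (\<Sum>j\<in>J. norm (\<rho> j y - \<rho> j x) * of_int M)"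
      proof (rule sum_mono)
        fix j assume "j \<in> J"
        then have "\<bar>\<nu> (j, x)\<bar> \<le> M" using J(2) xy by (intro M) auto
        then have "norm (real_of_int (\<nu> (j, x))) \<le> of_int M" by (metis norm_of_int of_int_abs of_int_le_iff)
        then show "norm ((\<rho> j y - \<rho> j x) * of_int (\<nu> (j, x))) \<le> norm (\<rho> j y - \<rho> j x) * of_int M"
          unfolding norm_mult by (rule mult_left_mono) simp
      qed
      finally show "norm (A (x, y)) \<le> (\<Sum>j\<in>J. norm (\<rho> j (snd (x, y)) - \<rho> j (fst (x, y))) * of_int M)" by simp
    qed
  qed
  define A' where "A' q = 2 * pi * \<i> * complex_of_real (A q)" for q
  have "((\<lambda>q. 2 * pi * \<i> * complex_of_real (A q)) \<longlongrightarrow> 2 * pi * \<i> * complex_of_real 0) (diag X)"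
    by (intro tendsto_intros A0)
  then have A'0: "(A' \<longlongrightarrow> 0) (diag X)" unfolding A'_def by simp
  define g where "g x = exp (2 * pi * \<i> * complex_of_real (t x))" for x
  have gA: "exp (A' q) = g (snd q) / g (fst q)" for q
  proof -
    have "exp (2 * pi * \<i> * of_int (\<nu> q)) = 1"
      using exp_integer_2pi[of "of_int (\<nu> q)"] by (simp add: mult.commute mult.left_commute)
    then show ?thesis by (simp add: A'_def A_def g_def right_diff_distrib exp_diff)
  qed
  have gc: "continuous_on X g"
  proof (rule continuous_on_of_tendsto_diag)
    have "((\<lambda>q. exp (A' q)) \<longlongrightarrow> exp 0) (diag X)" by (intro tendsto_intros A'0)
    then have "((\<lambda>q. norm (exp (A' q) - 1)) \<longlongrightarrow> 0) (diag X)"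
      by (simp add: LIM_zero tendsto_norm_zero)
    moreover have "norm (g (snd q) - g (fst q)) = norm (exp (A' q) - 1)" for q
    proof -
      have "g (snd q) - g (fst q) = g (fst q) * (exp (A' q) - 1)"
        unfolding gA by (simp add: right_diff_distrib) (simp add: g_def)
      moreover have "norm (g (fst q)) = 1" by (simp add: g_def)
      ultimately show ?thesis by (simp add: norm_mult)
    qed
    ultimately show "((\<lambda>q. g (snd q) - g (fst q)) \<longlongrightarrow> 0) (diag X)"
      by (simp add: tendsto_norm_zero_iff[of "\<lambda>q. g (snd q) - g (fst q)", symmetric])
  qed
  have "\<exists>K n l. finite K \<and> K \<subseteq> L \<and> K \<inter> X = {} \<and> continuous_on X l \<and>
    (\<forall>z\<in>X. g z = (\<Prod>a\<in>K. (z - a) powi n a) * exp (l z))"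
    by (rule circle_valued_map_logarithm[OF X gc _ L]) (simp_all add: g_def)
  then obtain K n l where K: "finite K" "K \<subseteq> L" "K \<inter> X = {}" and l: "continuous_on X l"
    and gz: "\<forall>z\<in>X. g z = (\<Prod>a\<in>K. (z - a) powi n a) * exp (l z)"
    by (elim exE conjE) (rule that)
  have "\<forall>\<^sub>F (x, y) in diag X. A' (x, y) = (\<Sum>a\<in>K. of_int (n a) * Lam a (x, y)) + (l y - l x)"
  proof (rule eventually_Lam_sum[OF X K(1) _ l A'0, where g = g])
    show "\<And>a. a \<in> K \<Longrightarrow> a \<notin> X" using K(3) by blast
    show "\<And>z. z \<in> X \<Longrightarrow> g z = (\<Prod>a\<in>K. (z - a) powi n a) * exp (l z)" using gz by blast
    show "\<forall>\<^sub>F (x, y) in diag X. exp (A' (x, y)) = g y / g x" by (simp add: gA case_prod_unfold)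
  qed
  then have "\<forall>\<^sub>F q in diag X. (of_real (t (snd q)) - l (snd q) / (2 * pi * \<i>)) - (of_real (t (fst q)) - l (fst q) / (2 * pi * \<i>)) =
      of_int (\<nu> q) - (\<Sum>a\<in>K. (- of_int (n a) / (2 * pi * \<i>)) * Lam a q)"
  proof eventually_elim
    case (elim q)
    obtain x y where q: "q = (x, y)" by (cases q)
    have e: "A' (x, y) = (\<Sum>a\<in>K. of_int (n a) * Lam a (x, y)) + (l y - l x)" using elim q by simp
    have 1: "of_int (\<nu> (x, y)) = of_real (t y) - of_real (t x) - A' (x, y) / (2 * pi * \<i>)"
      by (simp add: A'_def A_def)
    have 2: "(\<Sum>a\<in>K. (- of_int (n a) / (2 * pi * \<i>)) * Lam a (x, y)) =
        - (\<Sum>a\<in>K. of_int (n a) * Lam a (x, y)) / (2 * pi * \<i>)"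
      by (simp add: sum_divide_distrib sum_negf)
    show ?case unfolding q fst_conv snd_conv 1 2 e
      by (simp add: add_divide_distrib diff_divide_distrib)
  qed
  from cob_cong[OF cob_diff_function this] K show ?thesis
    unfolding log_rep_def by (intro exI[of _ K] exI[of _ "\<lambda>a. - of_int (n a) / (2 * pi * \<i>)"]) auto
qed

lemma log_rep_finite_valued_cocycle:
  fixes c :: "complex \<times> complex \<Rightarrow> complex"
  assumes X: "compact X" and L: "\<And>C. \<lbrakk>C \<in> components (- X); bounded C\<rbrakk> \<Longrightarrow> C \<inter> L \<noteq> {}"
    and \<delta>: "\<delta> > 0"
    and cocycle: "\<And>x y z. \<lbrakk>x \<in> X; y \<in> X; z \<in> X; dist x y < \<delta>; dist x z < \<delta>; dist y z < \<delta>\<rbrakk> \<Longrightarrow>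
      c (x, z) = c (x, y) + c (y, z)"
    and fin: "finite (c ` (X \<times> X))"
  shows "log_rep X L c"
proof -
  obtain B :: "complex set" and \<beta> \<nu> where B: "finite B"
    and s: "\<forall>s\<in>c ` (X \<times> X). s = (\<Sum>b\<in>B. of_int (\<nu> b s) * \<beta> b)"
    and add: "\<forall>s\<in>c ` (X \<times> X). \<forall>t\<in>c ` (X \<times> X). \<forall>u\<in>c ` (X \<times> X). \<forall>b\<in>B.
      s = t + u \<longrightarrow> \<nu> b s = \<nu> b t + \<nu> b u"
    using integral_coordinates[OF fin] by (elim exE conjE) (rule that)
  have "log_rep X L (\<lambda>q. of_int (\<nu> b (c q)))" if b: "b \<in> B" for b
  proof -
    have "finite ((\<lambda>s. \<bar>\<nu> b s\<bar>) ` c ` (X \<times> X))" using fin by simp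
    then obtain M where M: "\<forall>v\<in>(\<lambda>s. \<bar>\<nu> b s\<bar>) ` c ` (X \<times> X). v \<le> M"
      using bdd_above_finite unfolding bdd_above_def by blast
    show ?thesis
    proof (rule log_rep_integer_cocycle[OF X L \<delta>, of "\<lambda>q. \<nu> b (c q)" M])
      fix x y z assume a: "x \<in> X" "y \<in> X" "z \<in> X" "dist x y < \<delta>" "dist x z < \<delta>" "dist y z < \<delta>"
      show "\<nu> b (c (x, z)) = \<nu> b (c (x, y)) + \<nu> b (c (y, z))"
        by (rule add[rule_format, OF _ _ _ b cocycle[OF a]]) (use a in blast)+
    qed (use M in auto)
  qed
  then have "log_rep X L (\<lambda>q. \<Sum>b\<in>B. \<beta> b * of_int (\<nu> b (c q)))"
    by (intro log_rep_sum log_rep_cmult)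
  moreover have "\<forall>\<^sub>F q in diag X. (\<Sum>b\<in>B. \<beta> b * of_int (\<nu> b (c q))) = c q"
  proof (rule eventually_diagI[of 1])
    fix x y assume "x \<in> X" "y \<in> X"
    then have "c (x, y) \<in> c ` (X \<times> X)" by blast
    from bspec[OF s this] show "(\<Sum>b\<in>B. \<beta> b * of_int (\<nu> b (c (x, y)))) = c (x, y)"
      by (simp add: mult.commute)
  qed simp
  ultimately show ?thesis by (rule log_rep_cong)
qed

section \<open>Eigenclasses in the plane\<close>

text \<open>\<open>\<phi>\<close> stands for the inverse of the dynamics, so the eigenvalue equation
  gives \<open>c\<close> as \<open>\<mu>\<close> times its pull-back. In terms of punctures this
  relates the points of \<open>K\<close> to their preimages. Read in one hole \<open>H\<close>, it
  leaves one term on each side, because \<open>\<phi>\<close> maps \<open>H\<close> into one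
  complementary component and \<open>L\<close> has at most one point there.\<close>

lemma planar_eigencocycle_trivial:
  fixes c :: "complex \<times> complex \<Rightarrow> complex"
  assumes X: "compact X" and \<phi>: "continuous_on UNIV \<phi>" "inj \<phi>" "\<phi> ` X = X"
    and \<delta>: "\<delta> > 0"
    and cocycle: "\<And>x y z. \<lbrakk>x \<in> X; y \<in> X; z \<in> X; dist x y < \<delta>; dist x z < \<delta>; dist y z < \<delta>\<rbrakk> \<Longrightarrow>
      c (x, z) = c (x, y) + c (y, z)"
    and fin: "finite (c ` (X \<times> X))"
    and eig: "cob X (\<lambda>q. c q - \<mu> * c (\<phi> (fst q), \<phi> (snd q)))"
    and \<mu>: "\<mu> \<noteq> 0" "\<forall>n::nat. n > 0 \<longrightarrow> \<mu> ^ n \<noteq> 1"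
  shows "cob X c"
proof -
  define L where "L = (\<lambda>C. SOME a. a \<in> C) ` {C \<in> components (- X). bounded C}"
  have some: "(SOME a. a \<in> C) \<in> C" if "C \<in> components (- X)" for C
    using in_components_nonempty[OF that] by (simp add: some_in_eq)
  have Linj: "a = b" if ab: "a \<in> L" "b \<in> L" and C: "a \<in> C" "b \<in> C" "C \<in> components (- X)" for a b C
  proof -
    obtain A B where A: "a = (SOME a. a \<in> A)" "A \<in> components (- X)"
      and B: "b = (SOME a. a \<in> B)" "B \<in> components (- X)" using ab by (auto simp: L_def)
    have "A = C" using some[OF A(2)] A C(1,3) components_eq[of A "- X" C] by auto
    moreover have "B = C" using some[OF B(2)] B C(2,3) components_eq[of B "- X" C] by auto
    ultimately show ?thesis using A(1) B(1) by simp
  qed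
  have "C \<inter> L \<noteq> {}" if "C \<in> components (- X)" "bounded C" for C
    using some[OF that(1)] that by (auto simp: L_def)
  then have "log_rep X L c" by (intro log_rep_finite_valued_cocycle[OF X _ \<delta> cocycle fin]) auto
  then obtain K1 \<kappa> where K1: "finite K1" "K1 \<subseteq> L" "K1 \<inter> X = {}" "cob X (\<lambda>q. c q - (\<Sum>a\<in>K1. \<kappa> a * Lam a q))"
    by (auto simp: log_rep_def)
  \<comment> \<open>With nonzero coefficients only, the passage from \<open>a\<close> to
    \<open>a'\<close> in \<open>step\<close> can always be repeated.\<close>
  define K where "K = {a \<in> K1. \<kappa> a \<noteq> 0}"
  have K: "finite K" "K \<subseteq> L" "K \<inter> X = {}" using K1 by (auto simp: K_def)
  have "(\<Sum>a\<in>K1. \<kappa> a * Lam a q) = (\<Sum>a\<in>K. \<kappa> a * Lam a q)" for q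
    by (rule sum.mono_neutral_right[OF K1(1)]) (auto simp: K_def)
  then have cK: "cob X (\<lambda>q. c q - (\<Sum>a\<in>K. \<kappa> a * Lam a q))" using K1(4) by simp
  have "K = {}"
  proof (rule ccontr)
    assume Kne: "K \<noteq> {}"
    have \<phi>X: "\<phi> ` X \<subseteq> X" using \<phi>(3) by simp
    have \<phi>c: "continuous_on X \<phi>" using continuous_on_subset[OF \<phi>(1)] by simp
    define R where "R = K \<inter> range \<phi>"
    have R: "finite R" "R \<subseteq> K" using K by (auto simp: R_def)
    define b where "b a = inv_into UNIV \<phi> a" for a
    have \<phi>b: "\<phi> (b a) = a" if "a \<in> R" for a
      using that by (simp add: R_def b_def f_inv_into_f)
    have bX: "b a \<notin> X" if "a \<in> R" for a
    proof
      assume "b a \<in> X"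
      then have "a \<in> X" using \<phi>X \<phi>b[OF that] by (metis image_subset_iff)
      then show False using that R(2) K(3) by blast
    qed
    have "\<exists>e\<in>{1, -1}. cob X (\<lambda>q. Lam a (\<phi> (fst q), \<phi> (snd q)) - e * Lam (b a) q)" if a: "a \<in> R" for a
    proof -
      have "\<phi> (b a) \<notin> X" using \<phi>b[OF a] a R(2) K(3) by auto
      from cob_Lam_embedding[OF \<phi>(1,2) X \<phi>X bX[OF a] this] show ?thesis unfolding \<phi>b[OF a] .
    qed
    then have "\<forall>a\<in>R. \<exists>e. e \<in> {1, -1} \<and> cob X (\<lambda>q. Lam a (\<phi> (fst q), \<phi> (snd q)) - e * Lam (b a) q)"
      unfolding Bex_def by (intro ballI)
    from bchoice[OF this] obtain e where
      e0: "\<forall>a\<in>R. e a \<in> {1, -1} \<and> cob X (\<lambda>q. Lam a (\<phi> (fst q), \<phi> (snd q)) - e a * Lam (b a) q)"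
      by (elim exE) (rule that)
    have e: "e a \<in> {1, -1}" "cob X (\<lambda>q. Lam a (\<phi> (fst q), \<phi> (snd q)) - e a * Lam (b a) q)"
      if "a \<in> R" for a using bspec[OF e0 that] by (rule conjunct1, rule conjunct2)
    have om: "cob X (\<lambda>q. Lam a (\<phi> (fst q), \<phi> (snd q)))" if "a \<in> K - R" for a
      by (rule cob_Lam_omitted[OF \<phi>(1) X \<phi>X]) (use that K(3) in \<open>auto simp: R_def\<close>)
    define P where "P q = (\<phi> (fst q), \<phi> (snd q))" for q
    have c1: "cob X (\<lambda>q. c (P q) - (\<Sum>a\<in>K. \<kappa> a * Lam a (P q)))"
      using cob_pullback[OF cK X \<phi>c \<phi>X] by (simp add: P_def)
    have c2: "cob X (\<lambda>q. \<Sum>a\<in>R. \<kappa> a * (Lam a (P q) - e a * Lam (b a) q))"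
      unfolding P_def by (intro cob_sum cob_cmult e)
    have c3: "cob X (\<lambda>q. \<Sum>a\<in>K - R. \<kappa> a * Lam a (P q))"
      unfolding P_def by (intro cob_sum cob_cmult om)
    \<comment> \<open>A disjoint sum: a preimage \<open>b a\<close> may coincide with a point of
      \<open>K\<close>, and then both coefficients count.\<close>
    define I where "I = K <+> R"
    define p where "p i = (case i of Inl a \<Rightarrow> a | Inr a \<Rightarrow> b a)" for i
    define \<tau> where "\<tau> i = (case i of Inl a \<Rightarrow> \<kappa> a | Inr a \<Rightarrow> - \<mu> * \<kappa> a * e a)" for i
    have "cob X (\<lambda>q. (c q - \<mu> * c (P q)) + (-1) * (c q - (\<Sum>a\<in>K. \<kappa> a * Lam a q)) +
        \<mu> * ((c (P q) - (\<Sum>a\<in>K. \<kappa> a * Lam a (P q))) + (\<Sum>a\<in>R. \<kappa> a * (Lam a (P q) - e a * Lam (b a) q))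
          + (\<Sum>a\<in>K - R. \<kappa> a * Lam a (P q))))"
      using eig unfolding P_def[symmetric] by (intro cob_add cob_cmult cK c1 c2 c3)
    moreover have "(c q - \<mu> * c (P q)) + (-1) * (c q - (\<Sum>a\<in>K. \<kappa> a * Lam a q)) +
        \<mu> * ((c (P q) - (\<Sum>a\<in>K. \<kappa> a * Lam a (P q))) + (\<Sum>a\<in>R. \<kappa> a * (Lam a (P q) - e a * Lam (b a) q))
          + (\<Sum>a\<in>K - R. \<kappa> a * Lam a (P q))) = (\<Sum>i\<in>I. \<tau> i * Lam (p i) q)" for q
    proof -
      have 1: "(\<Sum>a\<in>K. \<kappa> a * Lam a (P q)) = (\<Sum>a\<in>K - R. \<kappa> a * Lam a (P q)) + (\<Sum>a\<in>R. \<kappa> a * Lam a (P q))"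
        using sum.subset_diff[OF R(2) K(1)] .
      have 2: "(\<Sum>a\<in>R. \<kappa> a * (Lam a (P q) - e a * Lam (b a) q)) =
          (\<Sum>a\<in>R. \<kappa> a * Lam a (P q)) - (\<Sum>a\<in>R. \<kappa> a * e a * Lam (b a) q)"
        by (simp add: right_diff_distrib sum_subtractf mult.assoc)
      have 3: "(\<Sum>i\<in>I. \<tau> i * Lam (p i) q) = (\<Sum>a\<in>K. \<kappa> a * Lam a q) - \<mu> * (\<Sum>a\<in>R. \<kappa> a * e a * Lam (b a) q)"
        unfolding I_def using K(1) R(1)
        by (simp add: sum.Plus \<tau>_def p_def sum_negf sum_distrib_left mult.assoc)
      show ?thesis unfolding 1 2 3 by (simp add: algebra_simps)
    qed
    ultimately have cI: "cob X (\<lambda>q. \<Sum>i\<in>I. \<tau> i * Lam (p i) q)" by (simp only:)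
    have finI: "finite I" using K(1) R(1) by (simp add: I_def)
    have pX: "p i \<notin> X" if "i \<in> I" for i
      using that K(3) bX by (auto simp: I_def p_def)
    \<comment> \<open>Squares remove the signs \<open>e\<close>. The preimage \<open>b a'\<close>
      need not be \<open>a\<close> but only lies in the same hole, which is why independence is
      stated by sums over holes.\<close>
    have step: "\<exists>a'\<in>K. (\<kappa> a')\<^sup>2 = (\<kappa> a)\<^sup>2 / \<mu>\<^sup>2" if a: "a \<in> K" for a
    proof -
      obtain H where H: "H \<in> components (- X)" "bounded H" "a = (SOME a. a \<in> H)"
        using a K(2) by (auto simp: L_def)
      have aH: "a \<in> H" using some[OF H(1)] H(3) by simp
      define J where "J = {a' \<in> R. b a' \<in> H}"
      have "{i \<in> I. p i \<in> H} = {a} <+> J"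
      proof -
        have uniq: "a' = a" if "a' \<in> K" "a' \<in> H" for a' using Linj[of a' a H] that a K(2) aH H(1) by blast
        show ?thesis using a aH by (auto simp: I_def p_def J_def dest: uniq)
      qed
      then have "(\<Sum>i\<in>{a} <+> J. \<tau> i) = 0"
        using cob_Lam_independent[OF X finI pX H(1,2) cI] by simp
      moreover have finJ: "finite J" using R(1) by (simp add: J_def)
      ultimately have s: "\<kappa> a = \<mu> * (\<Sum>a'\<in>J. \<kappa> a' * e a')"
        by (simp add: sum.Plus \<tau>_def sum_negf sum_distrib_left mult.assoc)
      have "\<kappa> a \<noteq> 0" using a by (simp add: K_def)
      then obtain a' where a': "a' \<in> J" using s by fastforce
      have "a'' = a'" if "a'' \<in> J" for a''
      proof -
        have "connected (\<phi> ` H)"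
          using in_components_connected[OF H(1)] continuous_on_subset[OF \<phi>(1)] by (intro connected_continuous_image) auto
        moreover have "\<phi> ` H \<subseteq> - X"
        proof (intro subsetI ComplI)
          fix w assume w: "w \<in> \<phi> ` H" "w \<in> X"
          then obtain z x where "z \<in> H" "x \<in> X" "\<phi> z = \<phi> x" using \<phi>(3) by (metis imageE)
          then have "z \<in> X" using \<phi>(2) by (auto dest: injD)
          then show False using \<open>z \<in> H\<close> in_components_subset[OF H(1)] by auto
        qed
        moreover have "- X \<noteq> {}" using in_components_subset[OF H(1)] aH by auto
        ultimately obtain C where C: "C \<in> components (- X)" "\<phi> ` H \<subseteq> C"
          using exists_component_superset by metis
        have "a'' \<in> C" "a' \<in> C"
          using that a' C(2) \<phi>b unfolding J_def by (metis (mono_tags, lifting) image_subset_iff mem_Collect_eq)+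
        then show ?thesis using Linj[OF _ _ _ _ C(1)] that a' R(2) K(2) by (auto simp: J_def)
      qed
      then have "J = {a'}" using a' by blast
      then have "\<kappa> a = \<mu> * (\<kappa> a' * e a')" using s by simp
      moreover have "(e a')\<^sup>2 = 1" using e(1)[of a'] a' by (auto simp: J_def)
      ultimately have "(\<kappa> a)\<^sup>2 = \<mu>\<^sup>2 * (\<kappa> a')\<^sup>2" by (simp add: power_mult_distrib)
      then show ?thesis using \<mu>(1) a' R(2) by (intro bexI[of _ a']) (auto simp: J_def)
    qed
    obtain a0 where a0: "a0 \<in> K" using Kne by blast
    define s where "s n = (\<kappa> a0)\<^sup>2 / \<mu> ^ (2 * n)" for n :: nat
    have sK: "s n \<in> (\<lambda>a. (\<kappa> a)\<^sup>2) ` K" for n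
    proof (induction n)
      case 0
      then show ?case using a0 by (simp add: s_def)
    next
      case (Suc n)
      then obtain a where a: "a \<in> K" "s n = (\<kappa> a)\<^sup>2" by blast
      then obtain a' where a': "a' \<in> K" "(\<kappa> a')\<^sup>2 = (\<kappa> a)\<^sup>2 / \<mu>\<^sup>2" using step by blast
      have "s (Suc n) = s n / \<mu>\<^sup>2" by (simp add: s_def power2_eq_square mult.commute mult.left_commute)
      then have "s (Suc n) = (\<kappa> a')\<^sup>2" using a a' by simp
      then show ?case using a'(1) by blast
    qed
    have "finite (range s)" by (rule finite_subset[of _ "(\<lambda>a. (\<kappa> a)\<^sup>2) ` K"]) (use sK K(1) in auto)
    then have "\<not> inj s" using finite_imageD[of s UNIV] by auto
    then obtain i j where ij: "i < j" "s i = s j" by (metis injI linorder_neqE_nat)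
    have "(\<kappa> a0)\<^sup>2 \<noteq> 0" using a0 by (simp add: K_def)
    then have "\<mu> ^ (2 * i) = \<mu> ^ (2 * j)" using ij(2) \<mu>(1) by (simp add: s_def field_simps)
    moreover have "\<mu> ^ (2 * j) = \<mu> ^ (2 * i) * \<mu> ^ (2 * (j - i))"
    proof -
      have "2 * j = 2 * i + 2 * (j - i)" using ij(1) by simp
      then show ?thesis by (metis power_add)
    qed
    ultimately have "\<mu> ^ (2 * (j - i)) = 1" using \<mu>(1) by simp
    then show False using \<mu>(2) ij(1) by simp
  qed
  then show ?thesis using cK by simp
qed

section \<open>Transfer from the plane to the phase space\<close>

lemma homeomorphic_maps_plane:
  assumes "M homeomorphic_space (euclidean :: (real ^ 2) topology)"
  obtains \<psi> \<psi>' where "homeomorphic_maps M (euclidean :: complex topology) \<psi> \<psi>'"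
proof -
  have "(UNIV :: (real ^ 2) set) homeomorphic (UNIV :: complex set)"
    by (simp add: homeomorphic_UNIV_UNIV)
  then obtain g h where "homeomorphism (UNIV :: (real ^ 2) set) (UNIV :: complex set) g h"
    unfolding homeomorphic_def by blast
  then have "homeomorphic_maps (euclidean :: (real ^ 2) topology) (euclidean :: complex topology) g h"
    by (simp add: homeomorphic_maps_def homeomorphism_def)
  then have "(euclidean :: (real ^ 2) topology) homeomorphic_space (euclidean :: complex topology)"
    unfolding homeomorphic_space_def by blast
  from homeomorphic_space_trans[OF assms this] show ?thesis
    unfolding homeomorphic_space_def using that by blast
qed

text \<open>Choosing a chart \<open>v y\<close> at each point turns the Cech cocycle into the
  function \<open>c [v x, v y]\<close> of two points. A finite subcover makes it finite valued, and
  a Lebesgue number gives the cocycle identity at a uniform scale. If this function is a coboundary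
  germ, its potential is a section, so the class was zero.\<close>

lemma no_planar_eigenvalue:
  fixes M :: "'a topology"
  assumes plane: "M homeomorphic_space (euclidean :: (real ^ 2) topology)"
    and hom: "homeomorphic_map (subtopology M D) M f"
    and X: "compactin M X" "X \<subseteq> D" "f ` X = X"
    and \<mu>: "\<mu> \<noteq> 0" "\<forall>n::nat. n > 0 \<longrightarrow> \<mu> ^ n \<noteq> 1"
  shows "\<not> linear_eigenvalue (cech (subtopology M X) {} 1) (cech_map (subtopology M X) {} 1 f) \<mu>"
proof
  let ?X = "subtopology M X"
  assume ev: "linear_eigenvalue (cech ?X {} 1) (cech_map ?X {} 1 f) \<mu>"
  obtain \<psi> \<psi>' where "homeomorphic_maps M (euclidean :: complex topology) \<psi> \<psi>'"
    by (rule homeomorphic_maps_plane[OF plane]) (rule that)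
  then have \<psi>: "continuous_map M euclidean \<psi>" and \<psi>': "continuous_map euclidean M \<psi>'"
    and \<psi>'\<psi>: "\<And>p. p \<in> topspace M \<Longrightarrow> \<psi>' (\<psi> p) = p" and \<psi>\<psi>': "\<And>z. \<psi> (\<psi>' z) = z"
    unfolding homeomorphic_maps_def by auto
  have \<psi>'M: "\<psi>' z \<in> topspace M" for z using \<psi>' by (auto simp: continuous_map_def)
  obtain f' where f': "homeomorphic_maps (subtopology M D) M f f'"
    using hom homeomorphic_map_maps by blast
  have XM: "X \<subseteq> topspace M" using X(1) by (rule compactin_subset_topspace)
  have tX: "topspace ?X = X" using XM by auto
  have f'c: "continuous_map M M f'" and f'D: "\<And>p. p \<in> topspace M \<Longrightarrow> f' p \<in> D"
    using f' unfolding homeomorphic_maps_def continuous_map_in_subtopology by auto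
  have ff': "f (f' p) = p" if "p \<in> topspace M" for p
    using f' that unfolding homeomorphic_maps_def by auto
  have f'f: "f' (f p) = p" if "p \<in> D" "p \<in> topspace M" for p
    using f' that unfolding homeomorphic_maps_def by auto
  have f'M: "f' p \<in> topspace M" if "p \<in> topspace M" for p
    using f'c that by (auto simp: continuous_map_def)
  have fXX: "continuous_map ?X ?X f"
  proof -
    have "continuous_map (subtopology M D) M f" using hom by (simp add: homeomorphic_imp_continuous_map)
    from continuous_map_from_subtopology_mono[OF this X(2)] show ?thesis
      using X(3) tX by (auto simp: continuous_map_in_subtopology)
  qed
  define Y where "Y = \<psi> ` X"
  have Y: "compact Y" using image_compactin[OF X(1) \<psi>] by (simp add: Y_def)
  have \<psi>'Y: "\<psi>' y \<in> X" if "y \<in> Y" for y using that \<psi>'\<psi> XM by (auto simp: Y_def)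
  have \<psi>X: "\<psi> p \<in> Y" if "p \<in> X" for p using that by (simp add: Y_def)
  \<comment> \<open>Built from the inverse \<open>f'\<close>, which is defined on all of
    \<open>M\<close>, whereas \<open>f\<close> is controlled on \<open>D\<close> only.\<close>
  define \<phi> where "\<phi> z = \<psi> (f' (\<psi>' z))" for z
  have "continuous_map euclidean euclidean (\<psi> \<circ> (f' \<circ> \<psi>'))"
    by (rule continuous_map_compose[OF continuous_map_compose[OF \<psi>' f'c] \<psi>])
  then have \<phi>1: "continuous_on UNIV \<phi>" by (simp add: \<phi>_def[abs_def] o_def)
  have \<psi>'\<phi>: "\<psi>' (\<phi> z) = f' (\<psi>' z)" for z by (simp add: \<phi>_def \<psi>'\<psi> f'M \<psi>'M)
  have f\<phi>: "f (\<psi>' (\<phi> z)) = \<psi>' z" for z by (simp add: \<psi>'\<phi> ff' \<psi>'M)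
  have \<phi>2: "inj \<phi>"
  proof (rule injI)
    fix z w assume "\<phi> z = \<phi> w"
    then have "\<psi>' z = \<psi>' w" using f\<phi> by metis
    then show "z = w" using \<psi>\<psi>' by metis
  qed
  have f'X: "f' ` X = X"
  proof -
    have "f' ` (f ` X) = (\<lambda>p. f' (f p)) ` X" by (rule image_image)
    also have "\<dots> = (\<lambda>p. p) ` X" by (rule image_cong) (use f'f X(2) XM in auto)
    finally show ?thesis using X(3) by simp
  qed
  have \<phi>3: "\<phi> ` Y = Y"
  proof -
    have "\<phi> ` Y = (\<lambda>p. \<phi> (\<psi> p)) ` X" unfolding Y_def by (rule image_image)
    also have "\<dots> = (\<lambda>p. \<psi> (f' p)) ` X" by (rule image_cong) (use \<psi>'\<psi> XM in \<open>auto simp: \<phi>_def\<close>)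
    also have "\<dots> = \<psi> ` (f' ` X)" by (rule image_image[symmetric])
    finally show ?thesis using f'X by (simp add: Y_def)
  qed
  have e0: "f ` {} \<subseteq> {}" by simp
  from ev[unfolded linear_eigenvalue_cech1_iff[OF fXX e0]]
  obtain U c h where c: "(U, c) \<in> cech_cocycles ?X {} 1"
    and h: "cech_link ?X {} f (U, \<lambda>s. \<mu> * c s) (U, c) h"
    and no: "\<not> (\<exists>s. cech_section ?X (topspace ?X) U c s \<and> (\<forall>x\<in>{}. \<forall>u\<in>U. x \<in> u \<longrightarrow> s x u = 0))"
    by (elim exE conjE) (rule that)
  note U = cech_cocycle_cover[OF c]
  have uX: "u \<subseteq> X" if "u \<in> U" for u using cech_cover_mem[OF U that] tX by blast
  have pull: "\<exists>O'. open O' \<and> (\<forall>y\<in>Y. y \<in> O' \<longleftrightarrow> \<psi>' y \<in> w)" if w: "openin ?X w" for w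
  proof -
    obtain W where W: "openin M W" "w = W \<inter> X" using w by (auto simp: openin_subtopology)
    have "openin euclidean {z \<in> topspace euclidean. \<psi>' z \<in> W}"
      using \<psi>' W(1) unfolding continuous_map_def by blast
    then have "open {z. \<psi>' z \<in> W}" by simp
    then show ?thesis using \<psi>'Y W(2) by (intro exI[of _ "{z. \<psi>' z \<in> W}"]) auto
  qed
  have "\<forall>u\<in>U. \<exists>O'. open O' \<and> (\<forall>y\<in>Y. y \<in> O' \<longleftrightarrow> \<psi>' y \<in> u)"
    using pull cech_cover_open[OF U] by blast
  from bchoice[OF this] obtain Op where
    Op0: "\<forall>u\<in>U. open (Op u) \<and> (\<forall>y\<in>Y. y \<in> Op u \<longleftrightarrow> \<psi>' y \<in> u)" by (elim exE) (rule that)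
  then have Op: "open (Op u)" "\<And>y. y \<in> Y \<Longrightarrow> y \<in> Op u \<longleftrightarrow> \<psi>' y \<in> u" if "u \<in> U" for u
    using that by blast+
  have "Y \<subseteq> (\<Union>u\<in>U. Op u)"
  proof
    fix y assume y: "y \<in> Y"
    then obtain u where "u \<in> U" "\<psi>' y \<in> u" using cech_cover_point[OF U] \<psi>'Y tX by metis
    then show "y \<in> (\<Union>u\<in>U. Op u)" using Op y by blast
  qed
  then obtain U0 where U0: "U0 \<subseteq> U" "finite U0" "Y \<subseteq> (\<Union>u\<in>U0. Op u)"
    using compactE_image[OF Y, of U Op] Op(1) by blast
  obtain e where e: "e > 0" "\<And>y. y \<in> Y \<Longrightarrow> \<exists>G\<in>Op ` U0. ball y e \<subseteq> G"
    using Heine_Borel_lemma[OF Y, of "Op ` U0"] U0(1,3) Op(1) by (metis (no_types, lifting) image_iff subsetD)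
  have "\<forall>y\<in>Y. \<exists>u. u \<in> U0 \<and> ball y e \<subseteq> Op u" using e(2) by blast
  from bchoice[OF this] obtain v where v0: "\<forall>y\<in>Y. v y \<in> U0 \<and> ball y e \<subseteq> Op (v y)"
    by (elim exE) (rule that)
  have vU: "v y \<in> U" if "y \<in> Y" for y using v0 U0(1) that by blast
  have vmem: "\<psi>' x \<in> v y" if "x \<in> Y" "y \<in> Y" "dist y x < e" for x y
  proof -
    have "x \<in> Op (v y)" using v0 that by (metis mem_ball subsetD)
    then show ?thesis using Op(2)[OF vU[OF that(2)] that(1)] by blast
  qed
  define a where "a q = c [v (fst q), v (snd q)]" for q
  have "cob Y a"
  proof (rule planar_eigencocycle_trivial[OF Y \<phi>1 \<phi>2 \<phi>3 e(1) _ _ _ \<mu>])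
    fix x y z assume t: "x \<in> Y" "y \<in> Y" "z \<in> Y" "dist x y < e" "dist x z < e" "dist y z < e"
    have "\<psi>' x \<in> v x" "\<psi>' x \<in> v y" "\<psi>' x \<in> v z"
      by (rule vmem; use t e(1) in \<open>simp add: dist_commute\<close>)+
    from cech_cocycle_add[OF c vU[OF t(1)] vU[OF t(2)] vU[OF t(3)] this]
    show "a (x, z) = a (x, y) + a (y, z)" by (simp add: a_def)
  next
    have "a ` (Y \<times> Y) \<subseteq> (\<lambda>(u, u'). c [u, u']) ` (U0 \<times> U0)"
    proof
      fix t assume "t \<in> a ` (Y \<times> Y)"
      then obtain x y where "x \<in> Y" "y \<in> Y" "t = c [v x, v y]" by (auto simp: a_def)
      then show "t \<in> (\<lambda>(u, u'). c [u, u']) ` (U0 \<times> U0)"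
        using v0 by (intro image_eqI[of _ _ "(v x, v y)"]) auto
    qed
    then show "finite (a ` (Y \<times> Y))" using U0(2) finite_surj[of "U0 \<times> U0"] by blast
  next
    have \<phi>Y: "\<phi> y \<in> Y" if "y \<in> Y" for y using \<phi>3 that by blast
    \<comment> \<open>\<open>h\<close> is locally constant in fixed charts, but the charts used in
      \<open>\<theta>\<close> jump from point to point. A Lebesgue number for the sets
      \<open>G\<close> lets nearby points be compared through common charts \<open>u1\<close> and
      \<open>v1\<close>.\<close>
    have "\<forall>z\<in>Y. \<exists>G. open G \<and> z \<in> G \<and> (\<exists>u1\<in>U. \<exists>v1\<in>U. \<exists>k. \<forall>y\<in>G \<inter> Y.
        \<psi>' (\<phi> y) \<in> u1 \<and> \<psi>' y \<in> v1 \<and> h (\<psi>' (\<phi> y)) u1 v1 = k)"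
    proof
      fix z assume z: "z \<in> Y"
      let ?q = "\<psi>' (\<phi> z)"
      obtain u1 where u1: "u1 \<in> U" "?q \<in> u1" using cech_cover_point[OF U] \<psi>'Y[OF \<phi>Y[OF z]] tX by metis
      obtain v1 where v1: "v1 \<in> U" "\<psi>' z \<in> v1" using cech_cover_point[OF U] \<psi>'Y[OF z] tX by metis
      have "f ?q \<in> v1" using v1(2) f\<phi> by simp
      from cech_link_locally_const[OF h u1(1) v1(1) u1(2) this]
      obtain w where w: "openin ?X w" "?q \<in> w" "\<forall>p\<in>w. p \<in> u1 \<and> f p \<in> v1 \<longrightarrow> h p u1 v1 = h ?q u1 v1"
        by (elim exE conjE) (rule that)
      have "openin ?X (w \<inter> u1)" using w(1) cech_cover_open[OF U u1(1)] by blast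
      from pull[OF this] obtain G where G: "open G" "\<forall>y\<in>Y. y \<in> G \<longleftrightarrow> \<psi>' y \<in> w \<inter> u1" by blast
      have G': "open (\<phi> -` G)" using \<phi>1 G(1) by (simp add: open_vimage)
      show "\<exists>G. open G \<and> z \<in> G \<and> (\<exists>u1\<in>U. \<exists>v1\<in>U. \<exists>k. \<forall>y\<in>G \<inter> Y.
        \<psi>' (\<phi> y) \<in> u1 \<and> \<psi>' y \<in> v1 \<and> h (\<psi>' (\<phi> y)) u1 v1 = k)"
      proof (rule exI[of _ "\<phi> -` G \<inter> Op v1"], intro conjI, rule_tac [3] bexI[OF _ u1(1)],
          rule_tac [3] bexI[OF _ v1(1)], rule_tac [3] exI[of _ "h ?q u1 v1"], rule_tac [3] ballI,
          rule_tac [3] conjI, rule_tac [4] conjI)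
        show "open (\<phi> -` G \<inter> Op v1)" using G' Op(1)[OF v1(1)] by blast
        show "z \<in> \<phi> -` G \<inter> Op v1" using G(2) \<phi>Y[OF z] w(2) u1(2) Op(2)[OF v1(1) z] v1(2) by blast
        fix y assume y: "y \<in> \<phi> -` G \<inter> Op v1 \<inter> Y"
        have 1: "\<psi>' (\<phi> y) \<in> w \<inter> u1" using y G(2) \<phi>Y by blast
        have 2: "\<psi>' y \<in> v1" using y Op(2)[OF v1(1)] by blast
        show "\<psi>' (\<phi> y) \<in> u1" "\<psi>' y \<in> v1" using 1 2 by auto
        show "h (\<psi>' (\<phi> y)) u1 v1 = h ?q u1 v1"
          by (rule w(3)[rule_format]) (use 1 2 f\<phi> in auto)
      qed
    qed
    from bchoice[OF this] obtain G where G0: "\<forall>z\<in>Y. open (G z) \<and> z \<in> G z \<and> (\<exists>u1\<in>U. \<exists>v1\<in>U. \<exists>k. \<forall>y\<in>G z \<inter> Y.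
        \<psi>' (\<phi> y) \<in> u1 \<and> \<psi>' y \<in> v1 \<and> h (\<psi>' (\<phi> y)) u1 v1 = k)"
      by (elim exE) (rule that)
    then have "Y \<subseteq> \<Union>(G ` Y)" "\<And>S. S \<in> G ` Y \<Longrightarrow> open S" by blast+
    then obtain e2 where e2: "e2 > 0" "\<forall>y\<in>Y. \<exists>S\<in>G ` Y. ball y e2 \<subseteq> S"
      using Heine_Borel_lemma[OF Y, of "G ` Y"] by metis
    \<comment> \<open>The link at \<open>\<psi>' (\<phi> x)\<close>, a point that \<open>f\<close>
      maps to \<open>\<psi>' x\<close>, in the charts chosen for \<open>\<phi> x\<close> and
      \<open>x\<close>.\<close>
    define \<theta> where "\<theta> x = h (\<psi>' (\<phi> x)) (v (\<phi> x)) (v x)" for x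
    have "\<forall>\<^sub>F q in diag Y. dist (fst q) (snd q) < e \<and> fst q \<in> Y \<and> snd q \<in> Y"
      by (rule eventually_diagI[OF e(1)]) auto
    note E1 = this
    have \<phi>c: "continuous_on Y \<phi>" using continuous_on_subset[OF \<phi>1] by simp
    have E2: "\<forall>\<^sub>F q in diag Y. dist (\<phi> (fst q)) (\<phi> (snd q)) < e"
      using eventually_compose_filterlim[OF E1 filterlim_diag[OF Y \<phi>c]] \<phi>3
      by (auto simp: case_prod_unfold elim: eventually_mono)
    have E3: "\<forall>\<^sub>F q in diag Y. dist (fst q) (snd q) < e2"
      by (rule eventually_diagI[OF e2(1)]) auto
    from E1 E2 E3
    have "\<forall>\<^sub>F q in diag Y. \<theta> (snd q) - \<theta> (fst q) = a q - \<mu> * a (\<phi> (fst q), \<phi> (snd q))"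
    proof eventually_elim
      case (elim q)
      obtain x y where q: "q = (x, y)" by (cases q)
      have xy: "x \<in> Y" "y \<in> Y" "dist x y < e" "dist (\<phi> x) (\<phi> y) < e" "dist x y < e2" using elim q by auto
      obtain z where z: "z \<in> Y" "ball x e2 \<subseteq> G z" using e2(2) xy(1) by blast
      have Gz: "x \<in> G z" "y \<in> G z" using z(2) xy(5) e2(1) by auto
      obtain u1 v1 k where u1: "u1 \<in> U" and v1: "v1 \<in> U" and
        k: "\<forall>y\<in>G z \<inter> Y. \<psi>' (\<phi> y) \<in> u1 \<and> \<psi>' y \<in> v1 \<and> h (\<psi>' (\<phi> y)) u1 v1 = k"
        using bspec[OF G0 z(1)] by (elim conjE bexE exE) (rule that)
      have kx: "\<psi>' (\<phi> x) \<in> u1" "\<psi>' x \<in> v1" "h (\<psi>' (\<phi> x)) u1 v1 = k"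
        and ky: "\<psi>' (\<phi> y) \<in> u1" "\<psi>' y \<in> v1" "h (\<psi>' (\<phi> y)) u1 v1 = k"
        using bspec[OF k, of x] bspec[OF k, of y] Gz xy by auto
      note \<phi>xy = \<phi>Y[OF xy(1)] \<phi>Y[OF xy(2)]
      have vx: "\<psi>' x \<in> v x" and vy: "\<psi>' y \<in> v y" and vxy: "\<psi>' y \<in> v x"
        and wx: "\<psi>' (\<phi> x) \<in> v (\<phi> x)" and wy: "\<psi>' (\<phi> y) \<in> v (\<phi> y)" and wxy: "\<psi>' (\<phi> y) \<in> v (\<phi> x)"
        by (rule vmem; use xy \<phi>xy e(1) in simp)+
      have A: "\<theta> y = k - \<mu> * c [u1, v (\<phi> y)] + c [v1, v y]"
        unfolding \<theta>_def ky(3)[symmetric]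
        by (rule cech_link_change[OF h u1 vU[OF \<phi>xy(2)] v1 vU[OF xy(2)] ky(1) wy])
          (use f\<phi> ky vy in auto)
      have B: "\<theta> x = k - \<mu> * c [u1, v (\<phi> x)] + c [v1, v x]"
        unfolding \<theta>_def kx(3)[symmetric]
        by (rule cech_link_change[OF h u1 vU[OF \<phi>xy(1)] v1 vU[OF xy(1)] kx(1) wx])
          (use f\<phi> kx vx in auto)
      have C: "c [u1, v (\<phi> y)] = c [u1, v (\<phi> x)] + c [v (\<phi> x), v (\<phi> y)]"
        by (rule cech_cocycle_add[OF c u1 vU[OF \<phi>xy(1)] vU[OF \<phi>xy(2)] ky(1) wxy wy])
      have D: "c [v1, v y] = c [v1, v x] + c [v x, v y]"
        by (rule cech_cocycle_add[OF c v1 vU[OF xy(1)] vU[OF xy(2)] ky(2) vxy vy])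
      show ?case unfolding q fst_conv snd_conv A B C D a_def by (simp add: algebra_simps)
    qed
    from cob_cong[OF cob_diff_function this]
    show "cob Y (\<lambda>q. a q - \<mu> * a (\<phi> (fst q), \<phi> (snd q)))" .
  qed
  then obtain \<theta> where "\<forall>\<^sub>F q in diag Y. a q = \<theta> (snd q) - \<theta> (fst q)" by (auto simp: cob_def)
  then obtain d where d: "d > 0" "\<And>x y. \<lbrakk>x \<in> Y; y \<in> Y; dist x y < d\<rbrakk> \<Longrightarrow> a (x, y) = \<theta> y - \<theta> x"
    unfolding eventually_diag by auto
  \<comment> \<open>The potential is taken as the value in the chart \<open>v (\<psi> p)\<close> and
    moved to \<open>w\<close> by the transition function. When \<open>p\<close> moves, the increment
    of the potential cancels the change of chart.\<close>
  define s where "s p w = \<theta> (\<psi> p) + c [v (\<psi> p), w]" for p w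
  have vp: "p \<in> v (\<psi> p)" if "p \<in> X" for p
    using vmem[OF \<psi>X[OF that] \<psi>X[OF that]] e(1) \<psi>'\<psi> XM that by auto
  have "cech_section ?X X U c s"
  proof (rule cech_sectionI)
    fix p u w assume t: "p \<in> X" "u \<in> U" "w \<in> U" "p \<in> u" "p \<in> w"
    from cech_cocycle_add[OF c vU[OF \<psi>X[OF t(1)]] t(2,3) vp[OF t(1)] t(4,5)]
    show "s p w = s p u + c [u, w]" by (simp add: s_def)
  next
    fix p u assume t: "p \<in> X" "u \<in> U" "p \<in> u"
    define r where "r = min d e"
    have r: "r > 0" "r \<le> d" "r \<le> e" using d(1) e(1) by (auto simp: r_def)
    have "openin M {q \<in> topspace M. \<psi> q \<in> ball (\<psi> p) r}"
      using \<psi> unfolding continuous_map_def by (metis open_ball open_openin)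
    then have op: "openin ?X ({q \<in> topspace M. \<psi> q \<in> ball (\<psi> p) r} \<inter> X)" by (rule openin_subtopology_Int)
    show "\<exists>w. openin ?X w \<and> p \<in> w \<and> (\<forall>q\<in>w \<inter> X. q \<in> u \<longrightarrow> s q u = s p u)"
    proof (intro exI conjI ballI impI)
      show "openin ?X ({q \<in> topspace M. \<psi> q \<in> ball (\<psi> p) r} \<inter> X)" by (rule op)
      show "p \<in> {q \<in> topspace M. \<psi> q \<in> ball (\<psi> p) r} \<inter> X" using t r XM by auto
      fix q assume q0: "q \<in> {q \<in> topspace M. \<psi> q \<in> ball (\<psi> p) r} \<inter> X \<inter> X" and qu: "q \<in> u"
      then have q: "q \<in> X" "dist (\<psi> p) (\<psi> q) < r" by auto
      have "\<psi>' (\<psi> q) \<in> v (\<psi> p)" by (rule vmem) (use q r \<psi>X t in auto)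
      then have qv: "q \<in> v (\<psi> p)" using \<psi>'\<psi> q XM by auto
      have "c [v (\<psi> p), u] = c [v (\<psi> p), v (\<psi> q)] + c [v (\<psi> q), u]"
        by (rule cech_cocycle_add[OF c vU[OF \<psi>X[OF t(1)]] vU[OF \<psi>X[OF q(1)]] t(2) qv vp[OF q(1)] qu])
      moreover have "c [v (\<psi> p), v (\<psi> q)] = \<theta> (\<psi> q) - \<theta> (\<psi> p)"
        using d(2)[of "\<psi> p" "\<psi> q"] q r \<psi>X t by (simp add: a_def)
      ultimately show "s q u = s p u" by (simp add: s_def)
    qed
  qed
  then show False using no unfolding tX by auto
qed

theorem theorem7:
  fixes M :: "'a topology" and D X :: "'a set" and f :: "'a \<Rightarrow> 'a" and \<mu> :: complex
  assumes "locally_compact_space M" and "paracompact_space M" and "Hausdorff_space M"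
    and "openin M D" and "continuous_map (subtopology M D) M f"
    and "isolated_invariant_set M D f X"
    and "\<exists>N L. index_pair M D f X N L \<and> finite_dimensional_cech (pointed_quotient M N L)"
    and "conley_index1_nonzero_eigenvalue M D f X \<mu>"
    and "\<forall>n::nat. n > 0 \<longrightarrow> \<mu> ^ n \<noteq> 1"
  shows "(infinite (connected_components_of (subtopology M X)) \<or>
          linear_eigenvalue (cech (subtopology M X) {} 1) (cech_map (subtopology M X) {} 1 f) \<mu>) \<and>
         (M homeomorphic_space (euclidean :: (real ^ 2) topology) \<and>
            homeomorphic_map (subtopology M D) M f \<longrightarrow>
          infinite (connected_components_of (subtopology M X)) \<and>
          \<not> linear_eigenvalue (cech (subtopology M X) {} 1) (cech_map (subtopology M X) {} 1 f) \<mu>)"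
proof -
  obtain N L where \<mu>: "\<mu> \<noteq> 0" and ip: "index_pair M D f X N L"
    and ev: "linear_eigenvalue (cech (pointed_quotient M N L) {None} 1)
        (cech_map (pointed_quotient M N L) {None} 1 (index_map f N L)) \<mu>"
    using assms(8) unfolding conley_index1_nonzero_eigenvalue_def by blast
  interpret index_pair_context M D X N L f
    by unfold_locales (fact assms ip)+
  have "X \<subseteq> D" using XNL ND by blast
  then show ?thesis
    using eigenvalue_on_invariant_set[OF _ \<mu> assms(9) ev]
      no_planar_eigenvalue[OF _ _ X_compact _ fX \<mu> assms(9)] by blast
qed

end
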